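(* Let $\mathbb{F}$ be a field. There exists a matrix $B\in\mathbb{R}^{5\times 5}$ with tropical rank $\mathrm{trop}(B)=3$ and Kapranov rank (with respect to the ground field $\mathbb{F}$) $\mathrm{K}_{\mathbb{F}}(B)=4$ if and only if $\mathbb{F}$ contains at most three elements.
   Context: For a field $\mathbb{F}$, let $\mathbf{H}_{\mathbb{F}}$ denote the field of formal sums $a(t)=\sum_{e\in\mathbb{R}}a_e t^e$ with coefficients $a_e\in\mathbb{F}$ whose support $E(a)=\{e\in\mathbb{R}: a_e\neq 0\}$ is a well-ordered subset of $\mathbb{R}$ (usual addition and multiplication of generalized power series, i.e. Hahn series with value group $\mathbb{R}$). Write $\mathbf{H}_{\mathbb{F}}^*$ for its set of nonzero elements. For $a\in\mathbf{H}_{\mathbb{F}}^*$, the degree is $\deg a=\min E(a)$. For a matrix $A\in(\mathbf{H}_{\mathbb{F}}^* )^{m\times n}$, $\deg A\in\mathbb{R}^{m\times n}$ is obtained by applying $\deg$ entrywise. The Kapranov rank of $B\in\mathbb{R}^{m\times n}$ with respect to the ground field $\mathbb{F}$ is $$\mathrm{K}_{\mathbb{F}}(B)=\min\{\mathrm{rank}(A) : A\in(\mathbf{H}_{\mathbb{F}}^* )^{m\times n},\ \deg A=B\},$$ where $\mathrm{rank}$ is the usual rank of matrices over the field $\mathbf{H}_{\mathbb{F}}$. A square matrix $B\in\mathbb{R}^{r\times r}$ is tropically non-singular if the minimum $\min_{\sigma\in S_r}\{b_{1,\sigma(1)}+\cdots+b_{r,\sigma(r)}\}$ is attained by exactly one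 permutation $\sigma$; otherwise (the minimum is attained at least twice) it is tropically singular. The tropical rank $\mathrm{trop}(M)$ of $M\in\mathbb{R}^{p\times q}$ is the largest $r$ such that $M$ contains a tropically non-singular $r\times r$ submatrix. *)

theory Defs
  imports "HOL-Analysis.Analysis" "Jordan_Normal_Form.DL_Rank" "Jordan_Normal_Form.DL_Submatrix"
begin

definition well_ordered :: "real set \<Rightarrow> bool" where
  "well_ordered S \<longleftrightarrow> (\<forall>T. T \<subseteq> S \<longrightarrow> T \<noteq> {} \<longrightarrow> (\<exists>m\<in>T. \<forall>x\<in>T. m \<le> x))"

lemma well_ordered_subset: "well_ordered S \<Longrightarrow> T \<subseteq> S \<Longrightarrow> well_ordered T"
  unfolding well_ordered_def by blast

lemma well_ordered_least:
  assumes "well_ordered S" "S \<noteq> {}"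
  obtains m where "m \<in> S" "\<And>x. x \<in> S \<Longrightarrow> m \<le> x"
proof -
  have "\<exists>m\<in>S. \<forall>x\<in>S. m \<le> x" using assms unfolding well_ordered_def by simp
  then show ?thesis using that by auto
qed

lemma well_ordered_empty [simp]: "well_ordered {}"
  unfolding well_ordered_def by blast

lemma well_ordered_singleton [simp]: "well_ordered {x}"
  unfolding well_ordered_def by blast

lemma well_ordered_no_descent:
  fixes f :: "nat \<Rightarrow> real"
  assumes "well_ordered S" "\<And>n. f n \<in> S" "\<And>n. f (Suc n) < f n"
  shows False
proof -
  have "range f \<subseteq> S" using assms(2) by auto
  from well_ordered_subset[OF assms(1) this]
  obtain m where "m \<in> range f" "\<And>x. x \<in> range f \<Longrightarrow> m \<le> x"
    by (rule well_ordered_least) auto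
  then obtain k where "\<And>n. f k \<le> f n" by auto
  then show False using assms(3)[of k] by (simp add: not_less[symmetric])
qed

lemma well_orderedI_no_descent:
  assumes "\<And>f :: nat \<Rightarrow> real. (\<And>n. f n \<in> S) \<Longrightarrow> (\<And>n. f (Suc n) < f n) \<Longrightarrow> False"
  shows "well_ordered S"
proof (rule ccontr)
  assume "\<not> well_ordered S"
  then obtain T where T: "T \<subseteq> S" "T \<noteq> {}" "\<forall>m\<in>T. \<exists>x\<in>T. x < m"
    unfolding well_ordered_def by (meson not_le)
  then obtain g where g: "\<And>m. m \<in> T \<Longrightarrow> g m \<in> T \<and> g m < m" by metis
  obtain t where t: "t \<in> T" using T by blast
  define f where "f n = (g ^^ n) t" for n
  have "f n \<in> T" for n by (induction n) (auto simp: f_def t g)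
  then show False using assms[of f] g T(1) by (auto simp: f_def)
qed

lemma well_ordered_incseq:
  fixes f :: "nat \<Rightarrow> real"
  assumes wo: "well_ordered S" and f: "\<And>n. f n \<in> S"
  obtains r :: "nat \<Rightarrow> nat" where "strict_mono r" "incseq (f \<circ> r)"
proof -
  obtain r :: "nat \<Rightarrow> nat" where r: "strict_mono r" "monoseq (f \<circ> r)"
    using seq_monosub[of f] by (auto simp: o_def)
  show thesis
  proof (cases "incseq (f \<circ> r)")
    case True
    then show ?thesis using that r by blast
  next
    case False
    then have dec: "decseq (f \<circ> r)" using r(2) by (simp add: monoseq_iff)
    have "range (f \<circ> r) \<subseteq> S" using f by auto
    from well_ordered_subset[OF wo this]
    obtain m where "m \<in> range (f \<circ> r)" "\<And>x. x \<in> range (f \<circ> r) \<Longrightarrow> m \<le> x"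
      by (rule well_ordered_least) auto
    then obtain k where k: "\<And>n. f (r k) \<le> f (r n)" by auto
    have const: "f (r (k + n)) = f (r k)" for n
      using k[of "k + n"] decseqD[OF dec, of k "k + n"] by auto
    show ?thesis
    proof (rule that[of "\<lambda>n. r (k + n)"])
      show "strict_mono (\<lambda>n. r (k + n))" using r(1) by (simp add: strict_mono_def)
      show "incseq (f \<circ> (\<lambda>n. r (k + n)))" by (simp add: incseq_def const)
    qed
  qed
qed

lemma well_ordered_Un:
  assumes "well_ordered S" "well_ordered T"
  shows "well_ordered (S \<union> T)"
  unfolding well_ordered_def
proof (intro allI impI)
  fix U assume U: "U \<subseteq> S \<union> T" "U \<noteq> {}"
  show "\<exists>m\<in>U. \<forall>x\<in>U. m \<le> x"
  proof (cases "U \<inter> S = {} \<or> U \<inter> T = {}")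
    case True
    then have "U \<subseteq> T \<or> U \<subseteq> S" using U by blast
    then show ?thesis using assms U unfolding well_ordered_def by blast
  next
    case False
    then obtain m n where mn: "m \<in> U \<inter> S" "\<forall>x\<in>U \<inter> S. m \<le> x" "n \<in> U \<inter> T" "\<forall>x\<in>U \<inter> T. n \<le> x"
      using assms unfolding well_ordered_def by (meson inf_le2)
    have "min m n \<in> U" using mn by (auto simp: min_def)
    moreover have "\<forall>x\<in>U. min m n \<le> x" using mn U by (auto simp: min_le_iff_disj)
    ultimately show ?thesis by blast
  qed
qed

definition sumset :: "real set \<Rightarrow> real set \<Rightarrow> real set" where
  "sumset S T = {x + y | x y. x \<in> S \<and> y \<in> T}"

lemma sumsetI: "x \<in> S \<Longrightarrow> y \<in> T \<Longrightarrow> z = x + y \<Longrightarrow> z \<in> sumset S T"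
  unfolding sumset_def by blast

lemma well_ordered_sumset:
  assumes "well_ordered S" "well_ordered T"
  shows "well_ordered (sumset S T)"
proof (rule well_orderedI_no_descent)
  fix f :: "nat \<Rightarrow> real"
  assume f: "\<And>n. f n \<in> sumset S T" and dec: "\<And>n. f (Suc n) < f n"
  have "\<forall>n. \<exists>x y. x \<in> S \<and> y \<in> T \<and> f n = x + y" using f unfolding sumset_def by blast
  then obtain x y where xy: "\<And>n. x n \<in> S" "\<And>n. y n \<in> T" "\<And>n. f n = x n + y n" by metis
  obtain r where r: "strict_mono r" "incseq (x \<circ> r)"
    using well_ordered_incseq[of S x] assms xy by blast
  obtain q where q: "strict_mono q" "incseq (y \<circ> r \<circ> q)"
    using well_ordered_incseq[of T "y \<circ> r"] assms(2) xy(2) by auto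
  have "x (r (q 0)) \<le> x (r (q 1))"
    using incseqD[OF r(2), of "q 0" "q 1"] q(1) by (simp add: strict_mono_less_eq)
  moreover have "y (r (q 0)) \<le> y (r (q 1))"
    using incseqD[OF q(2), of 0 1] by simp
  moreover have "r (q 0) < r (q 1)" using r q by (simp add: strict_mono_less)
  then have "f (r (q 1)) < f (r (q 0))"
    using lift_Suc_mono_less[of "\<lambda>n. - f n" "r (q 0)" "r (q 1)"] dec by simp
  ultimately show False using xy(3) by simp
qed

lemma well_ordered_finite_fibre:
  assumes "well_ordered S" "well_ordered T"
  shows "finite {d \<in> S. e - d \<in> T}"
proof (rule ccontr)
  assume "infinite {d \<in> S. e - d \<in> T}"
  then obtain f :: "nat \<Rightarrow> real" where f: "inj f" "range f \<subseteq> {d \<in> S. e - d \<in> T}"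
    using infinite_countable_subset by blast
  have fS: "f n \<in> S" "e - f n \<in> T" for n using f by auto
  obtain r where r: "strict_mono r" "incseq (f \<circ> r)"
    using well_ordered_incseq[of S f] assms fS by blast
  have "f (r n) < f (r (Suc n))" for n
  proof -
    have "f (r n) \<le> f (r (Suc n))" using incseqD[OF r(2), of n "Suc n"] by simp
    moreover have "r n \<noteq> r (Suc n)" using r(1) by (simp add: strict_mono_eq)
    then have "f (r n) \<noteq> f (r (Suc n))" using f(1) by (simp add: inj_eq)
    ultimately show ?thesis by simp
  qed
  then show False
    using well_ordered_no_descent[of T "\<lambda>n. e - f (r n)"] assms fS by simp
qed

typedef (overloaded) 'a hahn = "{f :: real \<Rightarrow> 'a::zero. well_ordered {e. f e \<noteq> 0}}"
  morphisms hcoeff Abs_hahn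
  by (rule exI[of _ "\<lambda>_. 0"]) simp

setup_lifting type_definition_hahn

definition hsupp :: "'a::zero hahn \<Rightarrow> real set" where
  "hsupp a = {e. hcoeff a e \<noteq> 0}"

lemma well_ordered_hsupp: "well_ordered (hsupp a)"
  using hcoeff[of a] by (simp add: hsupp_def)

lemma hcoeff_outside: "e \<notin> hsupp a \<Longrightarrow> hcoeff a e = 0"
  by (simp add: hsupp_def)

lemma hahn_eqI: "(\<And>e. hcoeff a e = hcoeff b e) \<Longrightarrow> a = b"
  using hcoeff_inject[of a b] by blast

lemma conv_supp:
  fixes f g :: "real \<Rightarrow> 'a::semiring_0"
  shows "{e. (\<Sum>d | f d \<noteq> 0 \<and> g (e - d) \<noteq> 0. f d * g (e - d)) \<noteq> 0}
    \<subseteq> sumset {e. f e \<noteq> 0} {e. g e \<noteq> 0}"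
proof
  fix e assume "e \<in> {e. (\<Sum>d | f d \<noteq> 0 \<and> g (e - d) \<noteq> 0. f d * g (e - d)) \<noteq> 0}"
  then have "{d. f d \<noteq> 0 \<and> g (e - d) \<noteq> 0} \<noteq> {}" by force
  then obtain d where "f d \<noteq> 0" "g (e - d) \<noteq> 0" by blast
  then show "e \<in> sumset {e. f e \<noteq> 0} {e. g e \<noteq> 0}"
    unfolding sumset_def mem_Collect_eq by (intro exI[of _ d] exI[of _ "e - d"]) auto
qed

instantiation hahn :: (comm_ring_1) comm_ring_1
begin

lift_definition zero_hahn :: "'a hahn" is "\<lambda>_. 0" by simp

lift_definition one_hahn :: "'a hahn" is "\<lambda>e. if e = 0 then 1 else 0" by simp

lift_definition plus_hahn :: "'a hahn \<Rightarrow> 'a hahn \<Rightarrow> 'a hahn" is "\<lambda>f g e. f e + g e"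
proof -
  fix f g :: "real \<Rightarrow> 'a"
  assume "well_ordered {e. f e \<noteq> 0}" "well_ordered {e. g e \<noteq> 0}"
  then have "well_ordered ({e. f e \<noteq> 0} \<union> {e. g e \<noteq> 0})" by (rule well_ordered_Un)
  then show "well_ordered {e. f e + g e \<noteq> 0}" by (rule well_ordered_subset) auto
qed

lift_definition uminus_hahn :: "'a hahn \<Rightarrow> 'a hahn" is "\<lambda>f e. - f e" by simp

lift_definition minus_hahn :: "'a hahn \<Rightarrow> 'a hahn \<Rightarrow> 'a hahn" is "\<lambda>f g e. f e - g e"
proof -
  fix f g :: "real \<Rightarrow> 'a"
  assume "well_ordered {e. f e \<noteq> 0}" "well_ordered {e. g e \<noteq> 0}"
  then have "well_ordered ({e. f e \<noteq> 0} \<union> {e. g e \<noteq> 0})" by (rule well_ordered_Un)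
  then show "well_ordered {e. f e - g e \<noteq> 0}" by (rule well_ordered_subset) auto
qed

text \<open>The index set of the sum is finite, see \<open>well_ordered_finite_fibre\<close>.\<close>

lift_definition times_hahn :: "'a hahn \<Rightarrow> 'a hahn \<Rightarrow> 'a hahn" is
  "\<lambda>f g e. \<Sum>d | f d \<noteq> 0 \<and> g (e - d) \<noteq> 0. f d * g (e - d)"
  by (rule well_ordered_subset[OF well_ordered_sumset conv_supp])

lemma hcoeff_times:
  assumes "well_ordered S" "well_ordered T" "hsupp a \<subseteq> S" "hsupp b \<subseteq> T"
  shows "hcoeff (a * b) e = (\<Sum>d | d \<in> S \<and> e - d \<in> T. hcoeff a d * hcoeff b (e - d))"
  unfolding times_hahn.rep_eq
  by (rule sum.mono_neutral_left)
    (use assms well_ordered_finite_fibre[of S T e] in \<open>auto simp: hsupp_def\<close>)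

lemma hsupp_times: "hsupp (a * b) \<subseteq> sumset (hsupp a) (hsupp (b :: 'a hahn))"
  unfolding hsupp_def times_hahn.rep_eq by (rule conv_supp)

instance
proof
  fix a b c :: "'a hahn"
  note wo = well_ordered_hsupp
  show "a * b * c = a * (b * c)"
  proof (rule hahn_eqI)
    fix e
    let ?A = "hsupp a" and ?B = "hsupp b" and ?C = "hsupp c"
    let ?X = "{s. s \<in> sumset ?A ?B \<and> e - s \<in> ?C}"
    let ?Y = "{d. d \<in> ?A \<and> e - d \<in> sumset ?B ?C}"
    have finX: "finite ?X" and finY: "finite ?Y"
      using well_ordered_finite_fibre well_ordered_sumset wo by blast+
    have "hcoeff (a * b * c) e = (\<Sum>s\<in>?X. hcoeff (a * b) s * hcoeff c (e - s))"
      by (rule hcoeff_times) (auto intro: well_ordered_sumset wo hsupp_times[THEN subsetD])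
    also have "\<dots> = (\<Sum>s\<in>?X. \<Sum>d | d \<in> ?A \<and> s - d \<in> ?B. hcoeff a d * hcoeff b (s - d) * hcoeff c (e - s))"
      by (simp add: hcoeff_times[OF wo wo order_refl order_refl] sum_distrib_right)
    also have "\<dots> = (\<Sum>(s,d)\<in>(SIGMA s:?X. {d. d \<in> ?A \<and> s - d \<in> ?B}). hcoeff a d * hcoeff b (s - d) * hcoeff c (e - s))"
      by (rule sum.Sigma) (use finX well_ordered_finite_fibre[OF wo wo] in auto)
    also have "\<dots> = (\<Sum>(d,u)\<in>(SIGMA d:?Y. {u. u \<in> ?B \<and> e - d - u \<in> ?C}). hcoeff a d * (hcoeff b u * hcoeff c (e - d - u)))"
      by (rule sum.reindex_bij_witness[of _ "\<lambda>(d,u). (d + u, d)" "\<lambda>(s,d). (d, s - d)"])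
        (auto simp: mult.assoc diff_diff_eq intro: sumsetI)
    also have "\<dots> = (\<Sum>d\<in>?Y. \<Sum>u | u \<in> ?B \<and> e - d - u \<in> ?C. hcoeff a d * (hcoeff b u * hcoeff c (e - d - u)))"
      by (rule sum.Sigma[symmetric]) (use finY well_ordered_finite_fibre[OF wo wo] in auto)
    also have "\<dots> = (\<Sum>d\<in>?Y. hcoeff a d * hcoeff (b * c) (e - d))"
      by (simp add: hcoeff_times[OF wo wo order_refl order_refl] sum_distrib_left)
    also have "\<dots> = hcoeff (a * (b * c)) e"
      by (rule hcoeff_times[symmetric]) (auto intro: well_ordered_sumset wo hsupp_times[THEN subsetD])
    finally show "hcoeff (a * b * c) e = hcoeff (a * (b * c)) e" .
  qed
  show "a * b = b * a"
  proof (rule hahn_eqI)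
    fix e
    show "hcoeff (a * b) e = hcoeff (b * a) e"
      unfolding times_hahn.rep_eq
      by (rule sum.reindex_bij_witness[of _ "\<lambda>d. e - d" "\<lambda>d. e - d"]) (auto simp: mult.commute)
  qed
  show "(a + b) * c = a * c + b * c"
  proof (rule hahn_eqI)
    fix e
    let ?S = "hsupp a \<union> hsupp b"
    have S: "well_ordered ?S" by (simp add: well_ordered_Un wo)
    have sub: "hsupp (a + b) \<subseteq> ?S" by (auto simp: hsupp_def plus_hahn.rep_eq)
    show "hcoeff ((a + b) * c) e = hcoeff (a * c + b * c) e"
      unfolding plus_hahn.rep_eq hcoeff_times[OF S wo sub order_refl]
        hcoeff_times[OF S wo Un_upper1 order_refl] hcoeff_times[OF S wo Un_upper2 order_refl]
      by (simp only: distrib_right sum.distrib)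
  qed
  show "1 * a = a"
  proof (rule hahn_eqI)
    fix e
    have *: "hsupp (1 :: 'a hahn) \<subseteq> {0}" by (auto simp: hsupp_def one_hahn.rep_eq)
    have "hcoeff (1 * a) e = (\<Sum>d | d \<in> {0} \<and> e - d \<in> hsupp a. hcoeff 1 d * hcoeff a (e - d))"
      by (rule hcoeff_times) (use * wo in auto)
    also have "{d. d \<in> {0} \<and> e - d \<in> hsupp a} = (if e \<in> hsupp a then {0} else {})" by auto
    finally show "hcoeff (1 * a) e = hcoeff a e"
      by (auto simp: one_hahn.rep_eq hcoeff_outside)
  qed
  show "(0 :: 'a hahn) \<noteq> 1"
  proof
    assume "(0 :: 'a hahn) = 1"
    then have "hcoeff (0 :: 'a hahn) 0 = hcoeff 1 0" by simp
    then show False by (simp add: zero_hahn.rep_eq one_hahn.rep_eq)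
  qed
  show "a + b + c = a + (b + c)" by (rule hahn_eqI) (simp add: plus_hahn.rep_eq add.assoc)
  show "a + b = b + a" by (rule hahn_eqI) (simp add: plus_hahn.rep_eq add.commute)
  show "0 + a = a" by (rule hahn_eqI) (simp add: plus_hahn.rep_eq zero_hahn.rep_eq)
  show "- a + a = 0"
    by (rule hahn_eqI) (simp add: plus_hahn.rep_eq uminus_hahn.rep_eq zero_hahn.rep_eq)
  show "a - b = a + - b"
    by (rule hahn_eqI) (simp add: plus_hahn.rep_eq uminus_hahn.rep_eq minus_hahn.rep_eq)
qed

end

lift_definition hmonom :: "'a::zero \<Rightarrow> real \<Rightarrow> 'a hahn" is "\<lambda>c d e. if e = d then c else 0"
proof -
  fix c :: 'a and d :: real
  show "well_ordered {e. (if e = d then c else 0) \<noteq> 0}"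
    by (rule well_ordered_subset[OF well_ordered_singleton[of d]]) auto
qed

lemma hcoeff_hmonom_times:
  fixes a :: "'a::comm_ring_1 hahn"
  shows "hcoeff (hmonom c d * a) e = c * hcoeff a (e - d)"
proof -
  have *: "hsupp (hmonom c d) \<subseteq> {d}" by (auto simp: hsupp_def hmonom.rep_eq)
  have "hcoeff (hmonom c d * a) e
      = (\<Sum>x | x \<in> {d} \<and> e - x \<in> hsupp a. hcoeff (hmonom c d) x * hcoeff a (e - x))"
    by (rule hcoeff_times) (use * well_ordered_hsupp in auto)
  also have "{x. x \<in> {d} \<and> e - x \<in> hsupp a} = (if e - d \<in> hsupp a then {d} else {})" by auto
  finally show ?thesis by (auto simp: hmonom.rep_eq hcoeff_outside)
qed

lemma hcoeff_times_below:
  fixes a b :: "'a::comm_ring_1 hahn"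
  assumes "\<And>e. e < p \<Longrightarrow> hcoeff a e = 0" "\<And>e. e < q \<Longrightarrow> hcoeff b e = 0" "e < p + q"
  shows "hcoeff (a * b) e = 0"
  unfolding times_hahn.rep_eq
proof (rule sum.neutral, clarify)
  fix d assume "hcoeff a d \<noteq> 0" "hcoeff b (e - d) \<noteq> 0"
  then have "p \<le> d" "q \<le> e - d" using assms(1,2) by (meson not_le)+
  then show "hcoeff a d * hcoeff b (e - d) = 0" using assms(3) by simp
qed

text \<open>Inversion of \<open>1 - u\<close> for \<open>u\<close> with positive support, by the geometric series.\<close>

lemma hahn_geometric:
  fixes u :: "'a::comm_ring_1 hahn"
  assumes \<delta>: "\<delta> > 0" and u: "\<And>e. e < \<delta> \<Longrightarrow> hcoeff u e = 0"
  shows "\<exists>g. (1 - u) * g = 1"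
proof -
  define G where "G N = (\<Sum>n<N. u ^ n)" for N
  have pow: "hcoeff (u ^ n) e = 0" if "e < real n * \<delta>" for n e
    using that
  proof (induction n arbitrary: e)
    case 0
    then show ?case by (simp add: one_hahn.rep_eq)
  next
    case (Suc n)
    show ?case unfolding power_Suc
      by (rule hcoeff_times_below[of \<delta> _ "real n * \<delta>"]) (use u Suc in \<open>auto simp: algebra_simps\<close>)
  qed
  have stable_aux: "hcoeff (G (N + k)) e = hcoeff (G N) e" if "e < real N * \<delta>" for N k e
  proof (induction k)
    case (Suc k)
    have "e < real (N + k) * \<delta>" using that \<delta> by (smt (verit) mult_right_mono of_nat_mono le_add1)
    then show ?case using Suc pow[of e "N + k"] by (simp add: G_def plus_hahn.rep_eq)
  qed simp
  define N where "N e = Suc (nat \<lceil>e / \<delta>\<rceil>)" for e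
  have N: "e < real (N e) * \<delta>" for e
  proof -
    have "e / \<delta> < real (N e)" unfolding N_def by linarith
    then show ?thesis using \<delta> by (simp add: field_simps)
  qed
  have stable: "hcoeff (G M) e = hcoeff (G (N e)) e" if "e < real M * \<delta>" for M e
    using stable_aux[OF that, of "N e - M"] stable_aux[OF N, of e "M - N e"]
    by (cases "M \<le> N e") auto
  let ?g = "\<lambda>e. hcoeff (G (N e)) e"
  have "well_ordered {e. ?g e \<noteq> 0}"
  proof (rule well_orderedI_no_descent)
    fix f :: "nat \<Rightarrow> real"
    assume f: "\<And>n. f n \<in> {e. ?g e \<noteq> 0}" and dec: "\<And>n. f (Suc n) < f n"
    have le: "f n \<le> f 0" for n by (induction n) (use dec in \<open>auto intro: order_trans less_imp_le\<close>)
    have "f n \<in> hsupp (G (N (f 0)))" for n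
    proof -
      have "f n < real (N (f 0)) * \<delta>" using le[of n] N[of "f 0"] by simp
      then show ?thesis using stable[of "f n" "N (f 0)"] f[of n] by (simp add: hsupp_def)
    qed
    then show False using well_ordered_no_descent well_ordered_hsupp dec by blast
  qed
  then have g: "hcoeff (Abs_hahn ?g) = ?g" by (simp add: Abs_hahn_inverse)
  have "(1 - u) * Abs_hahn ?g = 1"
  proof (rule hahn_eqI)
    fix e
    let ?M = "N e" and ?g = "Abs_hahn ?g"
    have 1: "hcoeff ((1 - u) * (?g - G ?M)) e = 0"
    proof (rule hcoeff_times_below[of 0 _ "real ?M * \<delta>"])
      show "hcoeff (1 - u) x = 0" if "x < 0" for x
        using that \<delta> u by (simp add: minus_hahn.rep_eq one_hahn.rep_eq)
      show "hcoeff (?g - G ?M) x = 0" if "x < real ?M * \<delta>" for x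
        using stable[OF that] by (simp add: minus_hahn.rep_eq g)
      show "e < 0 + real ?M * \<delta>" using N by simp
    qed
    have "(1 - u) * G ?M = 1 - u ^ ?M"
      unfolding G_def by (rule one_diff_power_eq[symmetric])
    then have "(1 - u) * ?g = (1 - u) * (?g - G ?M) + (1 - u ^ ?M)"
      by (simp add: right_diff_distrib)
    then show "hcoeff ((1 - u) * ?g) e = hcoeff 1 e"
      using 1 pow[OF N] by (simp add: plus_hahn.rep_eq minus_hahn.rep_eq)
  qed
  then show ?thesis by blast
qed

lemma hahn_inverse_exists:
  fixes a :: "'a::field hahn"
  assumes "a \<noteq> 0"
  shows "\<exists>b. a * b = 1"
proof -
  have "hsupp a \<noteq> {}" using assms hahn_eqI[of a 0] by (auto simp: hsupp_def zero_hahn.rep_eq)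
  then obtain d where d: "d \<in> hsupp a" "\<And>e. e \<in> hsupp a \<Longrightarrow> d \<le> e"
    using well_ordered_least[OF well_ordered_hsupp[of a]] by blast
  define c where "c = hcoeff a d"
  have c: "c \<noteq> 0" using d(1) by (simp add: c_def hsupp_def)
  define m where "m = hmonom (inverse c) (- d)"
  define u where "u = 1 - m * a"
  have ma: "hcoeff (m * a) e = inverse c * hcoeff a (e + d)" for e
    by (simp add: m_def hcoeff_hmonom_times)
  have pos: "e > 0" if "e \<in> hsupp u" for e
  proof (rule ccontr)
    assume "\<not> e > 0"
    moreover have "e \<noteq> 0"
      using that c by (auto simp: hsupp_def u_def minus_hahn.rep_eq one_hahn.rep_eq ma c_def[symmetric])
    ultimately have "e < 0" by simp
    then have "hcoeff a (e + d) = 0" using d(2)[of "e + d"] by (auto simp: hsupp_def)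
    then show False
      using that \<open>e < 0\<close> by (simp add: hsupp_def u_def minus_hahn.rep_eq one_hahn.rep_eq ma)
  qed
  have "\<exists>\<delta>>0. \<forall>e<\<delta>. hcoeff u e = 0"
  proof (cases "hsupp u = {}")
    case True
    then show ?thesis by (intro exI[of _ 1]) (auto simp: hsupp_def)
  next
    case False
    then obtain \<delta> where "\<delta> \<in> hsupp u" "\<And>e. e \<in> hsupp u \<Longrightarrow> \<delta> \<le> e"
      using well_ordered_least[OF well_ordered_hsupp[of u]] by blast
    then show ?thesis using pos
      by (intro exI[of _ \<delta>]) (metis hcoeff_outside not_le)
  qed
  then obtain \<delta> where "\<delta> > 0" "\<And>e. e < \<delta> \<Longrightarrow> hcoeff u e = 0" by blast
  then obtain g where "(1 - u) * g = 1" using hahn_geometric by blast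
  then have "a * (m * g) = 1" by (simp add: u_def ac_simps)
  then show ?thesis by blast
qed

instantiation hahn :: (field) field
begin

definition inverse_hahn :: "'a hahn \<Rightarrow> 'a hahn" where
  "inverse_hahn a = (if a = 0 then 0 else SOME b. a * b = 1)"

definition divide_hahn :: "'a hahn \<Rightarrow> 'a hahn \<Rightarrow> 'a hahn" where
  "divide_hahn a b = a * inverse b"

instance
proof
  fix a b :: "'a hahn"
  show "inverse a * a = 1" if "a \<noteq> 0"
    using someI_ex[OF hahn_inverse_exists[OF that]] that
    by (simp add: inverse_hahn_def mult.commute)
qed (simp_all add: divide_hahn_def inverse_hahn_def)

end

text \<open>The degree is meaningful for nonzero series only; their support has a least element.\<close>

definition hdeg :: "'a::zero hahn \<Rightarrow> real" where
  "hdeg a = (LEAST e. e \<in> hsupp a)"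

lemma hsupp_nonempty: "a \<noteq> 0 \<Longrightarrow> hsupp a \<noteq> {}" for a :: "'a::comm_ring_1 hahn"
  using hahn_eqI[of a 0] by (auto simp: hsupp_def zero_hahn.rep_eq)

lemma hdeg_least:
  fixes a :: "'a::comm_ring_1 hahn"
  assumes "a \<noteq> 0"
  shows "hdeg a \<in> hsupp a" "e \<in> hsupp a \<Longrightarrow> hdeg a \<le> e"
proof -
  obtain m where m: "m \<in> hsupp a" "\<And>x. x \<in> hsupp a \<Longrightarrow> m \<le> x"
    using well_ordered_least[OF well_ordered_hsupp hsupp_nonempty[OF assms]] by blast
  then have "hdeg a = m" unfolding hdeg_def by (intro Least_equality)
  then show "hdeg a \<in> hsupp a" "e \<in> hsupp a \<Longrightarrow> hdeg a \<le> e" using m by simp_all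
qed

lemma hdeg_hmonom: "c \<noteq> 0 \<Longrightarrow> hdeg (hmonom c d) = d"
  unfolding hdeg_def by (rule Least_equality) (auto simp: hsupp_def hmonom.rep_eq split: if_splits)

lemma hmonom_nonzero: "c \<noteq> 0 \<Longrightarrow> hmonom c d \<noteq> 0" for c :: "'a::comm_ring_1"
  by (metis hmonom.rep_eq zero_hahn.rep_eq)

text \<open>The first argument only fixes the ground field.\<close>

definition kapranov_rank :: "'a::field itself \<Rightarrow> real mat \<Rightarrow> nat" where
  "kapranov_rank F B = (LEAST r. \<exists>A :: 'a hahn mat.
     A \<in> carrier_mat (dim_row B) (dim_col B) \<and>
     (\<forall>i<dim_row B. \<forall>j<dim_col B. A $$ (i, j) \<noteq> 0) \<and>
     map_mat hdeg A = B \<and>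
     vec_space.rank (dim_row A) A = r)"

text \<open>The minimum is over a nonempty set: the monomials with exponents \<open>B\<close> form a lift of \<open>B\<close>.\<close>

lemma kapranov_rank_attained:
  fixes B :: "real mat"
  shows "\<exists>A :: 'a::field hahn mat.
     A \<in> carrier_mat (dim_row B) (dim_col B) \<and>
     (\<forall>i<dim_row B. \<forall>j<dim_col B. A $$ (i, j) \<noteq> 0) \<and>
     map_mat hdeg A = B \<and>
     vec_space.rank (dim_row A) A = kapranov_rank TYPE('a) B"
proof -
  let ?P = "\<lambda>r. \<exists>A :: 'a hahn mat.
     A \<in> carrier_mat (dim_row B) (dim_col B) \<and>
     (\<forall>i<dim_row B. \<forall>j<dim_col B. A $$ (i, j) \<noteq> 0) \<and>
     map_mat hdeg A = B \<and>
     vec_space.rank (dim_row A) A = r"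
  let ?A = "map_mat (hmonom (1 :: 'a)) B"
  have "map_mat hdeg ?A = B" by (rule eq_matI) (simp_all add: hdeg_hmonom)
  then have "?P (vec_space.rank (dim_row ?A) ?A)"
    by (intro exI[of _ ?A]) (simp add: hmonom_nonzero)
  then have "?P (Least ?P)" by (rule LeastI)
  then show ?thesis unfolding kapranov_rank_def .
qed

definition tropically_nonsingular :: "real mat \<Rightarrow> bool" where
  "tropically_nonsingular B \<longleftrightarrow> square_mat B \<and>
     (\<exists>!\<sigma>. \<sigma> permutes {..<dim_row B} \<and>
        (\<forall>\<tau>. \<tau> permutes {..<dim_row B} \<longrightarrow>
           (\<Sum>i<dim_row B. B $$ (i, \<sigma> i)) \<le> (\<Sum>i<dim_row B. B $$ (i, \<tau> i))))"

text \<open>The empty submatrix (\<open>r = 0\<close>) counts as non-singular, so the set below is never empty.\<close>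

definition tropical_rank :: "real mat \<Rightarrow> nat" where
  "tropical_rank M = Max {r. \<exists>I J. I \<subseteq> {..<dim_row M} \<and> J \<subseteq> {..<dim_col M} \<and>
     card I = r \<and> card J = r \<and> tropically_nonsingular (submatrix M I J)}"

end

theory Submission
  imports Defs "HOL-Combinatorics.Cycles" "Jordan_Normal_Form.DL_Rank_Submatrix"
begin

text \<open>If the field has at least four elements, a matrix of tropical rank 3 is scaled so that around a non-singular
\<open>3 \<times> 3\<close> submatrix its rows and columns fall into three classes, with zeros exactly where the classes agree.
When no class of rows, or no class of columns, has three members, a rank 3 lift is built from five generic vectors in
the plane over the Hahn field, whose pairwise determinants carry a tropical Pluecker vector: the four-term relations
for each column are linear equations that can be solved with prescribed degrees because the residue field offers enough
values to avoid. The remaining class sizes \<open>(3, 1, 1)\<close> lead to an explicit lift, to another normal form, or to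
the star tree, for which five distinct points of the projective line, hence four field elements, are needed.

Over two or three elements, the residues of a lift of a 0/1 matrix have a prescribed support, and all such matrices
have a nonzero 4 by 4 minor.\<close>

text \<open>A matrix with columns orthogonal to two independent vectors \<open>f\<close> and
  \<open>g\<close> of length 5 has rank at most 3. Read (\<open>f i\<close>, \<open>g i\<close>) as
  five points of the plane: eliminating row \<open>i\<close> from the two equations of a column
  leaves four terms, with the determinants against point \<open>i\<close> as coefficients. If
  \<open>p\<close> holds the degrees of the determinants, a column with degrees \<open>w\<close> can
  satisfy this only if the minimum of \<open>p i m + w m\<close> over \<open>m \<noteq> i\<close> is
  attained twice. Conversely, these conditions at four of the five rows suffice: the column is then
  found by Cramer's rule, and its two dependent entries have the right degrees as soon as two linear
  forms in residues do not vanish. Together with 0 this excludes at most three values of a residue,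
  whence the bound of four elements. Tropical dependence of the other four rows supplies weights
  that fit the condition at one row. The obstacle is to make the weights obtained at different rows
  the degrees of the determinants of a single configuration of points.\<close>

section \<open>Orders and leading coefficients of Hahn series\<close>

definition vge :: "real \<Rightarrow> 'a::zero hahn \<Rightarrow> bool" where
  "vge x a \<longleftrightarrow> (\<forall>e<x. hcoeff a e = 0)"

text \<open>The degree of the zero series has no meaning, hence the first conjunct.\<close>

definition hval :: "'a::comm_ring_1 hahn \<Rightarrow> real \<Rightarrow> bool" where
  "hval a x \<longleftrightarrow> a \<noteq> 0 \<and> hdeg a = x"

lemma hval_iff: "hval a x \<longleftrightarrow> vge x a \<and> hcoeff a x \<noteq> 0"
proof
  assume "hval a x"
  then have a: "a \<noteq> 0" "hdeg a = x" by (auto simp: hval_def)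
  show "vge x a \<and> hcoeff a x \<noteq> 0"
    using hdeg_least[OF a(1)] a(2) by (force simp: vge_def hsupp_def)
next
  assume *: "vge x a \<and> hcoeff a x \<noteq> 0"
  then have "a \<noteq> 0" by (auto simp: zero_hahn.rep_eq)
  moreover have "hdeg a = x"
    unfolding hdeg_def
  proof (rule Least_equality)
    show "x \<in> hsupp a" using * by (simp add: hsupp_def)
    show "x \<le> y" if "y \<in> hsupp a" for y
      using * that unfolding hsupp_def vge_def by (metis mem_Collect_eq not_le)
  qed
  ultimately show "hval a x" by (simp add: hval_def)
qed

lemma vge_mono: "vge x a \<Longrightarrow> y \<le> x \<Longrightarrow> vge y a"
  by (auto simp: vge_def)

lemma vge_0 [simp]: "vge x (0 :: 'a::comm_ring_1 hahn)"
  by (simp add: vge_def zero_hahn.rep_eq)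

lemma vge_add: "vge x a \<Longrightarrow> vge x b \<Longrightarrow> vge x (a + b)" for a b :: "'a::comm_ring_1 hahn"
  by (simp add: vge_def plus_hahn.rep_eq)

lemma vge_diff: "vge x a \<Longrightarrow> vge x b \<Longrightarrow> vge x (a - b)" for a b :: "'a::comm_ring_1 hahn"
  by (simp add: vge_def minus_hahn.rep_eq)

lemma vge_uminus: "vge x (- a) \<longleftrightarrow> vge x a" for a :: "'a::comm_ring_1 hahn"
  by (simp add: vge_def uminus_hahn.rep_eq)

lemma vge_mult: "vge x a \<Longrightarrow> vge y b \<Longrightarrow> vge (x + y) (a * b)" for a b :: "'a::comm_ring_1 hahn"
  unfolding vge_def using hcoeff_times_below[of x a y b] by blast

lemma hcoeff_0 [simp]: "hcoeff (0 :: 'a::comm_ring_1 hahn) e = 0"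
  by (simp add: zero_hahn.rep_eq)

lemma hcoeff_add [simp]: "hcoeff (a + b) e = hcoeff a e + hcoeff b e" for a b :: "'a::comm_ring_1 hahn"
  by (simp add: plus_hahn.rep_eq)

lemma hcoeff_diff [simp]: "hcoeff (a - b) e = hcoeff a e - hcoeff b e" for a b :: "'a::comm_ring_1 hahn"
  by (simp add: minus_hahn.rep_eq)

lemma hcoeff_uminus [simp]: "hcoeff (- a) e = - hcoeff a e" for a :: "'a::comm_ring_1 hahn"
  by (simp add: uminus_hahn.rep_eq)

lemma hcoeff_sum [simp]: "hcoeff (\<Sum>i\<in>I. a i) e = (\<Sum>i\<in>I. hcoeff (a i) e)"
  for a :: "'b \<Rightarrow> 'a::comm_ring_1 hahn"
  by (induction I rule: infinite_finite_induct) auto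

text \<open>A term of the convolution at \<open>x + y\<close> survives only if
  \<open>d \<ge> x\<close> and \<open>x + y - d \<ge> y\<close>, which forces \<open>d = x\<close>.
  The two coefficients may vanish, so lower bounds on the orders are enough.\<close>

lemma hcoeff_mult_lead:
  fixes a b :: "'a::comm_ring_1 hahn"
  assumes "vge x a" "vge y b"
  shows "hcoeff (a * b) (x + y) = hcoeff a x * hcoeff b y"
proof -
  let ?D = "{d. hcoeff a d \<noteq> 0 \<and> hcoeff b (x + y - d) \<noteq> 0}"
  have sub: "?D \<subseteq> {x}"
  proof
    fix d assume d: "d \<in> ?D"
    then have "\<not> d < x" "\<not> x + y - d < y" using assms unfolding vge_def by blast+
    then show "d \<in> {x}" by simp
  qed
  have "hcoeff (a * b) (x + y) = (\<Sum>d\<in>?D. hcoeff a d * hcoeff b (x + y - d))"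
    by (simp add: times_hahn.rep_eq)
  also have "\<dots> = (\<Sum>d\<in>{x}. hcoeff a d * hcoeff b (x + y - d))"
    by (rule sum.mono_neutral_left) (use sub in auto)
  finally show ?thesis by simp
qed

lemma hval_mult: "hval a x \<Longrightarrow> hval b y \<Longrightarrow> hval (a * b) (x + y)"
  for a b :: "'a::field hahn"
  by (simp add: hval_iff hcoeff_mult_lead vge_mult)

lemma hval_uminus [simp]: "hval (- a) x \<longleftrightarrow> hval a x" for a :: "'a::field hahn"
  by (simp add: hval_iff vge_uminus)

lemma hval_unique: "hval a x \<Longrightarrow> hval a y \<Longrightarrow> x = y"
  by (simp add: hval_def)

lemma hval_hmonom: "c \<noteq> 0 \<Longrightarrow> hval (hmonom c d) d" for c :: "'a::field"
  by (simp add: hval_def hdeg_hmonom hmonom_nonzero)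

lemma vge_hmonom: "x \<le> d \<Longrightarrow> vge x (hmonom c d)"
  by (auto simp: vge_def hmonom.rep_eq)

lemma hval_vge: "hval a x \<Longrightarrow> y \<le> x \<Longrightarrow> vge y a"
  by (auto simp: hval_iff vge_def)

lemma hval_one [simp]: "hval (1 :: 'a::field hahn) 0"
  by (simp add: hval_iff vge_def one_hahn.rep_eq)

lemma hval_nz: "hval a x \<Longrightarrow> a \<noteq> 0"
  by (simp add: hval_def)

lemma hval_ex: "a \<noteq> 0 \<Longrightarrow> hval a (hdeg a)"
  by (simp add: hval_def)

lemma hval_inverse:
  fixes a :: "'a::field hahn"
  assumes "hval a x"
  shows "hval (inverse a) (- x)"
proof -
  have a: "a \<noteq> 0" using assms by (simp add: hval_def)
  then have i: "hval (inverse a) (hdeg (inverse a))" by (intro hval_ex) simp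
  have "hval (a * inverse a) (x + hdeg (inverse a))" by (rule hval_mult[OF assms i])
  then have "x + hdeg (inverse a) = 0" using a hval_unique[OF _ hval_one] by simp
  then have "hdeg (inverse a) = - x" by simp
  with i show ?thesis by simp
qed

lemma hval_divide: "hval a x \<Longrightarrow> hval b y \<Longrightarrow> hval (a / b) (x - y)"
  for a b :: "'a::field hahn"
  unfolding divide_inverse using hval_mult[of a x "inverse b" "- y"] hval_inverse[of b y] by simp

lemma hval_add_dominant:
  "hval a x \<Longrightarrow> vge y b \<Longrightarrow> x < y \<Longrightarrow> hval (a + b) x" for a b :: "'a::comm_ring_1 hahn"
  by (auto simp: hval_iff vge_def)

lemma hval_diff_dominant:
  "hval a x \<Longrightarrow> vge y b \<Longrightarrow> x < y \<Longrightarrow> hval (a - b) x" for a b :: "'a::comm_ring_1 hahn"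
  by (auto simp: hval_iff vge_def)

lemma hval_diff_dominant':
  "vge y a \<Longrightarrow> hval b x \<Longrightarrow> x < y \<Longrightarrow> hval (a - b) x" for a b :: "'a::comm_ring_1 hahn"
  by (auto simp: hval_iff vge_def)

lemma hmonom_mult: "hmonom c x * hmonom d y = hmonom (c * d) (x + y)" for c d :: "'a::field"
  by (rule hahn_eqI) (auto simp: hcoeff_hmonom_times hmonom.rep_eq)

lemma hmonom_1_0: "hmonom 1 0 = (1 :: 'a::field hahn)"
  by (rule hahn_eqI) (simp add: hmonom.rep_eq one_hahn.rep_eq)

section \<open>Lifts of rank at most 3 and their symmetries\<close>

text \<open>A factorisation through dimension 3 stands for rank at most 3: it passes through
  renumbering, transposition and scaling by direct substitution.\<close>

definition lift3 :: "'a::field itself \<Rightarrow> (nat \<Rightarrow> nat \<Rightarrow> real) \<Rightarrow> bool" where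
  "lift3 F b \<longleftrightarrow> (\<exists>M N :: nat \<Rightarrow> nat \<Rightarrow> 'a hahn.
     \<forall>i<5. \<forall>j<5. hval (\<Sum>k<3. M i k * N k j) (b i j))"

lemma lift3_reindex:
  assumes "lift3 TYPE('a::field) (\<lambda>i j. b (\<pi> i) (\<sigma> j))"
    and "bij_betw \<pi> {..<5} {..<5}" "bij_betw \<sigma> {..<5} {..<5}"
  shows "lift3 TYPE('a) b"
proof -
  obtain M N :: "nat \<Rightarrow> nat \<Rightarrow> 'a hahn" where
    MN: "\<And>i j. i < 5 \<Longrightarrow> j < 5 \<Longrightarrow> hval (\<Sum>k<3. M i k * N k j) (b (\<pi> i) (\<sigma> j))"
    using assms(1) unfolding lift3_def by blast
  define p where "p = inv_into {..<5} \<pi>"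
  define s where "s = inv_into {..<5} \<sigma>"
  have p: "p i < 5" "\<pi> (p i) = i" if "i < 5" for i
    using that assms(2) bij_betw_inv_into[OF assms(2)] bij_betw_inv_into_right[OF assms(2)]
    unfolding p_def by (auto dest: bij_betwE)
  have s: "s i < 5" "\<sigma> (s i) = i" if "i < 5" for i
    using that assms(3) bij_betw_inv_into[OF assms(3)] bij_betw_inv_into_right[OF assms(3)]
    unfolding s_def by (auto dest: bij_betwE)
  have "hval (\<Sum>k<3. M (p i) k * N k (s j)) (b i j)" if "i < 5" "j < 5" for i j
    using MN[of "p i" "s j"] p[OF that(1)] s[OF that(2)] by simp
  then show ?thesis unfolding lift3_def by (intro exI[of _ "\<lambda>i. M (p i)"] exI[of _ "\<lambda>k j. N k (s j)"]) auto
qed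

lemma lift3_transpose:
  assumes "lift3 TYPE('a::field) (\<lambda>i j. b j i)"
  shows "lift3 TYPE('a) b"
proof -
  obtain M N :: "nat \<Rightarrow> nat \<Rightarrow> 'a hahn" where
    MN: "\<And>i j. i < 5 \<Longrightarrow> j < 5 \<Longrightarrow> hval (\<Sum>k<3. M i k * N k j) (b j i)"
    using assms(1) unfolding lift3_def by blast
  show ?thesis unfolding lift3_def
    by (intro exI[of _ "\<lambda>i k. N k i"] exI[of _ "\<lambda>k j. M j k"]) (use MN in \<open>auto simp: mult.commute\<close>)
qed

lemma lift3_scale:
  assumes "lift3 TYPE('a::field) (\<lambda>i j. b i j + x i + y j)"
  shows "lift3 TYPE('a) b"
proof -
  obtain M N :: "nat \<Rightarrow> nat \<Rightarrow> 'a hahn" where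
    MN: "\<And>i j. i < 5 \<Longrightarrow> j < 5 \<Longrightarrow> hval (\<Sum>k<3. M i k * N k j) (b i j + x i + y j)"
    using assms(1) unfolding lift3_def by blast
  let ?M = "\<lambda>i k. hmonom 1 (- x i) * M i k" and ?N = "\<lambda>k j. hmonom 1 (- y j) * N k j"
  have *: "hval (\<Sum>k<3. ?M i k * ?N k j) (b i j)" if "i < 5" "j < 5" for i j
  proof -
    have eq: "(p * m) * (q * n) = p * (q * (m * n))" for p m q n :: "'a hahn"
      by (simp only: mult.assoc mult.left_commute)
    have "(\<Sum>k<3. ?M i k * ?N k j) = hmonom 1 (- x i) * (hmonom 1 (- y j) * (\<Sum>k<3. M i k * N k j))"
      by (simp only: sum_distrib_left eq)
    then show ?thesis
      using hval_mult[OF hval_hmonom[OF one_neq_zero] hval_mult[OF hval_hmonom[OF one_neq_zero] MN[OF that]],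
        of "- x i" "- y j"] by simp
  qed
  show ?thesis unfolding lift3_def
    by (rule exI[of _ ?M], rule exI[of _ ?N]) (use * in simp)
qed

section \<open>Avoiding residues in a field with at least four elements\<close>

lemma exists_three_nonzero:
  fixes a :: "'a::field"
  assumes "infinite (UNIV :: 'a set) \<or> card (UNIV :: 'a set) \<ge> 4"
  obtains w :: 'a where "w \<noteq> 0" "w \<noteq> 1" "w \<noteq> a"
proof -
  have "\<not> (UNIV :: 'a set) \<subseteq> {0, 1, a}"
  proof
    assume *: "(UNIV :: 'a set) \<subseteq> {0, 1, a}"
    then have "finite (UNIV :: 'a set)" by (rule finite_subset) simp
    moreover have "card (UNIV :: 'a set) \<le> card {0, 1, a}" using * by (intro card_mono) auto
    moreover have "card {0, 1, a} \<le> 3" by (auto simp: card_insert_if)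
    ultimately show False using assms by auto
  qed
  then show thesis using that by blast
qed

text \<open>Excluded are 0 and the root of each affine form, three values at most; a fourth element
  of the field remains.\<close>

lemma avoid_two_values:
  fixes r s x y :: "'a::field"
  assumes "infinite (UNIV :: 'a set) \<or> card (UNIV :: 'a set) \<ge> 4"
    and "r \<noteq> 0" "s \<noteq> 0"
  shows "\<exists>c::'a. c \<noteq> 0 \<and> r * c + x \<noteq> 0 \<and> s * c + y \<noteq> 0"
proof -
  have "\<not> UNIV \<subseteq> {0, - x / r, - y / s}"
  proof
    assume *: "UNIV \<subseteq> {0, - x / r, - y / s}"
    then have "finite (UNIV :: 'a set)" by (rule finite_subset) simp
    moreover have "card (UNIV :: 'a set) \<le> card {0, - x / r, - y / s}" using * by (intro card_mono) auto
    moreover have "card {0, - x / r, - y / s} \<le> 3" by (auto simp: card_insert_if)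
    ultimately show False using assms by auto
  qed
  then obtain c where "c \<noteq> 0" "c \<noteq> - x / r" "c \<noteq> - y / s" by blast
  moreover have "r * c + x \<noteq> 0" if "c \<noteq> - x / r" using that assms(2) by (auto simp: field_simps add_eq_0_iff)
  moreover have "s * c + y \<noteq> 0" if "c \<noteq> - y / s" using that assms(3) by (auto simp: field_simps add_eq_0_iff)
  ultimately show ?thesis by blast
qed

text \<open>If a variable occurs in both forms, it is varied and the others are set to 1. Otherwise
  each form has a variable absent from the other one, and these two can be varied
  independently.\<close>

lemma avoid_two_forms:
  fixes r0 r1 r2 s0 s1 s2 :: "'a::field"
  assumes F: "infinite (UNIV :: 'a set) \<or> card (UNIV :: 'a set) \<ge> 4"
    and r: "r0 \<noteq> 0 \<or> r1 \<noteq> 0 \<or> r2 \<noteq> 0" and s: "s0 \<noteq> 0 \<or> s1 \<noteq> 0 \<or> s2 \<noteq> 0"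
  shows "\<exists>c0 c1 c2. c0 \<noteq> 0 \<and> c1 \<noteq> 0 \<and> c2 \<noteq> 0 \<and>
    r0 * c0 + r1 * c1 + r2 * c2 \<noteq> 0 \<and> s0 * c0 + s1 * c1 + s2 * c2 \<noteq> 0"
proof -
  have disj: "\<exists>c d. c \<noteq> 0 \<and> d \<noteq> 0 \<and> r * c + x \<noteq> 0 \<and> s * d + y \<noteq> 0" if "r \<noteq> 0" "s \<noteq> 0" for r s x y :: 'a
    using avoid_two_values[OF F that(1) that(1), of x x] avoid_two_values[OF F that(2) that(2), of y y] by blast
  consider "r0 \<noteq> 0 \<and> s0 \<noteq> 0" | "r1 \<noteq> 0 \<and> s1 \<noteq> 0" | "r2 \<noteq> 0 \<and> s2 \<noteq> 0"
    | "r0 \<noteq> 0 \<and> s1 \<noteq> 0 \<and> r1 = 0 \<and> s0 = 0" | "r0 \<noteq> 0 \<and> s2 \<noteq> 0 \<and> r2 = 0 \<and> s0 = 0"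
    | "r1 \<noteq> 0 \<and> s0 \<noteq> 0 \<and> r0 = 0 \<and> s1 = 0" | "r1 \<noteq> 0 \<and> s2 \<noteq> 0 \<and> r2 = 0 \<and> s1 = 0"
    | "r2 \<noteq> 0 \<and> s0 \<noteq> 0 \<and> r0 = 0 \<and> s2 = 0" | "r2 \<noteq> 0 \<and> s1 \<noteq> 0 \<and> r1 = 0 \<and> s2 = 0"
    using r s by argo
  then show ?thesis
  proof cases
    case 1
    then obtain c where "c \<noteq> 0 \<and> r0 * c + (r1 + r2) \<noteq> 0 \<and> s0 * c + (s1 + s2) \<noteq> 0"
      using avoid_two_values[OF F, of r0 s0 "r1 + r2" "s1 + s2"] by blast
    then show ?thesis by (intro exI[of _ c] exI[of _ 1]) (simp add: add.assoc)
  next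
    case 2
    then obtain c where "c \<noteq> 0 \<and> r1 * c + (r0 + r2) \<noteq> 0 \<and> s1 * c + (s0 + s2) \<noteq> 0"
      using avoid_two_values[OF F, of r1 s1 "r0 + r2" "s0 + s2"] by blast
    then show ?thesis by (intro exI[of _ 1] exI[of _ c]) (simp add: algebra_simps)
  next
    case 3
    then obtain c where "c \<noteq> 0 \<and> r2 * c + (r0 + r1) \<noteq> 0 \<and> s2 * c + (s0 + s1) \<noteq> 0"
      using avoid_two_values[OF F, of r2 s2 "r0 + r1" "s0 + s1"] by blast
    then show ?thesis by (intro exI[of _ 1] exI[of _ c]) (simp add: algebra_simps)
  next
    case 4
    then obtain c d where "c \<noteq> 0 \<and> d \<noteq> 0 \<and> r0 * c + r2 \<noteq> 0 \<and> s1 * d + s2 \<noteq> 0" using disj by blast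
    then show ?thesis using 4 by (intro exI[of _ c] exI[of _ d] exI[of _ 1]) simp
  next
    case 5
    then obtain c d where "c \<noteq> 0 \<and> d \<noteq> 0 \<and> r0 * c + r1 \<noteq> 0 \<and> s2 * d + s1 \<noteq> 0" using disj by blast
    then show ?thesis using 5 by (intro exI[of _ c] exI[of _ 1] exI[of _ d]) (simp add: add.commute)
  next
    case 6
    then obtain c d where "c \<noteq> 0 \<and> d \<noteq> 0 \<and> r1 * c + r2 \<noteq> 0 \<and> s0 * d + s2 \<noteq> 0" using disj by blast
    then show ?thesis using 6 by (intro exI[of _ d] exI[of _ c] exI[of _ 1]) simp
  next
    case 7
    then obtain c d where "c \<noteq> 0 \<and> d \<noteq> 0 \<and> r1 * c + r0 \<noteq> 0 \<and> s2 * d + s0 \<noteq> 0" using disj by blast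
    then show ?thesis using 7 by (intro exI[of _ 1] exI[of _ c] exI[of _ d]) (simp add: add.commute)
  next
    case 8
    then obtain c d where "c \<noteq> 0 \<and> d \<noteq> 0 \<and> r2 * c + r1 \<noteq> 0 \<and> s0 * d + s1 \<noteq> 0" using disj by blast
    then show ?thesis using 8 by (intro exI[of _ d] exI[of _ 1] exI[of _ c]) (simp add: add.commute)
  next
    case 9
    then obtain c d where "c \<noteq> 0 \<and> d \<noteq> 0 \<and> r2 * c + r0 \<noteq> 0 \<and> s1 * d + s0 \<noteq> 0" using disj by blast
    then show ?thesis using 9 by (intro exI[of _ 1] exI[of _ d] exI[of _ c]) (simp add: add.commute)
  qed
qed

text \<open>The coefficient of \<open>t\<close>-exponent \<open>x\<close> of a series of order at least \<open>x\<close> behaves like a residue.\<close>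

lemma hcoeff_lead_eq_0: "hval a x \<Longrightarrow> y < x \<Longrightarrow> hcoeff a y = 0"
  by (simp add: hval_iff vge_def)

section \<open>Columns orthogonal to a configuration of five points\<close>

text \<open>Cramer's rule expresses the unknowns at \<open>k\<close> and \<open>l\<close> by the
  other three, which are taken as monomials. The inequalities say that no contribution lies below
  the prescribed degree, the existence conditions that some contribution attains it. So the
  coefficient at that degree is a nonzero linear form in the three free residues, and
  \<open>avoid_two_forms\<close> keeps both forms from vanishing.\<close>

lemma solve_two_linear:
  fixes f g :: "nat \<Rightarrow> 'a::field hahn" and w :: "nat \<Rightarrow> real" and m0 m1 m2 k l :: nat
  defines D_def: "D \<equiv> \<lambda>i j. f i * g j - f j * g i"
  assumes F: "infinite (UNIV :: 'a set) \<or> card (UNIV :: 'a set) \<ge> 4"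
    and p: "hval (D k l) pkl"
    and pl: "\<And>m. m \<in> {m0,m1,m2} \<Longrightarrow> hval (D m l) (pl m)"
    and pk: "\<And>m. m \<in> {m0,m1,m2} \<Longrightarrow> hval (D k m) (pk m)"
    and gel: "\<And>m. m \<in> {m0,m1,m2} \<Longrightarrow> pkl + w k \<le> pl m + w m"
    and gek: "\<And>m. m \<in> {m0,m1,m2} \<Longrightarrow> pkl + w l \<le> pk m + w m"
    and exl: "\<exists>m\<in>{m0,m1,m2}. pl m + w m = pkl + w k"
    and exk: "\<exists>m\<in>{m0,m1,m2}. pk m + w m = pkl + w l"
  shows "\<exists>a0 a1 a2 ak al. hval a0 (w m0) \<and> hval a1 (w m1) \<and> hval a2 (w m2) \<and> hval ak (w k) \<and> hval al (w l) \<and>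
    a0 * f m0 + a1 * f m1 + a2 * f m2 + ak * f k + al * f l = 0 \<and>
    a0 * g m0 + a1 * g m1 + a2 * g m2 + ak * g k + al * g l = 0"
proof -
  have D0: "D k l \<noteq> 0" using p by (rule hval_nz)
  define u where "u m = - (D m l / D k l)" for m
  define v where "v m = - (D k m / D k l)" for m
  have u: "hval (u m) (pl m - pkl)" if "m \<in> {m0,m1,m2}" for m
    unfolding u_def using hval_divide[OF pl[OF that] p] by simp
  have v: "hval (v m) (pk m - pkl)" if "m \<in> {m0,m1,m2}" for m
    unfolding v_def using hval_divide[OF pk[OF that] p] by simp
  \<comment> \<open>Residue of the Cramer coefficient at its least admissible order; it is 0 for
    those \<open>m\<close> whose contribution starts strictly above \<open>w k\<close>.\<close>
  define r where "r m = hcoeff (u m) (w k - w m)" for m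
  define s where "s m = hcoeff (v m) (w l - w m)" for m
  have uv: "vge (w k - w m) (u m)" "vge (w l - w m) (v m)" if "m \<in> {m0,m1,m2}" for m
    using hval_vge[OF u[OF that], of "w k - w m"] hval_vge[OF v[OF that], of "w l - w m"] gel[OF that] gek[OF that]
    by auto
  have "\<exists>m\<in>{m0,m1,m2}. r m \<noteq> 0"
  proof -
    obtain m where m: "m \<in> {m0,m1,m2}" "pl m + w m = pkl + w k" using exl by blast
    then have "w k - w m = pl m - pkl" by simp
    then have "r m \<noteq> 0" using u[OF m(1)] by (simp add: r_def hval_iff)
    with m show ?thesis by blast
  qed
  then have rr: "r m0 \<noteq> 0 \<or> r m1 \<noteq> 0 \<or> r m2 \<noteq> 0" by auto
  have "\<exists>m\<in>{m0,m1,m2}. s m \<noteq> 0"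
  proof -
    obtain m where m: "m \<in> {m0,m1,m2}" "pk m + w m = pkl + w l" using exk by blast
    then have "w l - w m = pk m - pkl" by simp
    then have "s m \<noteq> 0" using v[OF m(1)] by (simp add: s_def hval_iff)
    with m show ?thesis by blast
  qed
  then have ss: "s m0 \<noteq> 0 \<or> s m1 \<noteq> 0 \<or> s m2 \<noteq> 0" by auto
  obtain c0 c1 c2 where c: "c0 \<noteq> 0" "c1 \<noteq> 0" "c2 \<noteq> 0"
    "r m0 * c0 + r m1 * c1 + r m2 * c2 \<noteq> 0" "s m0 * c0 + s m1 * c1 + s m2 * c2 \<noteq> 0"
    using avoid_two_forms[OF F rr ss] by blast
  define a0 a1 a2 where "a0 = hmonom c0 (w m0)" and "a1 = hmonom c1 (w m1)" and "a2 = hmonom c2 (w m2)"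
  have a: "hval a0 (w m0)" "hval a1 (w m1)" "hval a2 (w m2)"
    using c by (simp_all add: a0_def a1_def a2_def hval_hmonom)
  have ac: "hcoeff a0 (w m0) = c0" "hcoeff a1 (w m1) = c1" "hcoeff a2 (w m2) = c2"
    by (simp_all add: a0_def a1_def a2_def hmonom.rep_eq)
  define ak where "ak = u m0 * a0 + u m1 * a1 + u m2 * a2"
  define al where "al = v m0 * a0 + v m1 * a1 + v m2 * a2"
  have lead: "hcoeff (q * x) y = hcoeff q (y - z) * hcoeff x z" "vge y (q * x)"
    if "vge (y - z) q" "hval x z" for q x :: "'a hahn" and y z
    using hcoeff_mult_lead[OF that(1), of z x] vge_mult[OF that(1), of z x] that(2) by (auto simp: hval_iff)
  have "hval ak (w k)"
    unfolding hval_iff ak_def using c(4)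
    by (simp add: lead[OF uv(1) a(1)] lead[OF uv(1) a(2)] lead[OF uv(1) a(3)] ac vge_add r_def[symmetric])
  moreover have "hval al (w l)"
    unfolding hval_iff al_def using c(5)
    by (simp add: lead[OF uv(2) a(1)] lead[OF uv(2) a(2)] lead[OF uv(2) a(3)] ac vge_add s_def[symmetric])
  moreover have uD: "u m * D k l = - D m l" "v m * D k l = - D k m" for m
    using D0 by (simp_all add: u_def v_def)
  \<comment> \<open>The linear dependence of three vectors of the plane, with their determinants as
    coefficients.\<close>
  have key: "h m * D k l + u m * D k l * h k + v m * D k l * h l = 0" if "h = f \<or> h = g" for h m
    using that unfolding uD by (auto simp: D_def algebra_simps)
  have key': "h m + u m * h k + v m * h l = 0" if "h = f \<or> h = g" for h m
  proof -
    have "(h m + u m * h k + v m * h l) * D k l = 0"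
      using key[OF that, of m] by (simp add: algebra_simps)
    then show ?thesis using D0 by simp
  qed
  have "a0 * h m0 + a1 * h m1 + a2 * h m2 + ak * h k + al * h l = 0" if h: "h = f \<or> h = g" for h
  proof -
    have "a0 * h m0 + a1 * h m1 + a2 * h m2 + ak * h k + al * h l
      = a0 * (h m0 + u m0 * h k + v m0 * h l) + a1 * (h m1 + u m1 * h k + v m1 * h l)
        + a2 * (h m2 + u m2 * h k + v m2 * h l)"
      unfolding ak_def al_def by (simp add: algebra_simps)
    then show ?thesis using key'[OF h] by simp
  qed
  ultimately show ?thesis using a by blast
qed

lemma sum_lessThan_5: "(\<Sum>i<5. h i) = h 0 + h 1 + h 2 + h 3 + h (4::nat)"
  by (simp add: eval_nat_numeral)

lemma sum_lessThan_3: "(\<Sum>i<3. h i) = h 0 + h 1 + h (2::nat)"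
  by (simp add: eval_nat_numeral)

lemma less_5_cases: "(i::nat) < 5 \<longleftrightarrow> i = 0 \<or> i = 1 \<or> i = 2 \<or> i = 3 \<or> i = 4"
  by auto

lemma other_three:
  assumes "(k::nat) < 5" "l < 5" "k \<noteq> l"
  shows "\<exists>m0 m1 m2. {m0,m1,m2,k,l} = {..<5} \<and> distinct [m0,m1,m2,k,l]"
proof -
  have "card ({..<5} - {k,l}) = 3" using assms by (subst card_Diff_subset) auto
  then obtain m0 m1 m2 where m: "{..<5} - {k,l} = {m0,m1,m2}" "distinct [m0,m1,m2]"
    by (auto simp: card_3_iff)
  then have "{m0,m1,m2,k,l} = {..<5}" using assms by auto
  moreover have "distinct [m0,m1,m2,k,l]" using m assms by auto
  ultimately show ?thesis by blast
qed

text \<open>The hypothesis \<open>circ\<close> says that at each of the first four rows the minimum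
  of \<open>p i m + w m\<close> over \<open>m \<noteq> i\<close> is attained twice. A pair that
  minimises \<open>p k l + w k + w l\<close> fulfils the inequalities of
  \<open>solve_two_linear\<close>, and the double minima at \<open>k\<close> and at \<open>l\<close>
  give its two equalities.\<close>

lemma column_lift:
  fixes f g :: "nat \<Rightarrow> 'a::field hahn" and w :: "nat \<Rightarrow> real"
  assumes F: "infinite (UNIV :: 'a set) \<or> card (UNIV :: 'a set) \<ge> 4"
    and val: "\<And>i j. i < 5 \<Longrightarrow> j < 5 \<Longrightarrow> i \<noteq> j \<Longrightarrow> hval (f i * g j - f j * g i) (p i j)"
    and circ: "\<And>i m. i < 4 \<Longrightarrow> m < 5 \<Longrightarrow> m \<noteq> i \<Longrightarrow>
      \<exists>m'<5. m' \<noteq> i \<and> m' \<noteq> m \<and> p i m' + w m' \<le> p i m + w m"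
  shows "\<exists>a. (\<forall>i<5. hval (a i) (w i)) \<and> (\<Sum>i<5. a i * f i) = 0 \<and> (\<Sum>i<5. a i * g i) = 0"
proof -
  have sym: "p i j = p j i" if "i < 5" "j < 5" "i \<noteq> j" for i j
  proof -
    have "hval (- (f j * g i - f i * g j)) (p j i)"
      using val[OF that(2,1)] that(3) by (subst hval_uminus) auto
    then have "hval (f i * g j - f j * g i) (p j i)" by simp
    with val[OF that] show ?thesis by (rule hval_unique)
  qed
  define S where "S = {(i, j). i < (5::nat) \<and> j < (5::nat) \<and> i \<noteq> j}"
  have S: "finite S" "S \<noteq> {}"
  proof -
    have "S \<subseteq> {..<5} \<times> {..<5}" by (auto simp: S_def)
    then show "finite S" by (rule finite_subset) simp
    have "(0, 1) \<in> S" by (simp add: S_def)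
    then show "S \<noteq> {}" by blast
  qed
  define c where "c = (\<lambda>(i, j). p i j + w i + w j)"
  obtain k0 l0 where kl0: "(k0, l0) \<in> S" "\<And>i j. (i, j) \<in> S \<Longrightarrow> c (k0, l0) \<le> c (i, j)"
    using arg_min_if_finite[OF S, of c] by (metis not_le surj_pair)
  \<comment> \<open>There is no relation at row 4. If the minimal pair contains 4, the relation at
    its other member replaces 4 by an index that gives no larger value.\<close>
  have "\<exists>k l. (k, l) \<in> S \<and> k \<noteq> 4 \<and> l \<noteq> 4 \<and> c (k, l) \<le> c (k0, l0)"
  proof -
    have flip: "\<exists>k l. (k, l) \<in> S \<and> k \<noteq> 4 \<and> l \<noteq> 4 \<and> c (k, l) \<le> c (i, 4)" if "i < 4" for i
    proof -
      have "\<exists>m'<5. m' \<noteq> i \<and> m' \<noteq> 4 \<and> p i m' + w m' \<le> p i 4 + w 4"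
        by (rule circ) (use that in auto)
      then obtain m where m: "m < 5" "m \<noteq> i" "m \<noteq> 4" "p i m + w m \<le> p i 4 + w 4" by blast
      then show ?thesis using that by (intro exI[of _ i] exI[of _ m]) (simp add: S_def c_def)
    qed
    consider "k0 \<noteq> 4 \<and> l0 \<noteq> 4" | "k0 < 4" "l0 = 4" | "k0 = 4" "l0 < 4"
      using kl0(1) by (auto simp: S_def)
    then show ?thesis
    proof cases
      case 3
      then have "c (k0, l0) = c (l0, 4)" using sym[of 4 l0] by (simp add: c_def)
      then show ?thesis using flip[OF 3(2)] by simp
    qed (use flip[of k0] kl0 in auto)
  qed
  then obtain k l where "(k, l) \<in> S" "k \<noteq> 4" "l \<noteq> 4" and cle: "c (k, l) \<le> c (k0, l0)" by blast
  then have kl: "k < 4" "l < 4" "k \<noteq> l" "c (k, l) \<le> c (k0, l0)"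
    by (auto simp: S_def)
  have min: "p k l + w k + w l \<le> p i j + w i + w j" if "i < 5" "j < 5" "i \<noteq> j" for i j
    using kl(4) kl0(2)[of i j] that by (auto simp: S_def c_def)
  obtain m0 m1 m2 where m: "{m0,m1,m2,k,l} = {..<5}" "distinct [m0,m1,m2,k,l]"
    using other_three[of k l] kl by auto
  have mm: "m < 5" "m \<noteq> k" "m \<noteq> l" if "m \<in> {m0,m1,m2}" for m using m that by auto
  have cov: "m \<in> {m0,m1,m2}" if "m < 5" "m \<noteq> k" "m \<noteq> l" for m
  proof -
    have "m \<in> {m0,m1,m2,k,l}" using that m(1) by simp
    then show ?thesis using that by auto
  qed
  have "\<exists>m'<5. m' \<noteq> l \<and> m' \<noteq> k \<and> p l m' + w m' \<le> p l k + w k"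
    using circ[OF kl(2), of k] kl by auto
  then obtain x where x: "x < 5" "x \<noteq> l" "x \<noteq> k" "p l x + w x \<le> p l k + w k" by blast
  have "p x l + w x = p k l + w k"
    using min[of x l] x sym[of x l] sym[of k l] kl by simp
  then have ex1: "\<exists>m\<in>{m0,m1,m2}. p m l + w m = p k l + w k"
    using cov[of x] x by blast
  have "\<exists>m'<5. m' \<noteq> k \<and> m' \<noteq> l \<and> p k m' + w m' \<le> p k l + w l"
    using circ[OF kl(1), of l] kl by auto
  then obtain y where y: "y < 5" "y \<noteq> k" "y \<noteq> l" "p k y + w y \<le> p k l + w l" by blast
  have "p k y + w y = p k l + w l"
    using min[of k y] y kl by simp
  then have ex2: "\<exists>m\<in>{m0,m1,m2}. p k m + w m = p k l + w l"
    using cov[of y] y by blast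
  have "\<exists>a0 a1 a2 ak al. hval a0 (w m0) \<and> hval a1 (w m1) \<and> hval a2 (w m2) \<and> hval ak (w k) \<and> hval al (w l) \<and>
    a0 * f m0 + a1 * f m1 + a2 * f m2 + ak * f k + al * f l = 0 \<and>
    a0 * g m0 + a1 * g m1 + a2 * g m2 + ak * g k + al * g l = 0"
  proof (rule solve_two_linear[OF F, where pkl = "p k l" and pl = "\<lambda>m. p m l" and pk = "\<lambda>m. p k m"])
    show "hval (f k * g l - f l * g k) (p k l)" using val[of k l] kl by simp
    fix m assume m': "m \<in> {m0,m1,m2}"
    note mm = mm[OF m']
    show "hval (f m * g l - f l * g m) (p m l)" "hval (f k * g m - f m * g k) (p k m)"
      using val[of m l] val[of k m] mm kl by auto
    show "p k l + w k \<le> p m l + w m" "p k l + w l \<le> p k m + w m"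
      using min[of m l] min[of k m] mm kl by auto
  qed (use ex1 ex2 in auto)
  then obtain a0 a1 a2 ak al where a: "hval a0 (w m0)" "hval a1 (w m1)" "hval a2 (w m2)" "hval ak (w k)" "hval al (w l)"
    "a0 * f m0 + a1 * f m1 + a2 * f m2 + ak * f k + al * f l = 0"
    "a0 * g m0 + a1 * g m1 + a2 * g m2 + ak * g k + al * g l = 0"
    by blast
  define h where "h = (\<lambda>i. if i = m0 then a0 else if i = m1 then a1 else if i = m2 then a2 else if i = k then ak else al)"
  have h: "h m0 = a0" "h m1 = a1" "h m2 = a2" "h k = ak" "h l = al"
    using m(2) by (auto simp: h_def)
  have "(\<Sum>i<5. h i * q i) = a0 * q m0 + a1 * q m1 + a2 * q m2 + ak * q k + al * q l" for q
    unfolding m(1)[symmetric] using m(2) h by (simp add: add.assoc)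
  moreover have "hval (h i) (w i)" if "i < 5" for i
  proof -
    have "i \<in> {m0,m1,m2,k,l}" using that m(1) by simp
    then show ?thesis using a h by auto
  qed
  ultimately show ?thesis using a(6,7) by (intro exI[of _ h]) simp
qed

lemma neg_combination:
  fixes x y z e a b c :: "'b::comm_ring_1"
  shows "- (x * e) * a + - (y * e) * b + - (z * e) * c = - (a * x + b * y + c * z) * e"
  by (simp add: algebra_simps)

text \<open>Combining the two equations with the entries of row 4 removes the unknown
  \<open>a 4\<close>; with those of row 3 it removes \<open>a 3\<close>.\<close>

lemma eliminate_coordinate:
  fixes f g a :: "nat \<Rightarrow> 'b::comm_ring_1"
  assumes "(\<Sum>i<5. a i * f i) = 0" "(\<Sum>i<5. a i * g i) = 0"
  shows "a 3 * (f 3 * g 4 - f 4 * g 3)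
      = - (a 0 * (f 0 * g 4 - f 4 * g 0) + a 1 * (f 1 * g 4 - f 4 * g 1) + a 2 * (f 2 * g 4 - f 4 * g 2))"
    and "a 4 * (f 3 * g 4 - f 4 * g 3)
      = - (a 0 * (f 3 * g 0 - f 0 * g 3) + a 1 * (f 3 * g 1 - f 1 * g 3) + a 2 * (f 3 * g 2 - f 2 * g 3))"
proof -
  have "(\<Sum>i<5. a i * f i) * g 4 - (\<Sum>i<5. a i * g i) * f 4 = 0" using assms by simp
  then have "(a 0 * (f 0 * g 4 - f 4 * g 0) + a 1 * (f 1 * g 4 - f 4 * g 1) + a 2 * (f 2 * g 4 - f 4 * g 2))
      + a 3 * (f 3 * g 4 - f 4 * g 3) = 0"
    unfolding sum_lessThan_5 by (simp add: algebra_simps)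
  then show "a 3 * (f 3 * g 4 - f 4 * g 3)
      = - (a 0 * (f 0 * g 4 - f 4 * g 0) + a 1 * (f 1 * g 4 - f 4 * g 1) + a 2 * (f 2 * g 4 - f 4 * g 2))"
    by (rule minus_unique[symmetric])
  have "f 3 * (\<Sum>i<5. a i * g i) - g 3 * (\<Sum>i<5. a i * f i) = 0" using assms by simp
  then have "(a 0 * (f 3 * g 0 - f 0 * g 3) + a 1 * (f 3 * g 1 - f 1 * g 3) + a 2 * (f 3 * g 2 - f 2 * g 3))
      + a 4 * (f 3 * g 4 - f 4 * g 3) = 0"
    unfolding sum_lessThan_5 by (simp add: algebra_simps)
  then show "a 4 * (f 3 * g 4 - f 4 * g 3)
      = - (a 0 * (f 3 * g 0 - f 0 * g 3) + a 1 * (f 3 * g 1 - f 1 * g 3) + a 2 * (f 3 * g 2 - f 2 * g 3))"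
    by (rule minus_unique[symmetric])
qed

text \<open>The vectors orthogonal to \<open>f\<close> and \<open>g\<close> form a space of
  dimension 3. As the determinant of points 3 and 4 is nonzero, the first three coordinates
  parametrise it: \<open>M\<close> is the identity in rows 0 to 2 and holds the elimination
  coefficients in rows 3 and 4.\<close>

lemma tree_lift:
  fixes f g :: "nat \<Rightarrow> 'a::field hahn"
  assumes F: "infinite (UNIV :: 'a set) \<or> card (UNIV :: 'a set) \<ge> 4"
    and val: "\<And>i j. i < 5 \<Longrightarrow> j < 5 \<Longrightarrow> i \<noteq> j \<Longrightarrow> hval (f i * g j - f j * g i) (p i j)"
    and circ: "\<And>i m j. i < 4 \<Longrightarrow> m < 5 \<Longrightarrow> m \<noteq> i \<Longrightarrow> j < 5 \<Longrightarrow>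
      \<exists>m'<5. m' \<noteq> i \<and> m' \<noteq> m \<and> p i m' + b m' j \<le> p i m + b m j"
  shows "lift3 TYPE('a) b"
proof -
  have "\<forall>j\<in>{..<5}. \<exists>a. (\<forall>i<5. hval (a i) (b i j)) \<and> (\<Sum>i<5. a i * f i) = 0 \<and> (\<Sum>i<5. a i * g i) = 0"
  proof
    fix j :: nat assume "j \<in> {..<5}"
    then have j: "j < 5" by simp
    show "\<exists>a. (\<forall>i<5. hval (a i) (b i j)) \<and> (\<Sum>i<5. a i * f i) = 0 \<and> (\<Sum>i<5. a i * g i) = 0"
      by (rule column_lift[OF F val circ[OF _ _ _ j]])
  qed
  from bchoice[OF this] obtain A where
    "\<forall>j\<in>{..<5}. (\<forall>i<5. hval (A j i) (b i j)) \<and> (\<Sum>i<5. A j i * f i) = 0 \<and> (\<Sum>i<5. A j i * g i) = 0" ..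
  then have A: "\<And>i j. j < 5 \<Longrightarrow> i < 5 \<Longrightarrow> hval (A j i) (b i j)"
    "\<And>j. j < 5 \<Longrightarrow> (\<Sum>i<5. A j i * f i) = 0" "\<And>j. j < 5 \<Longrightarrow> (\<Sum>i<5. A j i * g i) = 0"
    by simp_all
  define d where "d = f 3 * g 4 - f 4 * g 3"
  have d: "d * inverse d = 1" using hval_nz[OF val[of 3 4]] by (simp add: d_def)
  define M where "M i k = (if i = 3 then - ((f k * g 4 - f 4 * g k) * inverse d)
    else if i = 4 then - ((f 3 * g k - f k * g 3) * inverse d)
    else if i = k then 1 else (0 :: 'a hahn))" for i k :: nat
  have "(\<Sum>k<3. M i k * A j k) = A j i" if "i < 5" "j < 5" for i j
  proof -
    have s: "A j i = A j i * d * inverse d" for i using d by (simp add: mult.assoc)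
    have "i < 3 \<or> i = 3 \<or> i = 4" using that(1) by arith
    then consider "i < 3" | "i = 3" | "i = 4" by blast
    then show ?thesis
    proof cases
      case 1
      then have "(\<Sum>k<3. M i k * A j k) = (\<Sum>k<3. if k = i then A j k else 0)"
        by (intro sum.cong) (auto simp: M_def)
      then show ?thesis using 1 by (simp add: sum.delta)
    next
      case 2
      have "(\<Sum>k<3. M 3 k * A j k) = A j 3 * d * inverse d"
        unfolding d_def eliminate_coordinate(1)[OF A(2,3)[OF that(2)]]
        unfolding sum_lessThan_3 M_def d_def if_P[OF refl] by (rule neg_combination)
      then show ?thesis using 2 s[of 3] by (simp only:)
    next
      case 3
      have M4: "M 4 k = - ((f 3 * g k - f k * g 3) * inverse d)" for k by (simp add: M_def)
      have "(\<Sum>k<3. M 4 k * A j k) = A j 4 * d * inverse d"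
        unfolding d_def eliminate_coordinate(2)[OF A(2,3)[OF that(2)]]
        unfolding sum_lessThan_3 M4 d_def by (rule neg_combination)
      then show ?thesis using 3 s[of 4] by (simp only:)
    qed
  qed
  then have *: "\<forall>i<5. \<forall>j<5. hval (\<Sum>k<3. M i k * A j k) (b i j)" using A(1) by simp
  show ?thesis unfolding lift3_def
    by (rule exI[of _ M], rule exI[of _ "\<lambda>k j. A j k"]) (use * in simp)
qed

section \<open>Tropical dependence of rows\<close>

lemma permutes_power_id:
  assumes "finite S" "\<pi> permutes S"
  obtains n where "n > 0" "\<pi> ^^ n = id"
  using permutation_is_nilpotent[of \<pi>] assms permutation_permutes by blast

text \<open>Summed over one period of \<open>\<pi>\<close> and over all starting points the weights
  are nonpositive, so some moved point starts a closed walk of nonpositive weight. Its orbit is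
  \<open>C\<close>, and \<open>z\<close> is a potential along this walk.\<close>

lemma nonpos_cycle:
  fixes w :: "'b \<Rightarrow> real"
  assumes fin: "finite I" and \<pi>: "\<pi> permutes I" "\<pi> \<noteq> id" and w: "(\<Sum>i\<in>I. if \<pi> i = i then 0 else w i) \<le> 0"
  shows "\<exists>C z. C \<subseteq> I \<and> C \<noteq> {} \<and> (\<forall>i\<in>C. \<pi> i \<noteq> i \<and> \<pi> i \<in> C \<and> z (\<pi> i) \<le> z i - w i)"
proof -
  define v where "v i = (if \<pi> i = i then 0 else w i)" for i
  obtain n where n: "n > 0" "\<pi> ^^ n = id" using permutes_power_id[OF fin \<pi>(1)] .
  define M where "M = {i \<in> I. \<pi> i \<noteq> i}"
  have "M \<noteq> {}"
  proof -
    obtain i where "\<pi> i \<noteq> i" using \<pi>(2) by (auto simp: fun_eq_iff)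
    then have "i \<in> M" using \<pi>(1) by (auto simp: M_def permutes_def)
    then show ?thesis by blast
  qed
  have powI: "(\<pi> ^^ t) permutes I" for t by (rule permutes_funpow[OF \<pi>(1)])
  have inj: "inj \<pi>" using \<pi>(1) by (rule permutes_inj)
  have powM: "\<pi> ((\<pi> ^^ t) i) \<noteq> (\<pi> ^^ t) i" if "\<pi> i \<noteq> i" for t i
  proof (induction t)
    case (Suc t)
    then show ?case using inj by (simp add: inj_eq)
  qed (use that in simp)
  define s where "s i = (\<Sum>t<n. v ((\<pi> ^^ t) i))" for i
  have "(\<Sum>i\<in>I. s i) = (\<Sum>t<n. \<Sum>i\<in>I. v ((\<pi> ^^ t) i))"
    unfolding s_def by (rule sum.swap)
  also have "\<dots> = (\<Sum>t<n. \<Sum>i\<in>I. v i)"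
  proof (rule sum.cong[OF refl])
    fix t
    show "(\<Sum>i\<in>I. v ((\<pi> ^^ t) i)) = (\<Sum>i\<in>I. v i)"
      using sum.permute[OF powI[of t], of v] unfolding o_def by (rule sym)
  qed
  also have "\<dots> \<le> 0" using w by (simp add: v_def mult_nonneg_nonpos)
  finally have "(\<Sum>i\<in>I. s i) \<le> 0" .
  moreover have "(\<Sum>i\<in>I. s i) = (\<Sum>i\<in>M. s i)"
  proof (rule sum.mono_neutral_right[OF fin])
    show "M \<subseteq> I" by (auto simp: M_def)
    have "(\<pi> ^^ t) i = i" if "\<pi> i = i" for t i by (induction t) (use that in simp_all)
    then show "\<forall>i\<in>I - M. s i = 0" by (simp add: M_def s_def v_def)
  qed
  ultimately have "(\<Sum>i\<in>M. s i) \<le> 0" by simp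
  then obtain i0 where i0: "i0 \<in> M" "s i0 \<le> 0"
    using \<open>M \<noteq> {}\<close> fin sum_pos[of M s] by (force simp: M_def)
  define C where "C = {(\<pi> ^^ t) i0 | t. t < n}"
  \<comment> \<open>The period of \<open>\<pi>\<close> may be a proper multiple of the orbit length,
    so a point can be visited repeatedly; the potential is the least of the values met at its
    visits.\<close>
  define A where "A x = (\<lambda>t. - (\<Sum>r<t. v ((\<pi> ^^ r) i0))) ` {t. t < n \<and> (\<pi> ^^ t) i0 = x}" for x
  define z where "z x = Min (A x)" for x
  have finA: "finite (A x)" for x by (simp add: A_def)
  have neA: "A x \<noteq> {}" if "x \<in> C" for x using that by (auto simp: A_def C_def)
  have i0C: "i0 \<in> C" using n by (auto simp: C_def intro!: exI[of _ 0])
  have moved: "\<pi> x \<noteq> x" if "x \<in> C" for x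
    using that powM[of i0] i0(1) unfolding C_def M_def mem_Collect_eq by blast
  have step: "\<pi> x \<in> C \<and> z (\<pi> x) \<le> z x - w x" if x: "x \<in> C" for x
  proof -
    have "z x \<in> A x" unfolding z_def by (rule Min_in[OF finA neA[OF x]])
    then obtain t where t: "t < n" "(\<pi> ^^ t) i0 = x" "z x = - (\<Sum>r<t. v ((\<pi> ^^ r) i0))"
      by (auto simp: A_def)
    have "v x = w x" using moved[OF x] by (simp add: v_def)
    then have sum: "- (\<Sum>r<Suc t. v ((\<pi> ^^ r) i0)) = z x - w x" using t by simp
    show ?thesis
    proof (cases "Suc t < n")
      case True
      have pt: "(\<pi> ^^ Suc t) i0 = \<pi> x" using t by simp
      have "\<pi> x \<in> C" unfolding C_def mem_Collect_eq
        by (rule exI[of _ "Suc t"]) (use True pt in simp)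
      moreover have "z x - w x \<in> A (\<pi> x)"
        unfolding A_def using True pt sum by (intro image_eqI[of _ _ "Suc t"]) auto
      then have "z (\<pi> x) \<le> z x - w x" unfolding z_def[of "\<pi> x"] by (rule Min_le[OF finA])
      ultimately show ?thesis by blast
    next
      case False
      then have tn: "Suc t = n" using t by simp
      have "\<pi> x = (\<pi> ^^ Suc t) i0" unfolding t(2)[symmetric] by simp
      also have "\<dots> = i0" unfolding tn n(2) by simp
      finally have px: "\<pi> x = i0" .
      \<comment> \<open>Time 0 bounds the potential at \<open>i0\<close> by 0, and
        \<open>s i0 \<le> 0\<close> allows the last step back to \<open>i0\<close>.\<close>
      have "0 \<in> A i0" unfolding A_def using n by (intro image_eqI[of _ _ 0]) auto
      then have "z i0 \<le> 0" unfolding z_def by (rule Min_le[OF finA])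
      also have "0 \<le> - s i0" using i0 by simp
      also have "\<dots> = z x - w x" using sum tn by (simp add: s_def)
      finally show ?thesis using px i0C by simp
    qed
  qed
  have "C \<subseteq> I"
    using i0(1) permutes_in_image[OF powI] by (auto simp: C_def M_def)
  then show ?thesis using i0C moved step by blast
qed

text \<open>For a constant column set this says that every column attains its minimum twice. Letting
  the columns depend on the row splits it into separate requirements that a given row is not the
  strict minimum of a given column.\<close>

definition tkernel :: "nat set \<Rightarrow> (nat \<Rightarrow> nat set) \<Rightarrow> (nat \<Rightarrow> nat \<Rightarrow> real) \<Rightarrow> (nat \<Rightarrow> real) \<Rightarrow> bool" where
  "tkernel I S b z \<longleftrightarrow> (\<forall>i\<in>I. \<forall>j\<in>S i. \<exists>k\<in>I. k \<noteq> i \<and> z k + b k j \<le> z i + b i j)"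

lemma tkernel_shift: "tkernel I S b z \<Longrightarrow> tkernel I S b (\<lambda>i. z i - c)"
  by (simp add: tkernel_def)

text \<open>Both solutions are normalised to vanish at \<open>i0\<close>, and their pointwise
  minimum is taken. At row \<open>i0\<close> it agrees with both, so each of them serves its own
  columns; at any other row the solution that attains the minimum serves.\<close>

lemma tkernel_choice:
  assumes "tkernel I (S(i0 := A)) b z" "tkernel I (S(i0 := B)) b z'"
  shows "\<exists>y. tkernel I (S(i0 := A \<union> B)) b y"
proof -
  define u u' where "u = (\<lambda>i. z i - z i0)" and "u' = (\<lambda>i. z' i - z' i0)"
  have u: "tkernel I (S(i0 := A)) b u" "tkernel I (S(i0 := B)) b u'"
    unfolding u_def u'_def using assms by (auto intro: tkernel_shift)
  have "tkernel I (S(i0 := A \<union> B)) b (\<lambda>i. min (u i) (u' i))"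
    unfolding tkernel_def
  proof (intro ballI)
    fix i j assume i: "i \<in> I" and j: "j \<in> (S(i0 := A \<union> B)) i"
    have 1: "\<exists>k\<in>I. k \<noteq> i \<and> min (u k) (u' k) + b k j \<le> u i + b i j" if "j \<in> (S(i0 := A)) i"
      using u(1) i that unfolding tkernel_def by (meson add_right_mono min.cobounded1 order_trans)
    have 2: "\<exists>k\<in>I. k \<noteq> i \<and> min (u k) (u' k) + b k j \<le> u' i + b i j" if "j \<in> (S(i0 := B)) i"
      using u(2) i that unfolding tkernel_def by (meson add_right_mono min.cobounded2 order_trans)
    show "\<exists>k\<in>I. k \<noteq> i \<and> min (u k) (u' k) + b k j \<le> min (u i) (u' i) + b i j"
    proof (cases "i = i0")
      case True
      then have "u i = 0" "u' i = 0" by (simp_all add: u_def u'_def)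
      then show ?thesis using 1 2 j True by auto
    next
      case False
      then show ?thesis using 1 2 j by (cases "u i \<le> u' i") (auto simp: min_def)
    qed
  qed
  then show ?thesis by blast
qed

text \<open>A permutation no heavier than the identity gives a cycle with a potential; if two rows
  share their column, exchanging them is such a cycle. A row outside the cycle receives the weight
  that makes it tie with a fixed row \<open>c\<close> of the cycle in its own column.\<close>

lemma tkernel_single:
  assumes fin: "finite I" and card: "card I \<ge> 2"
    and sing: "inj_on \<sigma> I \<Longrightarrow> \<exists>\<pi>. \<pi> permutes I \<and> \<pi> \<noteq> id \<and> (\<Sum>i\<in>I. b (\<pi> i) (\<sigma> i)) \<le> (\<Sum>i\<in>I. b i (\<sigma> i))"
  shows "\<exists>z. tkernel I (\<lambda>i. {\<sigma> i}) b z"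
proof -
  have "\<exists>C \<pi> z. C \<subseteq> I \<and> C \<noteq> {} \<and> (\<forall>i\<in>C. \<pi> i \<noteq> i \<and> \<pi> i \<in> C \<and> z (\<pi> i) \<le> z i - (b (\<pi> i) (\<sigma> i) - b i (\<sigma> i)))"
  proof (cases "inj_on \<sigma> I")
    case True
    then obtain \<pi> where \<pi>: "\<pi> permutes I" "\<pi> \<noteq> id" "(\<Sum>i\<in>I. b (\<pi> i) (\<sigma> i)) \<le> (\<Sum>i\<in>I. b i (\<sigma> i))"
      using sing by blast
    have "(\<Sum>i\<in>I. if \<pi> i = i then 0 else b (\<pi> i) (\<sigma> i) - b i (\<sigma> i)) = (\<Sum>i\<in>I. b (\<pi> i) (\<sigma> i) - b i (\<sigma> i))"
      by (rule sum.cong) auto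
    then have "(\<Sum>i\<in>I. if \<pi> i = i then 0 else b (\<pi> i) (\<sigma> i) - b i (\<sigma> i)) \<le> 0"
      using \<pi>(3) by (simp add: sum_subtractf)
    from nonpos_cycle[OF fin \<pi>(1,2) this] show ?thesis by (elim exE) (rule exI, rule exI, rule exI)
  next
    case False
    then obtain x y where xy: "x \<in> I" "y \<in> I" "x \<noteq> y" "\<sigma> x = \<sigma> y" by (auto simp: inj_on_def)
    then show ?thesis
      by (intro exI[of _ "{x, y}"] exI[of _ "\<lambda>i. if i = x then y else x"] exI[of _ "\<lambda>i. - b i (\<sigma> x)"]) auto
  qed
  then obtain C \<pi> z where "C \<subseteq> I \<and> C \<noteq> {} \<and>
      (\<forall>i\<in>C. \<pi> i \<noteq> i \<and> \<pi> i \<in> C \<and> z (\<pi> i) \<le> z i - (b (\<pi> i) (\<sigma> i) - b i (\<sigma> i)))"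
    by (elim exE)
  then have C: "C \<subseteq> I" "C \<noteq> {}"
    "\<And>i. i \<in> C \<Longrightarrow> \<pi> i \<noteq> i \<and> \<pi> i \<in> C \<and> z (\<pi> i) \<le> z i - (b (\<pi> i) (\<sigma> i) - b i (\<sigma> i))" by simp_all
  obtain c where c: "c \<in> C" using C(2) by blast
  define y where "y i = (if i \<in> C then z i else z c + b c (\<sigma> i) - b i (\<sigma> i))" for i
  have "tkernel I (\<lambda>i. {\<sigma> i}) b y"
    unfolding tkernel_def
  proof (intro ballI)
    fix i j assume i: "i \<in> I" and "j \<in> {\<sigma> i}"
    then have j: "j = \<sigma> i" by simp
    show "\<exists>k\<in>I. k \<noteq> i \<and> y k + b k j \<le> y i + b i j"
    proof (cases "i \<in> C")
      case True
      then show ?thesis using C(1) C(3)[OF True] j by (intro bexI[of _ "\<pi> i"]) (auto simp: y_def)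
    next
      case False
      then show ?thesis using c C(1) j by (intro bexI[of _ c]) (auto simp: y_def)
    qed
  qed
  then show ?thesis by blast
qed

text \<open>Rows whose maximal minors are all singular are tropically dependent. Solutions for two column sets at
  one row combine by \<open>tkernel_choice\<close>, so it suffices to prescribe one column per row.\<close>

lemma tkernel_exists:
  assumes fin: "finite I" "finite J" "J \<noteq> {}" and card: "card I \<ge> 2"
    and sing: "\<And>\<sigma>. inj_on \<sigma> I \<Longrightarrow> \<sigma> ` I \<subseteq> J \<Longrightarrow>
      \<exists>\<pi>. \<pi> permutes I \<and> \<pi> \<noteq> id \<and> (\<Sum>i\<in>I. b (\<pi> i) (\<sigma> i)) \<le> (\<Sum>i\<in>I. b i (\<sigma> i))"
  shows "\<exists>z. tkernel I (\<lambda>_. J) b z"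
proof -
  \<comment> \<open>Rows in \<open>L\<close> carry all columns, the others a single one. The outer
    induction enlarges \<open>L\<close>, the inner one adds the columns of the new row one by
    one.\<close>
  have "\<exists>z. tkernel I (\<lambda>i. if i \<in> L then J else {\<sigma> i}) b z" if "finite L" "\<sigma> ` I \<subseteq> J" for L \<sigma>
    using that
  proof (induction L arbitrary: \<sigma> rule: finite_induct)
    case empty
    then show ?case using tkernel_single[OF fin(1) card, of \<sigma> b] sing[of \<sigma>] by auto
  next
    case (insert i0 L)
    let ?S = "\<lambda>i. if i \<in> L then J else {\<sigma> i}"
    have "\<exists>z. tkernel I (?S(i0 := K)) b z" if "finite K" "K \<noteq> {}" "K \<subseteq> J" for K
      using that
    proof (induction K rule: finite_ne_induct)
      case (singleton j)
      have eq: "?S(i0 := {j}) = (\<lambda>i. if i \<in> L then J else {(\<sigma>(i0 := j)) i})"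
        using \<open>i0 \<notin> L\<close> by (simp add: fun_eq_iff)
      show ?case unfolding eq by (rule insert.IH) (use insert.prems singleton in auto)
    next
      case (insert j K)
      have "\<exists>z. tkernel I (?S(i0 := {j})) b z"
      proof -
        have eq: "?S(i0 := {j}) = (\<lambda>i. if i \<in> L then J else {(\<sigma>(i0 := j)) i})"
          using \<open>i0 \<notin> L\<close> by (simp add: fun_eq_iff)
        show ?thesis unfolding eq by (rule \<open>\<And>\<sigma>. \<sigma> ` I \<subseteq> J \<Longrightarrow> _\<close>) (use \<open>\<sigma> ` I \<subseteq> J\<close> insert.prems in auto)
      qed
      moreover have "\<exists>z. tkernel I (?S(i0 := K)) b z" by (rule insert.IH) (use insert.prems in simp)
      ultimately have "\<exists>z. tkernel I (?S(i0 := {j} \<union> K)) b z" by (elim exE) (rule tkernel_choice)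
      then show ?case unfolding insert_is_Un[of j K, symmetric] .
    qed
    from this[OF fin(2,3) order_refl] have "\<exists>z. tkernel I (?S(i0 := J)) b z" .
    moreover have "?S(i0 := J) = (\<lambda>i. if i \<in> insert i0 L then J else {\<sigma> i})"
      by (simp add: fun_eq_iff)
    ultimately show ?case by (simp only:)
  qed
  note * = this
  obtain j where j: "j \<in> J" using fin(3) by blast
  have eq: "(\<lambda>i. if i \<in> I then J else {j}) = (\<lambda>i. if i \<in> I then J else {(\<lambda>_. j) i})" by simp
  obtain z where "tkernel I (\<lambda>i. if i \<in> I then J else {j}) b z"
    using *[OF fin(1), of "\<lambda>_. j"] j by auto
  then show ?thesis by (intro exI[of _ z]) (simp add: tkernel_def)
qed

section \<open>Matrices without non-singular 4 by 4 minors\<close>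

text \<open>As \<open>\<rho>\<close> and \<open>\<sigma>\<close> run through all orderings of rows
  and columns, every permutation of a minor becomes its diagonal, so a competitor is demanded for
  the diagonal only.\<close>

definition rank3 :: "(nat \<Rightarrow> nat \<Rightarrow> real) \<Rightarrow> bool" where
  "rank3 b \<longleftrightarrow> (\<forall>\<rho> \<sigma>. inj_on \<rho> {..<4} \<longrightarrow> \<rho> ` {..<4} \<subseteq> {..<5} \<longrightarrow> inj_on \<sigma> {..<4} \<longrightarrow> \<sigma> ` {..<4} \<subseteq> {..<5} \<longrightarrow>
    (\<exists>\<pi>. \<pi> permutes {..<4::nat} \<and> \<pi> \<noteq> id \<and> (\<Sum>i<4. b (\<rho> (\<pi> i)) (\<sigma> i)) \<le> (\<Sum>i<4. b (\<rho> i) (\<sigma> i))))"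

text \<open>After subtraction of the potentials the minor is nonnegative, zero on the diagonal and
  positive below it. A permutation other than the identity moves some index upwards and so uses a
  positive entry; the diagonal would be the unique minimum.\<close>

lemma tri_contra:
  assumes r3: "rank3 b"
    and inj: "distinct [r0,r1,r2,r3]" "distinct [c0,c1,c2,c3]" "{r0,r1,r2,r3,c0,c1,c2,c3} \<subseteq> {..<5}"
    and eq: "b r0 c0 = x r0 + y c0" "b r1 c1 = x r1 + y c1" "b r2 c2 = x r2 + y c2" "b r3 c3 = x r3 + y c3"
    and ge: "b r0 c1 \<ge> x r0 + y c1" "b r0 c2 \<ge> x r0 + y c2" "b r0 c3 \<ge> x r0 + y c3"
      "b r1 c2 \<ge> x r1 + y c2" "b r1 c3 \<ge> x r1 + y c3" "b r2 c3 \<ge> x r2 + y c3"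
    and gt: "b r1 c0 > x r1 + y c0" "b r2 c0 > x r2 + y c0" "b r3 c0 > x r3 + y c0"
      "b r2 c1 > x r2 + y c1" "b r3 c1 > x r3 + y c1" "b r3 c2 > x r3 + y c2"
  shows False
proof -
  define \<rho> \<sigma> where "\<rho> = (!) [r0,r1,r2,r3]" and "\<sigma> = (!) [c0,c1,c2,c3]"
  have four: "i < 4 \<longleftrightarrow> i = 0 \<or> i = 1 \<or> i = 2 \<or> i = 3" for i :: nat by auto
  have "inj_on \<rho> {..<4}" "inj_on \<sigma> {..<4}"
    using inj(1,2) by (auto simp: inj_on_def \<rho>_def \<sigma>_def four)
  moreover have "\<rho> ` {..<4} \<subseteq> {..<5}" "\<sigma> ` {..<4} \<subseteq> {..<5}"
    using inj(3) by (auto simp: \<rho>_def \<sigma>_def four)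
  ultimately obtain \<pi> where \<pi>: "\<pi> permutes {..<4}" "\<pi> \<noteq> id"
    "(\<Sum>i<4. b (\<rho> (\<pi> i)) (\<sigma> i)) \<le> (\<Sum>i<4. b (\<rho> i) (\<sigma> i))"
    using r3 unfolding rank3_def by blast
  have lt: "\<pi> i < 4" if "i < 4" for i using permutes_in_image[OF \<pi>(1), of i] that by simp
  have up: "b (\<rho> k) (\<sigma> i) \<ge> x (\<rho> k) + y (\<sigma> i)" "k > i \<Longrightarrow> b (\<rho> k) (\<sigma> i) > x (\<rho> k) + y (\<sigma> i)"
    if "i < 4" "k < 4" for i k
  proof -
    have *: "\<rho> 0 = r0" "\<rho> 1 = r1" "\<rho> 2 = r2" "\<rho> 3 = r3" "\<sigma> 0 = c0" "\<sigma> 1 = c1" "\<sigma> 2 = c2" "\<sigma> 3 = c3"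
      by (simp_all add: \<rho>_def \<sigma>_def)
    have k: "k = 0 \<or> k = 1 \<or> k = 2 \<or> k = 3" using that(2) by arith
    have i: "i = 0 \<or> i = 1 \<or> i = 2 \<or> i = 3" using that(1) by arith
    show "b (\<rho> k) (\<sigma> i) \<ge> x (\<rho> k) + y (\<sigma> i)"
      using i k by (elim disjE)
        (simp_all only: * ge gt[THEN less_imp_le] eq[symmetric, THEN eq_refl])
    show "k > i \<Longrightarrow> b (\<rho> k) (\<sigma> i) > x (\<rho> k) + y (\<sigma> i)"
      using i k by (elim disjE) (simp_all only: *, use gt in simp_all)+
  qed
  have diag: "b (\<rho> i) (\<sigma> i) = x (\<rho> i) + y (\<sigma> i)" if "i < 4" for i
  proof -
    have "i = 0 \<or> i = 1 \<or> i = 2 \<or> i = 3" using that by arith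
    then show ?thesis using eq by (elim disjE) (simp_all add: \<rho>_def \<sigma>_def)
  qed
  have "\<exists>i<4. \<pi> i > i"
  proof (rule ccontr)
    assume no: "\<not> (\<exists>i<4. \<pi> i > i)"
    have "\<pi> i = i" if "i < 4" for i
      using that
    proof (induction i rule: less_induct)
      case (less i)
      have "\<pi> i \<le> i" using no less.prems by (meson not_le)
      moreover have "\<pi> i = i" if "\<pi> i < i"
        using less.IH[OF that] that less.prems permutes_inj[OF \<pi>(1)] by (simp add: inj_eq)
      ultimately show ?case by force
    qed
    then have "\<pi> i = i" for i using permutes_not_in[OF \<pi>(1), of i] by (cases "i < 4") simp_all
    then show False using \<pi>(2) by (simp add: fun_eq_iff)
  qed
  then obtain i0 where i0: "i0 < 4" "\<pi> i0 > i0" by blast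
  have "(\<Sum>i<4. x (\<rho> (\<pi> i)) + y (\<sigma> i)) < (\<Sum>i<4. b (\<rho> (\<pi> i)) (\<sigma> i))"
  proof (rule sum_strict_mono_ex1)
    show "\<forall>i\<in>{..<4}. x (\<rho> (\<pi> i)) + y (\<sigma> i) \<le> b (\<rho> (\<pi> i)) (\<sigma> i)" using up(1) lt by simp
    show "\<exists>i\<in>{..<4}. x (\<rho> (\<pi> i)) + y (\<sigma> i) < b (\<rho> (\<pi> i)) (\<sigma> i)"
      using up(2)[OF i0(1) lt[OF i0(1)] i0(2)] i0(1) by blast
  qed simp
  moreover have "(\<Sum>i<4. x (\<rho> (\<pi> i)) + y (\<sigma> i)) = (\<Sum>i<4. x (\<rho> i) + y (\<sigma> i))"
    using sum.permute[OF \<pi>(1), of "\<lambda>i. x (\<rho> i)"] by (simp add: sum.distrib o_def)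
  moreover have "(\<Sum>i<4. b (\<rho> i) (\<sigma> i)) = (\<Sum>i<4. x (\<rho> i) + y (\<sigma> i))"
    by (rule sum.cong) (use diag in auto)
  ultimately show False using \<pi>(3) by simp
qed

lemma kernel_rows:
  assumes r3: "rank3 b" and i0: "i0 < 5"
  shows "\<exists>z. \<forall>j<5. \<forall>i<5. i \<noteq> i0 \<longrightarrow> (\<exists>k<5. k \<noteq> i0 \<and> k \<noteq> i \<and> z k + b k j \<le> z i + b i j)"
proof -
  let ?I = "{..<5} - {i0}"
  have "card ?I = 4" using i0 by simp
  then obtain \<rho> where \<rho>: "bij_betw \<rho> {..<4::nat} ?I"
    using ex_bij_betw_nat_finite[of ?I] by (auto simp: atLeast0LessThan)
  have "\<exists>z. tkernel ?I (\<lambda>_. {..<5}) b z"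
  proof (rule tkernel_exists)
    fix \<sigma> :: "nat \<Rightarrow> nat" assume \<sigma>: "inj_on \<sigma> ?I" "\<sigma> ` ?I \<subseteq> {..<5}"
    have inj: "inj_on \<rho> {..<4}" and im: "\<rho> ` {..<4} = ?I" using \<rho> by (auto simp: bij_betw_def)
    have inj': "inj_on (\<sigma> \<circ> \<rho>) {..<4}" by (rule comp_inj_on[OF inj]) (use \<sigma> im in simp)
    have im': "\<rho> ` {..<4} \<subseteq> {..<5}" unfolding im by blast
    have im'': "(\<sigma> \<circ> \<rho>) ` {..<4} \<subseteq> {..<5}" unfolding image_comp[symmetric] im by (rule \<sigma>(2))
    obtain \<pi> where \<pi>: "\<pi> permutes {..<4::nat}" "\<pi> \<noteq> id"
      "(\<Sum>i<4. b (\<rho> (\<pi> i)) ((\<sigma> \<circ> \<rho>) i)) \<le> (\<Sum>i<4. b (\<rho> i) ((\<sigma> \<circ> \<rho>) i))"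
      using r3[unfolded rank3_def, rule_format, OF inj im' inj' im''] by blast
    define q where "q = inv_into {..<4} \<rho>"
    have q: "q (\<rho> i) = i" if "i < 4" for i using \<rho> that by (auto simp: q_def bij_betw_def)
    have \<rho>q: "\<rho> (q i) = i" "q i < 4" if "i \<in> ?I" for i
      using that \<rho> bij_betw_inv_into_right[OF \<rho> that] bij_betwE[OF bij_betw_inv_into[OF \<rho>]] by (auto simp: q_def)
    define \<tau> where "\<tau> i = (if i \<in> ?I then \<rho> (\<pi> (q i)) else i)" for i
    have "bij_betw (\<rho> \<circ> (\<pi> \<circ> q)) ?I ?I"
      using \<rho> permutes_imp_bij[OF \<pi>(1)] bij_betw_inv_into[OF \<rho>] unfolding q_def by (blast intro: bij_betw_trans)
    then have "bij_betw \<tau> ?I ?I" by (rule bij_betw_cong[THEN iffD1, rotated]) (auto simp: \<tau>_def)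
    then have \<tau>: "\<tau> permutes ?I" by (rule bij_imp_permutes) (unfold \<tau>_def, rule if_not_P)
    have re: "(\<Sum>i\<in>?I. h i) = (\<Sum>i<4. h (\<rho> i))" for h :: "nat \<Rightarrow> real"
      by (rule sum.reindex_bij_betw[OF \<rho>, symmetric])
    have \<rho>I: "\<rho> i \<in> ?I" if "i < 4" for i using bij_betwE[OF \<rho>] that by auto
    have e: "\<tau> (\<rho> i) = \<rho> (\<pi> i)" if "i < 4" for i using \<rho>I[OF that] q[OF that] by (simp add: \<tau>_def)
    have "\<tau> \<noteq> id"
    proof
      assume "\<tau> = id"
      then have "\<rho> (\<pi> i) = \<rho> i" if "i < 4" for i using e[OF that] by simp
      then have "\<pi> i = i" if "i < 4" for i
        using that \<rho> permutes_in_image[OF \<pi>(1), of i] by (auto simp: bij_betw_def inj_on_def)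
      then have "\<pi> i = i" for i using permutes_not_in[OF \<pi>(1), of i] by (cases "i < 4") simp_all
      then show False using \<pi>(2) by (simp add: fun_eq_iff)
    qed
    then show "\<exists>\<pi>. \<pi> permutes ?I \<and> \<pi> \<noteq> id \<and> (\<Sum>i\<in>?I. b (\<pi> i) (\<sigma> i)) \<le> (\<Sum>i\<in>?I. b i (\<sigma> i))"
      using \<tau> \<pi>(3) e unfolding re by (intro exI[of _ \<tau>]) auto
  qed (use i0 in \<open>auto simp: card_Diff_subset\<close>)
  then obtain z where "tkernel ?I (\<lambda>_. {..<5}) b z" ..
  then show ?thesis unfolding tkernel_def by (intro exI[of _ z]) auto
qed

text \<open>The minimum of four numbers is attained at least twice, phrased by inequalities alone to
  suit linear arithmetic.\<close>

definition tw :: "real \<Rightarrow> real \<Rightarrow> real \<Rightarrow> real \<Rightarrow> bool" where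
  "tw a b c d \<longleftrightarrow> (b \<le> a \<or> c \<le> a \<or> d \<le> a) \<and> (a \<le> b \<or> c \<le> b \<or> d \<le> b) \<and>
    (a \<le> c \<or> b \<le> c \<or> d \<le> c) \<and> (a \<le> d \<or> b \<le> d \<or> c \<le> d)"

lemma twD:
  assumes "tw a b c d"
  shows "b \<le> a \<or> c \<le> a \<or> d \<le> a" "a \<le> b \<or> c \<le> b \<or> d \<le> b"
    "a \<le> c \<or> b \<le> c \<or> d \<le> c" "a \<le> d \<or> b \<le> d \<or> c \<le> d"
  using assms by (auto simp: tw_def)

lemma kernel_tw:
  assumes "rank3 b" "distinct [i0,r1,r2,r3,r4]" "{i0,r1,r2,r3,r4} = {..<5}"
  shows "\<exists>z. \<forall>j<5. tw (z r1 + b r1 j) (z r2 + b r2 j) (z r3 + b r3 j) (z r4 + b r4 j)"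
proof -
  have lt: "i0 < 5" "r1 < 5" "r2 < 5" "r3 < 5" "r4 < 5" using assms(3) by auto
  obtain z where z: "\<And>j i. j < 5 \<Longrightarrow> i < 5 \<Longrightarrow> i \<noteq> i0 \<Longrightarrow> \<exists>k<5. k \<noteq> i0 \<and> k \<noteq> i \<and> z k + b k j \<le> z i + b i j"
    using kernel_rows[OF assms(1) lt(1)] by blast
  have mem: "k = r1 \<or> k = r2 \<or> k = r3 \<or> k = r4" if "k < 5" "k \<noteq> i0" for k
  proof -
    have "k \<in> {i0,r1,r2,r3,r4}" using that assms(3) by simp
    then show ?thesis using that by simp
  qed
  have "tw (z r1 + b r1 j) (z r2 + b r2 j) (z r3 + b r3 j) (z r4 + b r4 j)" if j: "j < 5" for j
  proof -
    have e: "\<exists>k. (k = r1 \<or> k = r2 \<or> k = r3 \<or> k = r4) \<and> k \<noteq> i \<and> z k + b k j \<le> z i + b i j"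
      if "i \<in> {r1,r2,r3,r4}" for i
    proof -
      have "i < 5" "i \<noteq> i0" using that lt assms(2) by auto
      from z[OF j this] show ?thesis using mem by blast
    qed
    show ?thesis unfolding tw_def using e[of r1] e[of r2] e[of r3] e[of r4] by auto
  qed
  then show ?thesis by blast
qed

text \<open>\<open>tree_lift\<close> with points and degrees as separate parameters, so that a
  configuration is given by instantiation.\<close>

lemma tree_tw:
  fixes f0 :: "'a::field hahn"
  assumes F: "infinite (UNIV :: 'a set) \<or> card (UNIV :: 'a set) \<ge> 4"
    and p: "hval (f0 * g1 - f1 * g0) p01" "hval (f0 * g2 - f2 * g0) p02" "hval (f0 * g3 - f3 * g0) p03"
      "hval (f0 * g4 - f4 * g0) p04" "hval (f1 * g2 - f2 * g1) p12" "hval (f1 * g3 - f3 * g1) p13"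
      "hval (f1 * g4 - f4 * g1) p14" "hval (f2 * g3 - f3 * g2) p23" "hval (f2 * g4 - f4 * g2) p24"
      "hval (f3 * g4 - f4 * g3) p34"
    and c: "\<And>j. j < 5 \<Longrightarrow> tw (p01 + b 1 j) (p02 + b 2 j) (p03 + b 3 j) (p04 + b 4 j)"
      "\<And>j. j < 5 \<Longrightarrow> tw (p01 + b 0 j) (p12 + b 2 j) (p13 + b 3 j) (p14 + b 4 j)"
      "\<And>j. j < 5 \<Longrightarrow> tw (p02 + b 0 j) (p12 + b 1 j) (p23 + b 3 j) (p24 + b 4 j)"
      "\<And>j. j < 5 \<Longrightarrow> tw (p03 + b 0 j) (p13 + b 1 j) (p23 + b 2 j) (p34 + b 4 j)"
  shows "lift3 TYPE('a) b"
proof -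
  define f g where "f = (!) [f0,f1,f2,f3,f4]" and "g = (!) [g0,g1,g2,g3,g4]"
  define p where "p = (\<lambda>i j. [[0,p01,p02,p03,p04],[p01,0,p12,p13,p14],[p02,p12,0,p23,p24],
    [p03,p13,p23,0,p34],[p04,p14,p24,p34,0]] ! i ! j)"
  have fs: "f 0 = f0" "f 1 = f1" "f 2 = f2" "f 3 = f3" "f 4 = f4"
    and gs: "g 0 = g0" "g 1 = g1" "g 2 = g2" "g 3 = g3" "g 4 = g4"
    by (simp_all add: f_def g_def)
  have ps: "p 0 1 = p01" "p 0 2 = p02" "p 0 3 = p03" "p 0 4 = p04" "p 1 2 = p12" "p 1 3 = p13" "p 1 4 = p14"
    "p 2 3 = p23" "p 2 4 = p24" "p 3 4 = p34"
    "p 1 0 = p01" "p 2 0 = p02" "p 3 0 = p03" "p 4 0 = p04" "p 2 1 = p12" "p 3 1 = p13" "p 4 1 = p14"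
    "p 3 2 = p23" "p 4 2 = p24" "p 4 3 = p34"
    by (simp_all add: p_def eval_nat_numeral)
  have v: "i = 0 \<and> j = 1 \<or> i = 0 \<and> j = 2 \<or> i = 0 \<and> j = 3 \<or> i = 0 \<and> j = 4 \<or> i = 1 \<and> j = 2 \<or>
     i = 1 \<and> j = 3 \<or> i = 1 \<and> j = 4 \<or> i = 2 \<and> j = 3 \<or> i = 2 \<and> j = 4 \<or> i = 3 \<and> j = 4"
    if "i < j" "j < (5::nat)" for i j using that by arith
  have val1: "hval (f i * g j - f j * g i) (p i j)" if "i < j" "j < 5" for i j
    using v[OF that] p by (elim disjE conjE) (simp_all only: fs gs ps)
  have sym: "p i j = p j i" if "i < j" "j < 5" for i j
    using v[OF that] by (elim disjE conjE) (simp_all only: ps)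
  have val: "hval (f i * g j - f j * g i) (p i j)" if "i < 5" "j < 5" "i \<noteq> j" for i j
  proof (cases "i < j")
    case True then show ?thesis using val1 that by simp
  next
    case False
    then have ji: "j < i" using that by simp
    have "f i * g j - f j * g i = - (f j * g i - f i * g j)" by simp
    then show ?thesis using val1[OF ji that(1)] sym[OF ji that(1)] by (simp only: hval_uminus)
  qed
  show ?thesis
  proof (rule tree_lift[OF F val])
    fix i m j :: nat assume i: "i < 4" and m: "m < 5" "m \<noteq> i" and j: "j < 5"
    have ex: "\<exists>m'<5. m' \<noteq> i \<and> m' \<noteq> m \<and> p i m' + b m' j \<le> p i m + b m j"
      if "tw (p i q1 + b q1 j) (p i q2 + b q2 j) (p i q3 + b q3 j) (p i q4 + b q4 j)"
        "m = q1 \<or> m = q2 \<or> m = q3 \<or> m = q4" "distinct [i,q1,q2,q3,q4]" "q1 < 5" "q2 < 5" "q3 < 5" "q4 < 5" for q1 q2 q3 q4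
    proof -
      have 1: "\<exists>q\<in>{q2,q3,q4}. p i q + b q j \<le> p i q1 + b q1 j" using twD(1)[OF that(1)] by blast
      have 2: "\<exists>q\<in>{q1,q3,q4}. p i q + b q j \<le> p i q2 + b q2 j" using twD(2)[OF that(1)] by blast
      have 3: "\<exists>q\<in>{q1,q2,q4}. p i q + b q j \<le> p i q3 + b q3 j" using twD(3)[OF that(1)] by blast
      have 4: "\<exists>q\<in>{q1,q2,q3}. p i q + b q j \<le> p i q4 + b q4 j" using twD(4)[OF that(1)] by blast
      have "\<exists>q. (q = q1 \<or> q = q2 \<or> q = q3 \<or> q = q4) \<and> q \<noteq> m \<and> p i q + b q j \<le> p i m + b m j"
        using that(2)
      proof (elim disjE)
        assume "m = q1" then show ?thesis using 1 that(3) by auto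
      next
        assume "m = q2" then show ?thesis using 2 that(3) by auto
      next
        assume "m = q3" then show ?thesis using 3 that(3) by auto
      next
        assume "m = q4" then show ?thesis using 4 that(3) by auto
      qed
      then obtain q where q: "q = q1 \<or> q = q2 \<or> q = q3 \<or> q = q4" "q \<noteq> m"
        "p i q + b q j \<le> p i m + b m j" by blast
      then show ?thesis using that(3-7) by (intro exI[of _ q]) auto
    qed
    have "i = 0 \<or> i = 1 \<or> i = 2 \<or> i = 3" using i by arith
    then show "\<exists>m'<5. m' \<noteq> i \<and> m' \<noteq> m \<and> p i m' + b m' j \<le> p i m + b m j"
    proof (elim disjE)
      assume "i = 0" then show ?thesis by (intro ex[of 1 2 3 4]) (use c(1)[OF j] m ps in \<open>simp_all, arith\<close>)
    next
      assume "i = 1" then show ?thesis by (intro ex[of 0 2 3 4]) (use c(2)[OF j] m ps in \<open>simp_all, arith\<close>)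
    next
      assume "i = 2" then show ?thesis by (intro ex[of 0 1 3 4]) (use c(3)[OF j] m ps in \<open>simp_all, arith\<close>)
    next
      assume "i = 3" then show ?thesis by (intro ex[of 0 1 2 4]) (use c(4)[OF j] m ps in \<open>simp_all, arith\<close>)
    qed
  qed
qed

section \<open>Rows in classes of sizes (2, 2, 1)\<close>

text \<open>The points are (1, 0), (1, t^l), (0, 1), (t^m, 1) and (t^al, \<open>B\<close>): two
  close pairs and a fifth point. The hypothesis \<open>pl\<close> is the tropical three-term
  Pluecker relation, by which the minimum of \<open>be1\<close>, \<open>be2\<close> and
  \<open>l + al\<close> is attained twice; \<open>al < m + be2\<close> makes the determinant of the
  last two points have degree \<open>al\<close>.\<close>

lemma tree_221:
  assumes F: "infinite (UNIV :: 'a::field set) \<or> card (UNIV :: 'a set) \<ge> 4"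
    and pos: "l > 0" "m > 0"
    and pl: "be1 = be2 \<and> be1 \<le> l + al \<or> be1 = l + al \<and> l + al < be2 \<or> be2 = l + al \<and> l + al < be1"
    and al: "al < m + be2"
    and c: "\<And>j. j < 5 \<Longrightarrow> tw (l + b 1 j) (b 2 j) (b 3 j) (be2 + b 4 j)"
      "\<And>j. j < 5 \<Longrightarrow> tw (l + b 0 j) (b 2 j) (b 3 j) (be1 + b 4 j)"
      "\<And>j. j < 5 \<Longrightarrow> tw (b 0 j) (b 1 j) (m + b 3 j) (al + b 4 j)"
      "\<And>j. j < 5 \<Longrightarrow> tw (b 0 j) (b 1 j) (m + b 2 j) (al + b 4 j)"
  shows "lift3 TYPE('a) b"
proof -
  let ?L = "hmonom (1::'a) l" and ?M = "hmonom (1::'a) m" and ?A = "hmonom (1::'a) al"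
  have AL: "?A * ?L = hmonom 1 (l + al)" by (simp add: hmonom_mult add.commute)
  obtain w :: 'a where w: "w \<noteq> 0" "w \<noteq> 1" using exists_three_nonzero[OF F, of 0] by blast
  \<comment> \<open>The position of the double minimum dictates the leading term of
    \<open>B\<close>. If all three degrees agree, its coefficient has to differ from 0 and from 1,
    so that subtracting \<open>?A * ?L\<close> does not cancel it.\<close>
  have "\<exists>B. hval B be2 \<and> hval (B - ?A * ?L) be1"
  proof -
    consider "be1 = be2" "be1 < l + al" | "be1 = be2" "be1 = l + al" | "be1 = l + al" "l + al < be2"
      | "be2 = l + al" "l + al < be1" using pl by fastforce
    then show ?thesis
    proof cases
      case 1
      have "hval (hmonom (1::'a) be2 - ?A * ?L) be2" unfolding AL
        by (rule hval_diff_dominant[OF hval_hmonom vge_hmonom]) (use 1 in auto)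
      then show ?thesis using 1 hval_hmonom[of "1::'a" be2] by auto
    next
      case 2
      have "hmonom w be2 - ?A * ?L = hmonom (w - 1) be2" unfolding AL
        by (rule hahn_eqI) (use 2 in \<open>simp add: hmonom.rep_eq\<close>)
      then show ?thesis using 2 w hval_hmonom[of w be2] hval_hmonom[of "w - 1" be2]
        by (intro exI[of _ "hmonom w be2"]) simp
    next
      case 3
      have "hval (hmonom (1::'a) be2 - ?A * ?L) (l + al)" unfolding AL
        by (rule hval_diff_dominant'[OF vge_hmonom hval_hmonom]) (use 3 in auto)
      then show ?thesis using 3 hval_hmonom[of "1::'a" be2] by auto
    next
      case 4
      have "hval (hmonom (1::'a) be2 + hmonom 1 be1) be2"
        by (rule hval_add_dominant[OF hval_hmonom vge_hmonom[OF order_refl]]) (use 4 in auto)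
      moreover have "hmonom (1::'a) be2 + hmonom 1 be1 - ?A * ?L = hmonom 1 be1" unfolding AL using 4 by simp
      ultimately show ?thesis using hval_hmonom[of "1::'a" be1]
        by (intro exI[of _ "hmonom 1 be2 + hmonom 1 be1"]) simp
    qed
  qed
  then obtain B where B: "hval B be2" "hval (B - ?A * ?L) be1" by blast
  have hL: "hval ?L l" and hM: "hval ?M m" and hA: "hval ?A al" by (simp_all add: hval_hmonom)
  show ?thesis
  proof (rule tree_tw[OF F, where ?f0.0 = 1 and ?g0.0 = 0 and ?f1.0 = 1 and ?g1.0 = ?L and ?f2.0 = 0 and ?g2.0 = 1
        and ?f3.0 = ?M and ?g3.0 = 1 and ?f4.0 = ?A and ?g4.0 = B
        and ?p01.0 = l and ?p02.0 = 0 and ?p03.0 = 0 and ?p04.0 = be2 and ?p12.0 = 0 and ?p13.0 = 0 and ?p14.0 = be1 and ?p23.0 = m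
        and ?p24.0 = al and ?p34.0 = al])
    show "hval (1 * 1 - ?M * ?L) 0"
      using hval_diff_dominant[OF hval_one, of "m + l" "?M * ?L"] hval_vge[OF hval_mult[OF hM hL] order_refl] pos by simp
    show "hval (?M * B - ?A * 1) al"
      using hval_diff_dominant'[of "m + be2" "?M * B" ?A al] hval_vge[OF hval_mult[OF hM B(1)] order_refl] al hA by simp
  qed (use hL hM hA B c in simp_all)
qed

text \<open>The row classes are {0, 1}, {2, 3} and {4}; zeros mark agreement with the column class
  \<open>c j\<close>. That every column class is inhabited determines the shape of tropical
  kernels.\<close>

definition nf221 :: "(nat \<Rightarrow> nat \<Rightarrow> real) \<Rightarrow> (nat \<Rightarrow> nat) \<Rightarrow> bool" where
  "nf221 b c \<longleftrightarrow> (\<forall>j<5.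
     c j = 0 \<and> b 0 j = 0 \<and> b 1 j = 0 \<and> b 2 j > 0 \<and> b 3 j > 0 \<and> b 4 j > 0 \<or>
     c j = 1 \<and> b 0 j > 0 \<and> b 1 j > 0 \<and> b 2 j = 0 \<and> b 3 j = 0 \<and> b 4 j > 0 \<or>
     c j = 2 \<and> b 0 j > 0 \<and> b 1 j > 0 \<and> b 2 j > 0 \<and> b 3 j > 0 \<and> b 4 j = 0) \<and>
   (\<exists>j<5. c j = 0) \<and> (\<exists>j<5. c j = 1) \<and> (\<exists>j<5. c j = 2)"

lemma nf221_cases:
  assumes "nf221 b c" "j < 5"
  shows "c j = 0 \<and> b 0 j = 0 \<and> b 1 j = 0 \<and> b 2 j > 0 \<and> b 3 j > 0 \<and> b 4 j > 0 \<or>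
     c j = 1 \<and> b 0 j > 0 \<and> b 1 j > 0 \<and> b 2 j = 0 \<and> b 3 j = 0 \<and> b 4 j > 0 \<or>
     c j = 2 \<and> b 0 j > 0 \<and> b 1 j > 0 \<and> b 2 j > 0 \<and> b 3 j > 0 \<and> b 4 j = 0"
  using assms unfolding nf221_def by blast

lemma nf221_0:
  assumes "nf221 b c" "j < 5" "c j = 0"
  shows "b 0 j = 0" "b 1 j = 0" "b 2 j > 0" "b 3 j > 0" "b 4 j > 0"
  using nf221_cases[OF assms(1,2)] assms(3) by simp_all

lemma nf221_1:
  assumes "nf221 b c" "j < 5" "c j = 1"
  shows "b 0 j > 0" "b 1 j > 0" "b 2 j = 0" "b 3 j = 0" "b 4 j > 0"
  using nf221_cases[OF assms(1,2)] assms(3) by simp_all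

lemma nf221_2:
  assumes "nf221 b c" "j < 5" "c j = 2"
  shows "b 0 j > 0" "b 1 j > 0" "b 2 j > 0" "b 3 j > 0" "b 4 j = 0"
  using nf221_cases[OF assms(1,2)] assms(3) by simp_all

text \<open>Were the least weight at a row alone in its class, the column of that class would have a
  strict minimum there. So it is attained exactly at the two rows of the middle class.\<close>

lemma kernel_normal:
  fixes z1 :: real
  assumes t0: "u1 = 0" "u2 > 0" "u3 > 0" "u4 > 0" "tw (z1 + u1) (z2 + u2) (z3 + u3) (z4 + u4)"
    and t1: "v1 > 0" "v2 = 0" "v3 = 0" "v4 > 0" "tw (z1 + v1) (z2 + v2) (z3 + v3) (z4 + v4)"
    and t2: "w1 > 0" "w2 > 0" "w3 > 0" "w4 = 0" "tw (z1 + w1) (z2 + w2) (z3 + w3) (z4 + w4)"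
  shows "z2 = z3 \<and> z1 > z2 \<and> z4 > z2"
  using assms unfolding tw_def by (smt (verit))

lemma tw_shift: "tw (a - e) (b - e) (c - e) (d - e) \<longleftrightarrow> tw a b c d"
  by (simp add: tw_def)

text \<open>The weights of the dependence without row \<open>i\<close> will serve as degrees of the
  determinants against point \<open>i\<close>; they are normalised to 0 at rows 2 and 3.\<close>

lemma kernel_2345:
  assumes "rank3 b" "nf221 b c" "i = (0::nat) \<and> i' = (1::nat) \<or> i = 1 \<and> i' = 0"
  shows "\<exists>l be. l > 0 \<and> be > 0 \<and> (\<forall>j<5. tw (l + b i' j) (b 2 j) (b 3 j) (be + b 4 j))"
proof -
  have "{i,i',2,3,4} = {..<5}" "distinct [i,i',2,3,4]" using assms(3) by auto
  from kernel_tw[OF assms(1) this(2,1)] obtain z where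
    "\<forall>j<5. tw (z i' + b i' j) (z 2 + b 2 j) (z 3 + b 3 j) (z 4 + b 4 j)" ..
  then have z: "tw (z i' + b i' j) (z 2 + b 2 j) (z 3 + b 3 j) (z 4 + b 4 j)" if "j < 5" for j
    using that by simp
  obtain j0 j1 j2 where j: "j0 < 5" "c j0 = 0" "j1 < 5" "c j1 = 1" "j2 < 5" "c j2 = 2"
    using assms(2) unfolding nf221_def by blast
  have i': "i' = 0 \<or> i' = 1" using assms(3) by auto
  have "z 2 = z 3 \<and> z i' > z 2 \<and> z 4 > z 2"
    by (rule kernel_normal[OF _ _ _ _ z[OF j(1)] _ _ _ _ z[OF j(3)] _ _ _ _ z[OF j(5)]])
      (use i' nf221_0[OF assms(2) j(1,2)] nf221_1[OF assms(2) j(3,4)] nf221_2[OF assms(2) j(5,6)] in auto)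
  moreover have "tw (z i' - z 2 + b i' j) (b 2 j) (b 3 j) (z 4 - z 2 + b 4 j)" if "j < 5" "z 2 = z 3" for j
    using z[OF that(1)] that(2) tw_shift[of "z i' + b i' j" "z 2" "z 2 + b 2 j" "z 3 + b 3 j" "z 4 + b 4 j"]
    by (simp add: algebra_simps)
  ultimately show ?thesis
    by (intro exI[of _ "z i' - z 2"] exI[of _ "z 4 - z 2"]) auto
qed

lemma kernel_0135:
  assumes "rank3 b" "nf221 b c"
  shows "\<exists>m al. m > 0 \<and> al > 0 \<and> (\<forall>j<5. tw (b 0 j) (b 1 j) (m + b 3 j) (al + b 4 j))"
proof -
  have "{2,0,1,3,4} = {..<5::nat}" "distinct [2,0,1,3,4::nat]" by auto
  from kernel_tw[OF assms(1) this(2,1)] obtain z :: "nat \<Rightarrow> real" where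
    "\<forall>j<5. tw (z 0 + b 0 j) (z 1 + b 1 j) (z 3 + b 3 j) (z 4 + b 4 j)" ..
  then have z: "tw (z 0 + b 0 j) (z 1 + b 1 j) (z 3 + b 3 j) (z 4 + b 4 j)" if "j < 5" for j
    using that by simp
  have z': "tw (z 3 + b 3 j) (z 0 + b 0 j) (z 1 + b 1 j) (z 4 + b 4 j)" if "j < 5" for j
    using z[OF that] unfolding tw_def by argo
  obtain j0 j1 j2 where j: "j0 < 5" "c j0 = 0" "j1 < 5" "c j1 = 1" "j2 < 5" "c j2 = 2"
    using assms(2) unfolding nf221_def by blast
  have "z 0 = z 1 \<and> z 3 > z 0 \<and> z 4 > z 0"
    by (rule kernel_normal[OF _ _ _ _ z'[OF j(3)] _ _ _ _ z'[OF j(1)] _ _ _ _ z'[OF j(5)]])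
      (use nf221_0[OF assms(2) j(1,2)] nf221_1[OF assms(2) j(3,4)] nf221_2[OF assms(2) j(5,6)] in auto)
  moreover have "tw (b 0 j) (b 1 j) (z 3 - z 0 + b 3 j) (z 4 - z 0 + b 4 j)" if "j < 5" "z 0 = z 1" for j
    using z[OF that(1)] that(2) tw_shift[of "z 0 + b 0 j" "z 0" "z 1 + b 1 j" "z 3 + b 3 j" "z 4 + b 4 j"]
    by (simp add: algebra_simps)
  ultimately show ?thesis
    by (intro exI[of _ "z 3 - z 0"] exI[of _ "z 4 - z 0"]) auto
qed

text \<open>If \<open>y2\<close> and \<open>y3\<close> differ, the smaller one is at least the
  minimum of \<open>l + x1\<close> and \<open>be\<close>. Adding \<open>m\<close> puts both strictly
  above the minimum of \<open>x1\<close> and \<open>al\<close>, so neither takes part in the double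
  minimum.\<close>

lemma colK3:
  assumes "tw (l + x1) y2 y3 be" "tw x0 x1 (m + y3) al" "al < m + be" "l > 0" "m > 0"
  shows "tw x0 x1 (m + y2) al"
  using assms unfolding tw_def by argo

lemma col_type0:
  assumes "tw l y2 y3 (be2 + h)" "be1 = be2 \<or> be1 \<ge> l \<and> be2 \<ge> l" "h > 0"
  shows "tw l y2 y3 (be1 + h)"
  using assms unfolding tw_def by (smt (verit))

lemma tw_zeros_23: "a \<ge> 0 \<Longrightarrow> d \<ge> 0 \<Longrightarrow> tw a 0 0 d"
  by (simp add: tw_def)

lemma tw_zeros_01: "c \<ge> 0 \<Longrightarrow> d \<ge> 0 \<Longrightarrow> tw 0 0 c d"
  by (simp add: tw_def)

text \<open>This and the next three lemmas deduce the relation at row 1 from those at rows 0 and 2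
  in a column of class 2. If \<open>be\<close> differs from \<open>l + al\<close>, this works in
  every column; for equality there are exceptional columns, which the negated hypotheses
  exclude.\<close>

lemma colK1_below:
  assumes "tw (l + x1) y2 y3 be" "tw x0 x1 (m + y3) al" "be < l + al" "l > 0" "m > 0"
  shows "tw (l + x0) y2 y3 be"
  using assms unfolding tw_def by (smt (verit))

lemma colK1_above:
  assumes "tw (l + x1) y2 y3 be" "tw x0 x1 (m + y3) al" "be > l + al" "l > 0" "m > 0"
  shows "tw (l + x0) y2 y3 (l + al)"
  using assms unfolding tw_def by (smt (verit))

lemma colK1_free:
  assumes "tw (l + x1) y2 y3 (l + al)" "tw x0 x1 (m + y3) al" "be \<ge> l + al" "l > 0" "m > 0"
    "\<not> (x1 = al \<and> x0 > al \<and> y2 \<ge> l + al \<and> y3 \<ge> l + al)"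
    "\<not> (x1 = al \<and> x0 = al \<and> y2 > l + al \<and> y3 > l + al)"
  shows "tw (l + x0) y2 y3 be"
  using assms unfolding tw_def by (smt (verit))

lemma colK1_equal:
  assumes "tw (l + x1) y2 y3 (l + al)" "tw x0 x1 (m + y3) al" "l > 0" "m > 0"
    "\<not> (x1 = al \<and> x0 > al \<and> y2 > l + al \<and> y3 > l + al)"
  shows "tw (l + x0) y2 y3 (l + al)"
  using assms unfolding tw_def by (smt (verit))

text \<open>Of the four relations wanted by \<open>tree_221\<close>, those at rows 0 and 2 come from
  tropical kernels. The one at row 3 then follows in every column, the one at row 1 in columns of
  class 0 and 1; what remains is \<open>c1\<close>.\<close>

lemma tree_221_nf:
  assumes F: "infinite (UNIV :: 'a::field set) \<or> card (UNIV :: 'a set) \<ge> 4"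
    and nf: "nf221 b c" and pos: "l > 0" "m > 0" "al > 0" "be1 > 0"
    and pl: "be1 = be2 \<and> be1 \<le> l + al \<or> be1 = l + al \<and> l + al < be2 \<or> be2 = l + al \<and> l + al < be1"
    and al: "al < m + be2"
    and c2: "\<And>j. j < 5 \<Longrightarrow> tw (l + b 1 j) (b 2 j) (b 3 j) (be2 + b 4 j)"
    and c1: "\<And>j. j < 5 \<Longrightarrow> c j = 2 \<Longrightarrow> tw (l + b 0 j) (b 2 j) (b 3 j) be1"
    and c4: "\<And>j. j < 5 \<Longrightarrow> tw (b 0 j) (b 1 j) (m + b 3 j) (al + b 4 j)"
  shows "lift3 TYPE('a) b"
proof (rule tree_221[OF F pos(1,2) pl al c2 _ c4])
  fix j :: nat assume j: "j < 5"
  note c2j = c2[OF j] and c4j = c4[OF j]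
  consider (0) "c j = 0" | (1) "c j = 1" | (2) "c j = 2" using nf221_cases[OF nf j] by (elim disjE conjE)
  note cs = this
  show "tw (l + b 0 j) (b 2 j) (b 3 j) (be1 + b 4 j)"
  proof (cases rule: cs)
    case 0
    note n = nf221_0[OF nf j 0]
    have "tw l (b 2 j) (b 3 j) (be2 + b 4 j)" using c2j n(2) by simp
    moreover have "be1 = be2 \<or> be1 \<ge> l \<and> be2 \<ge> l" using pl pos by linarith
    ultimately show ?thesis using col_type0 n(1,5) by simp
  next
    case 1
    note n = nf221_1[OF nf j 1]
    show ?thesis unfolding n(3,4) by (rule tw_zeros_23) (use n(1,5) pos in simp_all)
  next
    case 2
    then show ?thesis using c1[OF j 2] nf221_2[OF nf j 2] by simp
  qed
  show "tw (b 0 j) (b 1 j) (m + b 2 j) (al + b 4 j)"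
  proof (cases rule: cs)
    case 0
    note n = nf221_0[OF nf j 0]
    show ?thesis unfolding n(1,2) by (rule tw_zeros_01) (use n(3,5) pos in simp_all)
  next
    case 1
    note n = nf221_1[OF nf j 1]
    show ?thesis using c4j n by simp
  next
    case 2
    note n = nf221_2[OF nf j 2]
    show ?thesis using colK3[of l "b 1 j" "b 2 j" "b 3 j" be2 "b 0 j" m al] c2j c4j n al pos by simp
  qed
qed

text \<open>The Pluecker relation leaves no choice: \<open>be1\<close> is the smaller of
  \<open>be2\<close> and \<open>l + al\<close>.\<close>

lemma scenario_unequal:
  assumes F: "infinite (UNIV :: 'a::field set) \<or> card (UNIV :: 'a set) \<ge> 4"
    and nf: "nf221 b c" and pos: "l > 0" "m > 0" "al > 0" "be2 > 0"
    and al: "al < m + be2" and ne: "be2 \<noteq> l + al"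
    and c2: "\<And>j. j < 5 \<Longrightarrow> tw (l + b 1 j) (b 2 j) (b 3 j) (be2 + b 4 j)"
    and c4: "\<And>j. j < 5 \<Longrightarrow> tw (b 0 j) (b 1 j) (m + b 3 j) (al + b 4 j)"
  shows "lift3 TYPE('a) b"
proof (cases "be2 < l + al")
  case True
  show ?thesis
  proof (rule tree_221_nf[OF F nf pos(1-4) _ al c2 _ c4])
    fix j :: nat assume j: "j < 5" "c j = 2"
    show "tw (l + b 0 j) (b 2 j) (b 3 j) be2"
      by (rule colK1_below[of l "b 1 j" _ _ _ _ m al])
        (use c2[OF j(1)] c4[OF j(1)] nf221_2[OF nf j] True pos in simp_all)
  qed (use True in auto)
next
  case False
  have p: "l + al > 0" using pos by simp
  show ?thesis
  proof (rule tree_221_nf[OF F nf pos(1-3) p _ al c2 _ c4])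
    fix j :: nat assume j: "j < 5" "c j = 2"
    show "tw (l + b 0 j) (b 2 j) (b 3 j) (l + al)"
      by (rule colK1_above[of l "b 1 j" _ _ be2 _ m al])
        (use c2[OF j(1)] c4[OF j(1)] nf221_2[OF nf j] False ne pos in simp_all)
  qed (use False ne in auto)
qed

text \<open>In the remaining case \<open>be2 = l + al\<close> the valuation \<open>be1 \<ge> l + al\<close> is a free parameter, on which the columns
  impose conditions that may conflict.\<close>

lemma scenario_equal:
  assumes F: "infinite (UNIV :: 'a::field set) \<or> card (UNIV :: 'a set) \<ge> 4"
    and nf: "nf221 b c" and pos: "l > 0" "m > 0" "al > 0"
    and c2: "\<And>j. j < 5 \<Longrightarrow> tw (l + b 1 j) (b 2 j) (b 3 j) (l + al + b 4 j)"
    and c4: "\<And>j. j < 5 \<Longrightarrow> tw (b 0 j) (b 1 j) (m + b 3 j) (al + b 4 j)"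
  shows "lift3 TYPE('a) b \<or> (\<exists>j<5. \<exists>j'<5. j \<noteq> j' \<and> c j = 2 \<and> c j' = 2 \<and>
    b 1 j = al \<and> b 0 j > al \<and> b 2 j > l + al \<and> b 3 j > l + al \<and>
    b 1 j' = al \<and> (b 0 j' > al \<or> b 0 j' = al \<and> b 2 j' > l + al \<and> b 3 j' > l + al))"
proof (cases "\<exists>j<5. c j = 2 \<and> b 1 j = al \<and> b 0 j > al \<and> b 2 j > l + al \<and> b 3 j > l + al")
  case False
  have p: "l + al > 0" and q: "al < m + (l + al)" using pos by simp_all
  have "lift3 TYPE('a) b"
  proof (rule tree_221_nf[OF F nf pos p _ q c2 _ c4])
    fix j :: nat assume j: "j < 5" "c j = 2"
    show "tw (l + b 0 j) (b 2 j) (b 3 j) (l + al)"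
      by (rule colK1_equal[of l "b 1 j" _ _ al _ m])
        (use c2[OF j(1)] c4[OF j(1)] nf221_2[OF nf j] False j pos in auto)
  qed auto
  then show ?thesis ..
next
  case True
  then obtain j where j: "j < 5" "c j = 2" "b 1 j = al" "b 0 j > al" "b 2 j > l + al" "b 3 j > l + al" by blast
  \<comment> \<open>In the exceptional column \<open>j\<close> the other three terms exceed
    \<open>l + al\<close>; \<open>be1\<close> is made to tie with the least of them. Only a second
    exceptional column can now be violated.\<close>
  define be1 where "be1 = min (l + b 0 j) (min (b 2 j) (b 3 j))"
  have be1: "be1 > l + al" using j by (simp add: be1_def)
  show ?thesis
  proof (cases "\<exists>j'<5. j \<noteq> j' \<and> c j' = 2 \<and> b 1 j' = al \<and>
      (b 0 j' > al \<or> b 0 j' = al \<and> b 2 j' > l + al \<and> b 3 j' > l + al)")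
    case True
    then show ?thesis using j by blast
  next
    case no: False
    have p: "be1 > 0" and q: "al < m + (l + al)" using pos be1 by simp_all
    have "lift3 TYPE('a) b"
    proof (rule tree_221_nf[OF F nf pos p _ q c2 _ c4])
      fix j' :: nat assume j': "j' < 5" "c j' = 2"
      show "tw (l + b 0 j') (b 2 j') (b 3 j') be1"
      proof (cases "j' = j")
        case True
        then show ?thesis unfolding be1_def tw_def by (auto simp: min_def)
      next
        case False
        show ?thesis
          by (rule colK1_free[of l "b 1 j'" _ _ al _ m])
            (use c2[OF j'(1)] c4[OF j'(1)] nf221_2[OF nf j'] False no j' pos be1 in auto)
      qed
    qed (use be1 in auto)
    then show ?thesis ..
  qed
qed

section \<open>Invariance of the rank condition\<close>

lemma rank3_reindex:
  assumes "rank3 b" "bij_betw \<pi> {..<5} {..<5}" "bij_betw \<tau> {..<5} {..<5}"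
  shows "rank3 (\<lambda>i j. b (\<pi> i) (\<tau> j))"
  unfolding rank3_def
proof (intro allI impI)
  fix \<rho> \<sigma> :: "nat \<Rightarrow> nat"
  assume a: "inj_on \<rho> {..<4}" "\<rho> ` {..<4} \<subseteq> {..<5}" "inj_on \<sigma> {..<4}" "\<sigma> ` {..<4} \<subseteq> {..<5}"
  have comp: "inj_on (q \<circ> p) {..<4}" "(q \<circ> p) ` {..<4} \<subseteq> {..<5}"
    if "inj_on p {..<4}" "p ` {..<4} \<subseteq> {..<5}" "bij_betw q {..<5} {..<5}" for p q :: "nat \<Rightarrow> nat"
  proof -
    have q: "inj_on q {..<5}" "q ` {..<5} = {..<5}" using that(3) by (auto simp: bij_betw_def)
    show "inj_on (q \<circ> p) {..<4}" by (rule comp_inj_on[OF that(1)]) (rule inj_on_subset[OF q(1) that(2)])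
    show "(q \<circ> p) ` {..<4} \<subseteq> {..<5}" using that(2) q(2) by (force simp: image_comp[symmetric])
  qed
  note A = comp[OF a(1,2) assms(2)] and B = comp[OF a(3,4) assms(3)]
  show "\<exists>\<pi>'. \<pi>' permutes {..<4} \<and> \<pi>' \<noteq> id \<and> (\<Sum>i<4. b (\<pi> (\<rho> (\<pi>' i))) (\<tau> (\<sigma> i))) \<le> (\<Sum>i<4. b (\<pi> (\<rho> i)) (\<tau> (\<sigma> i)))"
    using assms(1)[unfolded rank3_def, rule_format, OF A B] unfolding o_def .
qed

lemma rank3_transpose:
  assumes "rank3 b"
  shows "rank3 (\<lambda>i j. b j i)"
  unfolding rank3_def
proof (intro allI impI)
  fix \<rho> \<sigma> :: "nat \<Rightarrow> nat"
  assume a: "inj_on \<rho> {..<4}" "\<rho> ` {..<4} \<subseteq> {..<5}" "inj_on \<sigma> {..<4}" "\<sigma> ` {..<4} \<subseteq> {..<5}"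
  obtain \<pi> where \<pi>: "\<pi> permutes {..<4::nat}" "\<pi> \<noteq> id" "(\<Sum>i<4. b (\<sigma> (\<pi> i)) (\<rho> i)) \<le> (\<Sum>i<4. b (\<sigma> i) (\<rho> i))"
    using assms[unfolded rank3_def, rule_format, OF a(3,4,1,2)] by blast
  have pinv: "inv_into UNIV \<pi> permutes {..<4}" by (rule permutes_inv[OF \<pi>(1)])
  have "inv_into UNIV \<pi> \<noteq> id"
  proof
    assume "inv_into UNIV \<pi> = id"
    then have "\<pi> = id" using permutes_inv_o(1)[OF \<pi>(1)] by simp
    then show False using \<pi>(2) by simp
  qed
  moreover have "(\<Sum>i<4. b (\<sigma> i) (\<rho> (inv_into UNIV \<pi> i))) = (\<Sum>i<4. b (\<sigma> (\<pi> i)) (\<rho> i))"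
    using sum.permute[OF \<pi>(1), of "\<lambda>i. b (\<sigma> i) (\<rho> (inv_into UNIV \<pi> i))"] permutes_inverses(2)[OF \<pi>(1)]
    by (simp add: o_def)
  ultimately show "\<exists>\<pi>'. \<pi>' permutes {..<4} \<and> \<pi>' \<noteq> id \<and> (\<Sum>i<4. b (\<sigma> i) (\<rho> (\<pi>' i))) \<le> (\<Sum>i<4. b (\<sigma> i) (\<rho> i))"
    using pinv \<pi>(3) by (intro exI[of _ "inv_into UNIV \<pi>"]) simp
qed

lemma rank3_scale:
  assumes "rank3 b"
  shows "rank3 (\<lambda>i j. b i j + x i + y j)"
  unfolding rank3_def
proof (intro allI impI)
  fix \<rho> \<sigma> :: "nat \<Rightarrow> nat"
  assume a: "inj_on \<rho> {..<4}" "\<rho> ` {..<4} \<subseteq> {..<5}" "inj_on \<sigma> {..<4}" "\<sigma> ` {..<4} \<subseteq> {..<5}"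
  obtain \<pi> where \<pi>: "\<pi> permutes {..<4::nat}" "\<pi> \<noteq> id" "(\<Sum>i<4. b (\<rho> (\<pi> i)) (\<sigma> i)) \<le> (\<Sum>i<4. b (\<rho> i) (\<sigma> i))"
    using assms[unfolded rank3_def, rule_format, OF a] by blast
  have "(\<Sum>i<4. x (\<rho> (\<pi> i))) = (\<Sum>i<4. x (\<rho> i))"
    using sum.permute[OF \<pi>(1), of "\<lambda>i. x (\<rho> i)"] by (simp add: o_def)
  then show "\<exists>\<pi>'. \<pi>' permutes {..<4} \<and> \<pi>' \<noteq> id \<and>
      (\<Sum>i<4. b (\<rho> (\<pi>' i)) (\<sigma> i) + x (\<rho> (\<pi>' i)) + y (\<sigma> i)) \<le> (\<Sum>i<4. b (\<rho> i) (\<sigma> i) + x (\<rho> i) + y (\<sigma> i))"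
    using \<pi> by (intro exI[of _ \<pi>]) (simp add: sum.distrib)
qed

definition perm5 :: "nat \<Rightarrow> nat \<Rightarrow> nat \<Rightarrow> nat \<Rightarrow> nat \<Rightarrow> nat \<Rightarrow> nat" where
  "perm5 a0 a1 a2 a3 a4 = (\<lambda>i. if i = 0 then a0 else if i = 1 then a1 else if i = 2 then a2 else if i = 3 then a3 else a4)"

lemma perm5_simps [simp]:
  "perm5 a0 a1 a2 a3 a4 0 = a0" "perm5 a0 a1 a2 a3 a4 (Suc 0) = a1" "perm5 a0 a1 a2 a3 a4 2 = a2"
  "perm5 a0 a1 a2 a3 a4 3 = a3" "perm5 a0 a1 a2 a3 a4 4 = a4"
  by (simp_all add: perm5_def)

lemma perm5_1 [simp]: "perm5 a0 a1 a2 a3 a4 1 = a1"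
  by (simp add: perm5_def)

lemma perm5_bij:
  assumes "{a0,a1,a2,a3,a4} = {..<5}"
  shows "bij_betw (perm5 a0 a1 a2 a3 a4) {..<5} {..<5}"
proof -
  have five: "{..<5::nat} = {0,1,2,3,4}" by auto
  have "perm5 a0 a1 a2 a3 a4 ` {..<5} = {a0,a1,a2,a3,a4}"
    unfolding five by simp
  then show ?thesis using assms finite_surj_inj[of "{..<5::nat}" "perm5 a0 a1 a2 a3 a4"]
    by (simp add: bij_betw_def)
qed

section \<open>Resolving conflicts between columns\<close>

text \<open>The columns are now one of class 0, one of class 1 and \<open>j\<close>,
  \<open>t\<close>, \<open>k\<close> of class 2. Triangular minors force rows 2 and 3 to agree in
  columns \<open>c0\<close> and \<open>k\<close>. Those two columns then tolerate a larger
  \<open>l\<close>, which can grow until \<open>l + al\<close> meets an entry of rows 2 or 3 in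
  column \<open>j\<close> or \<open>t\<close>.\<close>

lemma three_type2_columns:
  assumes F: "infinite (UNIV :: 'a::field set) \<or> card (UNIV :: 'a set) \<ge> 4"
    and r3: "rank3 b" and nf: "nf221 b c" and pos: "l > 0" "m > 0" "al > 0"
    and c2: "\<And>j. j < 5 \<Longrightarrow> tw (l + b 1 j) (b 2 j) (b 3 j) (l + al + b 4 j)"
    and c4: "\<And>j. j < 5 \<Longrightarrow> tw (b 0 j) (b 1 j) (m + b 3 j) (al + b 4 j)"
    and j: "j < 5" "c j = 2" "b 1 j = al" "b 0 j > al" "b 2 j > l + al" "b 3 j > l + al"
    and t: "t < 5" "c t = 2" "b 1 t = al" "b 0 t = al" "b 2 t > l + al" "b 3 t > l + al"
    and k: "k < 5" "c k = 2" "b 0 k = al" "b 1 k > al"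
  shows "lift3 TYPE('a) b"
proof -
  have jt: "j \<noteq> t" using j t by auto
  have jk: "j \<noteq> k" using j k by auto
  have tk: "t \<noteq> k" using t k by auto
  obtain c0 d where cd: "c0 < 5" "c c0 = 0" "d < 5" "c d = 1" using nf unfolding nf221_def by blast
  have ne: "c0 \<noteq> d" "c0 \<noteq> j" "c0 \<noteq> t" "c0 \<noteq> k" "d \<noteq> j" "d \<noteq> t" "d \<noteq> k" using cd j t k by auto
  note neq = ne jt jk tk ne[symmetric] jt[symmetric] jk[symmetric] tk[symmetric]
  have cov: "{c0,d,j,t,k} = {..<5}"
    by (rule card_subset_eq) (use cd j(1) t(1) k(1) ne jt jk tk in auto)
  note n0 = nf221_0[OF nf cd(1,2)] and n1 = nf221_1[OF nf cd(3,4)]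
  note nj = nf221_2[OF nf j(1,2)] and nt = nf221_2[OF nf t(1,2)] and nk = nf221_2[OF nf k(1,2)]
  have T0: "tw l (b 2 c0) (b 3 c0) (l + al + b 4 c0)" using c2[OF cd(1)] n0 by simp
  \<comment> \<open>If the entries differ, the relation makes the smaller one equal to
    \<open>l\<close>, so it is tight for a potential under which four rows become
    triangular.\<close>
  have h: "b 2 c0 = b 3 c0"
  proof (rule ccontr)
    assume "b 2 c0 \<noteq> b 3 c0"
    then consider "b 2 c0 < b 3 c0" | "b 3 c0 < b 2 c0" by linarith
    then show False
    proof cases
      case 1
      then have l: "b 2 c0 = l" using T0 n0 pos unfolding tw_def by argo
      show False
        by (rule tri_contra[OF r3, of 4 0 2 3 j t c0 d "\<lambda>r. if r = 4 then - (l + al) else if r = 0 then - l else 0"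
              "\<lambda>q. if q = j \<or> q = t then l + al else if q = c0 then l else 0"])
          (use 1 l cd j t n0 n1 nj nt pos in \<open>simp_all add: neq\<close>)
    next
      case 2
      then have l: "b 3 c0 = l" using T0 n0 pos unfolding tw_def by argo
      show False
        by (rule tri_contra[OF r3, of 4 0 3 2 j t c0 d "\<lambda>r. if r = 4 then - (l + al) else if r = 0 then - l else 0"
              "\<lambda>q. if q = j \<or> q = t then l + al else if q = c0 then l else 0"])
          (use 2 l cd j t n0 n1 nj nt pos in \<open>simp_all add: neq\<close>)
    qed
  qed
  have hl: "b 3 c0 \<le> l" using T0 n0 pos unfolding tw_def h by argo
  have Tk: "tw (l + b 1 k) (b 2 k) (b 3 k) (l + al)" using c2[OF k(1)] nk by simp
  have yk: "b 2 k = b 3 k"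
  proof (rule ccontr)
    assume "b 2 k \<noteq> b 3 k"
    then consider "b 2 k < b 3 k" | "b 3 k < b 2 k" by linarith
    then show False
    proof cases
      case 1
      then have l: "b 2 k = l + al" using Tk k pos unfolding tw_def by argo
      show False
        by (rule tri_contra[OF r3, of 1 0 2 3 j t k c0 "\<lambda>r. if r = 0 \<or> r = 1 then - l else 0"
              "\<lambda>q. if q = c0 then b 3 c0 else l + al"])
          (use 1 l cd j t k n0 h hl pos in \<open>simp_all add: neq\<close>)
    next
      case 2
      then have l: "b 3 k = l + al" using Tk k pos unfolding tw_def by argo
      show False
        by (rule tri_contra[OF r3, of 1 0 3 2 j t k c0 "\<lambda>r. if r = 0 \<or> r = 1 then - l else 0"
              "\<lambda>q. if q = c0 then b 3 c0 else l + al"])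
          (use 2 l cd j t k n0 h hl pos in \<open>simp_all add: neq\<close>)
    qed
  qed
  have ykl: "b 3 k \<le> l + al" using Tk k pos unfolding tw_def yk by argo
  define Yj Yt where "Yj = min (b 2 j) (b 3 j)" and "Yt = min (b 2 t) (b 3 t)"
  \<comment> \<open>With this \<open>l'\<close> the degree \<open>l' + al\<close> is the least entry
    of rows 2 and 3 in columns \<open>j\<close> and \<open>t\<close>. If column \<open>t\<close>
    attains it, that column leaves \<open>be1\<close> free and \<open>be1\<close> is adapted to
    column \<open>j\<close>; otherwise column \<open>t\<close> demands \<open>be1 = l' + al\<close>,
    which suits column \<open>j\<close> too.\<close>
  define l' where "l' = min Yj Yt - al"
  define be1 where "be1 = (if Yt \<le> Yj then min (l' + b 0 j) Yj else l' + al)"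
  have l': "l' > l" using j t by (simp add: l'_def Yj_def Yt_def)
  have be1: "be1 \<ge> l' + al" using j by (simp add: be1_def l'_def)
  have col: "q = c0 \<or> q = d \<or> q = j \<or> q = t \<or> q = k" if "q < 5" for q
  proof -
    have "q \<in> {c0,d,j,t,k}" using that cov by simp
    then show ?thesis by simp
  qed
  have p: "l' > 0" "be1 > 0" "al < m + (l' + al)" using l' pos be1 by simp_all
  show ?thesis
  proof (rule tree_221_nf[where l=l' and m=m and al=al and ?be1.0=be1 and ?be2.0="l'+al" and b=b and c=c, OF F nf p(1) pos(2,3) p(2) _ p(3) _ _ c4])
    show "be1 = l' + al \<and> be1 \<le> l' + al \<or> be1 = l' + al \<and> l' + al < l' + al \<or> l' + al = l' + al \<and> l' + al < be1"
      using be1 by auto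
  next
    fix q :: nat assume "q < 5"
    from col[OF this] show "tw (l' + b 1 q) (b 2 q) (b 3 q) (l' + al + b 4 q)"
    proof (elim disjE)
      assume q: "q = c0"
      show ?thesis unfolding q h n0(2) tw_def using hl l' n0 pos by auto
    next
      assume q: "q = d"
      show ?thesis unfolding q n1(3,4) by (rule tw_zeros_23) (use n1 p pos in simp_all)
    next
      assume q: "q = j"
      show ?thesis unfolding q j(3) nj(5) tw_def by (auto simp: l'_def Yj_def)
    next
      assume q: "q = t"
      show ?thesis unfolding q t(3) nt(5) tw_def by (auto simp: l'_def Yt_def)
    next
      assume q: "q = k"
      show ?thesis unfolding q yk nk(5) tw_def using ykl l' k by auto
    qed
  next
    fix q :: nat assume q5: "q < 5" "c q = 2"
    from col[OF q5(1)] q5(2) cd have "q = j \<or> q = t \<or> q = k" by auto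
    then show "tw (l' + b 0 q) (b 2 q) (b 3 q) be1"
    proof (elim disjE)
      assume q: "q = j"
      show ?thesis
      proof (cases "Yt \<le> Yj")
        case True
        then show ?thesis unfolding q be1_def Yj_def tw_def by (auto simp: min_def)
      next
        case False
        then have "be1 = Yj" by (simp add: be1_def l'_def)
        moreover have "l' + b 0 j \<ge> Yj" using False j by (simp add: l'_def)
        ultimately show ?thesis unfolding q Yj_def tw_def by (auto simp: min_def)
      qed
    next
      assume q: "q = t"
      show ?thesis
      proof (cases "Yt \<le> Yj")
        case True
        then have "l' + al = Yt" by (simp add: l'_def)
        then show ?thesis using be1 unfolding q t(4) Yt_def tw_def by (auto simp: min_def)
      next
        case False
        then have "be1 = l' + al" "l' + al < Yt" by (simp_all add: be1_def l'_def)
        then show ?thesis unfolding q t(4) Yt_def tw_def by auto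
      qed
    next
      assume q: "q = k"
      show ?thesis unfolding q yk k(3) tw_def using ykl l' be1 by auto
    qed
  qed
qed

lemma tw_commute12: "tw a b c d \<longleftrightarrow> tw b a c d"
  unfolding tw_def by (smt (verit))

lemma tw_swap_pairs: "tw a b c d \<longleftrightarrow> tw c a b d"
  unfolding tw_def by (smt (verit))

text \<open>After a conflict of columns rows 0 and 1 are exchanged, with the weights at row 1 in
  place of those at row 0. If columns conflict again, the two conflicts together with one column of
  class 0 and one of class 1 would involve six columns unless \<open>t = s\<close>, and
  \<open>three_type2_columns\<close> applies.\<close>

lemma nf221_lift_aux:
  assumes F: "infinite (UNIV :: 'a::field set) \<or> card (UNIV :: 'a set) \<ge> 4"
    and r3: "rank3 b" and nf: "nf221 b c" and pos: "l > 0" "m > 0" "al > 0" "be2 > 0"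
    and ge: "be2 \<ge> l + al"
    and c2: "\<And>j. j < 5 \<Longrightarrow> tw (l + b 1 j) (b 2 j) (b 3 j) (be2 + b 4 j)"
    and c4: "\<And>j. j < 5 \<Longrightarrow> tw (b 0 j) (b 1 j) (m + b 3 j) (al + b 4 j)"
  shows "lift3 TYPE('a) b"
proof (cases "be2 = l + al")
  case False
  have "al < m + be2" using ge pos by linarith
  from scenario_unequal[OF F nf pos this False c2 c4] show ?thesis by blast
next
  case True
  note c2' = c2[unfolded True]
  have "lift3 TYPE('a) b" if ex: "\<exists>j<5. \<exists>j'<5. j \<noteq> j' \<and> c j = 2 \<and> c j' = 2 \<and>
    b 1 j = al \<and> b 0 j > al \<and> b 2 j > l + al \<and> b 3 j > l + al \<and>
    b 1 j' = al \<and> (b 0 j' > al \<or> b 0 j' = al \<and> b 2 j' > l + al \<and> b 3 j' > l + al)"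
  proof -
    from ex obtain j t where j: "j < 5" "c j = 2" "b 1 j = al" "b 0 j > al" "b 2 j > l + al" "b 3 j > l + al"
      and t: "t < 5" "c t = 2" "b 1 t = al" "j \<noteq> t"
      and t': "b 0 t > al \<or> b 0 t = al \<and> b 2 t > l + al \<and> b 3 t > l + al"
      by (elim exE conjE) (rule that)
    from kernel_2345[OF r3 nf, of 1 0] obtain l' be1 where l': "l' > 0" "be1 > 0"
      and c1: "\<forall>j<5. tw (l' + b 0 j) (b 2 j) (b 3 j) (be1 + b 4 j)" by auto
    \<comment> \<open>Otherwise \<open>be1\<close> would be the strict minimum of the relation in
      column \<open>j\<close>.\<close>
    have "be1 > al"
    proof (rule ccontr)
      assume "\<not> be1 > al"
      then show False using c1[rule_format, OF j(1)] nf221_2(5)[OF nf j(1,2)] j l' pos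
        unfolding tw_def by auto
    qed
    then have al: "al < m + be1" using pos by simp
    let ?p = "perm5 1 0 2 3 4"
    let ?b = "\<lambda>i j. b (?p i) j"
    have p: "bij_betw ?p {..<5} {..<5}" by (rule perm5_bij) auto
    have bk: "lift3 TYPE('a) b" if "lift3 TYPE('a) ?b"
      by (rule lift3_reindex[OF _ p bij_betw_id[of "{..<5}"]]) (use that in simp)
    have nf': "nf221 ?b c" using nf unfolding nf221_def by (auto simp: conj_commute)
    have c2c: "\<And>j. j < 5 \<Longrightarrow> tw (l' + ?b 1 j) (?b 2 j) (?b 3 j) (be1 + ?b 4 j)" using c1 by simp
    have c4': "\<And>j. j < 5 \<Longrightarrow> tw (?b 0 j) (?b 1 j) (m + ?b 3 j) (al + ?b 4 j)"
      using c4 tw_commute12 by simp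
    show ?thesis
    proof (cases "be1 = l' + al")
      case False
      from scenario_unequal[OF F nf' l'(1) pos(2,3) l'(2) al False c2c c4'] show ?thesis by (intro bk) blast
    next
      case True
      note c2d = c2c[unfolded True]
      have e: "lift3 TYPE('a) b \<or> (\<exists>j<5. \<exists>j'<5. j \<noteq> j' \<and> c j = 2 \<and> c j' = 2 \<and>
        b 0 j = al \<and> b 1 j > al \<and> b 2 j > l' + al \<and> b 3 j > l' + al \<and>
        b 0 j' = al \<and> (b 1 j' > al \<or> b 1 j' = al \<and> b 2 j' > l' + al \<and> b 3 j' > l' + al))"
        using scenario_equal[OF F nf' l'(1) pos(2,3) c2d c4'] unfolding perm5_simps perm5_1 using bk by blast
      have "lift3 TYPE('a) b" if ex: "\<exists>j<5. \<exists>j'<5. j \<noteq> j' \<and> c j = 2 \<and> c j' = 2 \<and>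
        b 0 j = al \<and> b 1 j > al \<and> b 2 j > l' + al \<and> b 3 j > l' + al \<and>
        b 0 j' = al \<and> (b 1 j' > al \<or> b 1 j' = al \<and> b 2 j' > l' + al \<and> b 3 j' > l' + al)"
      proof -
        from ex obtain k s where k: "k < 5" "c k = 2" "b 0 k = al" "b 1 k > al"
          and s: "s < 5" "c s = 2" "b 0 s = al" "k \<noteq> s"
          by (elim exE conjE) (rule that)
        obtain c0 d where cd: "c0 < 5" "c c0 = 0" "d < 5" "c d = 1" using nf unfolding nf221_def by blast
        have ts: "t = s"
        proof (rule ccontr)
          assume "t \<noteq> s"
          moreover have "c0 \<noteq> d" "c0 \<noteq> j" "c0 \<noteq> t" "c0 \<noteq> k" "c0 \<noteq> s" "d \<noteq> j" "d \<noteq> t" "d \<noteq> k" "d \<noteq> s"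
            "j \<noteq> k" "j \<noteq> s" "t \<noteq> k" using cd j t k s by auto
          ultimately have "card {c0,d,j,t,k,s} = 6" using t(4) s(4) by simp
          moreover have "card {c0,d,j,t,k,s} \<le> card {..<5::nat}"
            by (rule card_mono) (use cd j t k s in auto)
          ultimately show False by simp
        qed
        show ?thesis
          by (rule three_type2_columns[OF F r3 nf pos(1-3) c2' c4 j t(1-3) _ _ _ k])
            (use t' s ts in auto)
      qed
      with e show ?thesis by blast
    qed
  qed
  with scenario_equal[OF F nf pos(1-3) c2' c4] show ?thesis by blast
qed

text \<open>The case \<open>al \<ge> m + be2\<close> lies outside \<open>tree_221\<close>.
  Exchanging the two pairs of rows swaps (\<open>l\<close>, \<open>be2\<close>) with
  (\<open>m\<close>, \<open>al\<close>) and turns it into the case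
  \<open>be2 \<ge> l + al\<close>.\<close>

lemma nf221_lift:
  assumes F: "infinite (UNIV :: 'a::field set) \<or> card (UNIV :: 'a set) \<ge> 4"
    and r3: "rank3 b" and nf: "nf221 b c"
  shows "lift3 TYPE('a) b"
proof -
  from kernel_2345[OF r3 nf, of 0 1] obtain l be2 where l: "l > 0" "be2 > 0"
    and c2: "\<forall>j<5. tw (l + b 1 j) (b 2 j) (b 3 j) (be2 + b 4 j)" by auto
  from kernel_0135[OF r3 nf] obtain m al where m: "m > 0" "al > 0"
    and c4: "\<forall>j<5. tw (b 0 j) (b 1 j) (m + b 3 j) (al + b 4 j)" by auto
  note c2' = c2[rule_format] and c4' = c4[rule_format]
  consider "be2 \<ge> l + al" | "be2 < l + al" "al < m + be2" | "al \<ge> m + be2" by linarith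
  then show ?thesis
  proof cases
    case 1
    show ?thesis by (rule nf221_lift_aux[OF F r3 nf l(1) m l(2) 1 c2' c4'])
  next
    case 2
    show ?thesis by (rule scenario_unequal[OF F nf l(1) m l(2) 2(2) _ c2' c4']) (use 2 in simp)
  next
    case 3
    let ?p = "perm5 2 3 0 1 4"
    let ?b = "\<lambda>i j. b (?p i) j" and ?c = "\<lambda>j. if c j = 0 then 1 else if c j = 1 then 0 else c j"
    have p: "bij_betw ?p {..<5} {..<5}" by (rule perm5_bij) auto
    have r3': "rank3 ?b" using rank3_reindex[OF r3 p bij_betw_id[of "{..<5}"]] by simp
    have nf': "nf221 ?b ?c"
    proof -
      have "?c j = 0 \<and> b 2 j = 0 \<and> b 3 j = 0 \<and> b 0 j > 0 \<and> b 1 j > 0 \<and> b 4 j > 0 \<or>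
        ?c j = 1 \<and> b 2 j > 0 \<and> b 3 j > 0 \<and> b 0 j = 0 \<and> b 1 j = 0 \<and> b 4 j > 0 \<or>
        ?c j = 2 \<and> b 2 j > 0 \<and> b 3 j > 0 \<and> b 0 j > 0 \<and> b 1 j > 0 \<and> b 4 j = 0" if "j < 5" for j
        using nf221_cases[OF nf that] by (elim disjE) simp_all
      moreover have "\<exists>j<5. c j = 0" "\<exists>j<5. c j = 1" "\<exists>j<5. c j = 2" using nf unfolding nf221_def by blast+
      then obtain u v w where "u < 5" "c u = 0" "v < 5" "c v = 1" "w < 5" "c w = 2" by blast
      then have "v < 5 \<and> ?c v = 0" "u < 5 \<and> ?c u = 1" "w < 5 \<and> ?c w = 2" by simp_all
      then have "\<exists>j<5. ?c j = 0" "\<exists>j<5. ?c j = 1" "\<exists>j<5. ?c j = 2" by (auto simp only:)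
      ultimately show ?thesis unfolding nf221_def perm5_simps perm5_1 by blast
    qed
    have a: "\<And>j. j < 5 \<Longrightarrow> tw (m + ?b 1 j) (?b 2 j) (?b 3 j) (al + ?b 4 j)"
      using c4' tw_swap_pairs by simp
    have b: "\<And>j. j < 5 \<Longrightarrow> tw (?b 0 j) (?b 1 j) (l + ?b 3 j) (be2 + ?b 4 j)"
      using c2' tw_swap_pairs by simp
    have "lift3 TYPE('a) ?b"
      by (rule nf221_lift_aux[OF F r3' nf' m(1) l(1) l(2) m(2) _ a b]) (use 3 in simp)
    then show ?thesis
      using lift3_reindex[where b=b and \<pi>="?p" and \<sigma>="\<lambda>j. j", OF _ p] bij_betw_id[of "{..<5}"]
      by (simp add: id_def)
  qed
qed

section \<open>Normal forms with labelled rows and columns\<close>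

lemma lift3_perm5:
  assumes "lift3 TYPE('a::field) (\<lambda>i j. b (perm5 a0 a1 a2 a3 a4 i) (perm5 c0 c1 c2 c3 c4 j))"
    and "{a0,a1,a2,a3,a4} = {..<5}" "{c0,c1,c2,c3,c4} = {..<5}"
  shows "lift3 TYPE('a) b"
  by (rule lift3_reindex[OF assms(1) perm5_bij[OF assms(2)] perm5_bij[OF assms(3)]])

lemma rank3_perm5:
  assumes "rank3 b" "{a0,a1,a2,a3,a4} = {..<5}" "{c0,c1,c2,c3,c4} = {..<5}"
  shows "rank3 (\<lambda>i j. b (perm5 a0 a1 a2 a3 a4 i) (perm5 c0 c1 c2 c3 c4 j))"
  by (rule rank3_reindex[OF assms(1) perm5_bij[OF assms(2)] perm5_bij[OF assms(3)]])

lemma perm5_in: "{a0,a1,a2,a3,a4} = {..<5} \<Longrightarrow> i < 5 \<Longrightarrow> perm5 a0 a1 a2 a3 a4 i < 5"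
  using bij_betwE[OF perm5_bij] by blast

definition nf :: "(nat \<Rightarrow> nat \<Rightarrow> real) \<Rightarrow> (nat \<Rightarrow> nat) \<Rightarrow> (nat \<Rightarrow> nat) \<Rightarrow> (nat \<Rightarrow> real) \<Rightarrow> (nat \<Rightarrow> real) \<Rightarrow> bool" where
  "nf b r c x y \<longleftrightarrow> (\<forall>i<5. \<forall>j<5. if r i = c j then b i j = x i + y j else b i j > x i + y j)"

lemma nf_transpose: "nf b r c x y \<Longrightarrow> nf (\<lambda>i j. b j i) c r y x"
  unfolding nf_def by (auto simp: add.commute)

lemma lift3_scaled:
  assumes "lift3 TYPE('a::field) (\<lambda>i j. b i j - x i - y j)"
  shows "lift3 TYPE('a) b"
  by (rule lift3_scale[of b "\<lambda>i. - x i" "\<lambda>j. - y j"]) (use assms in simp)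

lemma rank3_scaled:
  assumes "rank3 b"
  shows "rank3 (\<lambda>i j. b i j - x i - y j)"
  using rank3_scale[OF assms, of "\<lambda>i. - x i" "\<lambda>j. - y j"] by simp

lemma nf_lift_221:
  assumes F: "infinite (UNIV :: 'a::field set) \<or> card (UNIV :: 'a set) \<ge> 4"
    and r3: "rank3 b" and n: "nf b r c x y" and A: "{a0,a1,a2,a3,a4} = {..<5}"
    and r: "r a0 = e0" "r a1 = e0" "r a2 = e1" "r a3 = e1" "r a4 = e2"
    and e: "e0 \<noteq> e1" "e0 \<noteq> e2" "e1 \<noteq> e2"
    and c: "\<And>j. j < 5 \<Longrightarrow> c j = e0 \<or> c j = e1 \<or> c j = e2" "\<exists>j<5. c j = e0" "\<exists>j<5. c j = e1" "\<exists>j<5. c j = e2"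
  shows "lift3 TYPE('a) b"
proof -
  let ?p = "perm5 a0 a1 a2 a3 a4" and ?q = "perm5 0 1 2 3 4"
  let ?b' = "\<lambda>i j. b i j - x i - y j"
  let ?b = "\<lambda>i j. ?b' (?p i) j"
  let ?c = "\<lambda>j. if c j = e0 then 0 else if c j = e1 then 1 else 2 :: nat"
  have r3': "rank3 ?b" 
    by (rule rank3_reindex[where \<tau>="\<lambda>j. j", OF rank3_scaled[OF r3, of x y] perm5_bij[OF A]])
      (simp add: bij_betw_def)
  have a: "a0 < 5" "a1 < 5" "a2 < 5" "a3 < 5" "a4 < 5" using A by auto
  have "nf221 ?b ?c"
    unfolding nf221_def
  proof (intro conjI allI impI)
    fix j :: nat assume j: "j < 5"
    have N: "\<And>i. i < 5 \<Longrightarrow> if r i = c j then b i j = x i + y j else b i j > x i + y j"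
      using n j unfolding nf_def by blast
    from c(1)[OF j] show "?c j = 0 \<and> ?b 0 j = 0 \<and> ?b 1 j = 0 \<and> ?b 2 j > 0 \<and> ?b 3 j > 0 \<and> ?b 4 j > 0 \<or>
     ?c j = 1 \<and> ?b 0 j > 0 \<and> ?b 1 j > 0 \<and> ?b 2 j = 0 \<and> ?b 3 j = 0 \<and> ?b 4 j > 0 \<or>
     ?c j = 2 \<and> ?b 0 j > 0 \<and> ?b 1 j > 0 \<and> ?b 2 j > 0 \<and> ?b 3 j > 0 \<and> ?b 4 j = 0"
      using N[OF a(1)] N[OF a(2)] N[OF a(3)] N[OF a(4)] N[OF a(5)] e
      by (elim disjE) (simp_all add: r)
  next
    from c(2) obtain j where "j < 5" "c j = e0" by blast
    then show "\<exists>j<5. ?c j = 0" by (intro exI[of _ j]) simp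
  next
    from c(3) obtain j where "j < 5" "c j = e1" by blast
    then show "\<exists>j<5. ?c j = 1" using e by (intro exI[of _ j]) simp
  next
    from c(4) obtain j where "j < 5" "c j = e2" by blast
    then show "\<exists>j<5. ?c j = 2" using e by (intro exI[of _ j]) simp
  qed
  from nf221_lift[OF F r3' this] have L: "lift3 TYPE('a) ?b" .
  have "lift3 TYPE('a) ?b'"
    by (rule lift3_reindex[where b="?b'" and \<pi>="?p" and \<sigma>="\<lambda>j. j", OF L perm5_bij[OF A]]) (simp add: bij_betw_def)
  then show ?thesis by (rule lift3_scaled)
qed

lemma nf_lift_221T:
  assumes F: "infinite (UNIV :: 'a::field set) \<or> card (UNIV :: 'a set) \<ge> 4"
    and r3: "rank3 b" and n: "nf b r c x y" and A: "{a0,a1,a2,a3,a4} = {..<5}"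
    and r: "c a0 = e0" "c a1 = e0" "c a2 = e1" "c a3 = e1" "c a4 = e2"
    and e: "e0 \<noteq> e1" "e0 \<noteq> e2" "e1 \<noteq> e2"
    and c: "\<And>j. j < 5 \<Longrightarrow> r j = e0 \<or> r j = e1 \<or> r j = e2" "\<exists>j<5. r j = e0" "\<exists>j<5. r j = e1" "\<exists>j<5. r j = e2"
  shows "lift3 TYPE('a) b"
  by (rule lift3_transpose, rule nf_lift_221[OF F rank3_transpose[OF r3] nf_transpose[OF n] A r e c])

text \<open>Ties between different classes are broken by moving \<open>x\<close> and
  \<open>y\<close> in opposite directions by a small multiple \<open>e\<close> of the heights.
  Equality within a class is unaffected, a tie from a higher row class to a lower column class
  becomes strict, and \<open>e\<close> is too small to spoil the strict inequalities.\<close>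

lemma weak_nf:
  assumes ge: "\<And>i j. i < 5 \<Longrightarrow> j < 5 \<Longrightarrow> b i j \<ge> x i + y j"
    and eq: "\<And>i j. i < 5 \<Longrightarrow> j < 5 \<Longrightarrow> r i = c j \<Longrightarrow> b i j = x i + y j"
    and ht: "\<And>i j. i < 5 \<Longrightarrow> j < 5 \<Longrightarrow> r i \<noteq> c j \<Longrightarrow> b i j = x i + y j \<Longrightarrow> h (r i) > (h (c j) :: real)"
  shows "\<exists>x y. nf b r c x y"
proof -
  let ?S = "{..<5::nat} \<times> {..<5::nat}"
  let ?D = "{d \<in> (\<lambda>p. b (fst p) (snd p) - x (fst p) - y (snd p)) ` ?S. d > 0}"
  have fin: "finite ?D" by simp
  \<comment> \<open>The least positive slack; inserting 1 keeps the set nonempty.\<close>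
  define d where "d = Min (insert 1 ?D)"
  have d: "d > 0" unfolding d_def using fin by (subst Min_gr_iff) auto
  have dle: "d \<le> b i j - x i - y j" if "i < 5" "j < 5" "b i j > x i + y j" for i j
  proof -
    have "b i j - x i - y j \<in> (\<lambda>p. b (fst p) (snd p) - x (fst p) - y (snd p)) ` ?S"
      by (rule image_eqI[of _ _ "(i,j)"]) (use that in auto)
    then show ?thesis unfolding d_def using fin that by (intro Min_le) auto
  qed
  define H where "H = 1 + (\<Sum>p\<in>?S. \<bar>h (r (fst p)) - h (c (snd p))\<bar>)"
  have H: "\<bar>h (r i) - h (c j)\<bar> < H" if "i < 5" "j < 5" for i j
    using member_le_sum[of "(i,j)" ?S "\<lambda>p. \<bar>h (r (fst p)) - h (c (snd p))\<bar>"] that by (simp add: H_def)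
  have H0: "H > 0" using H[of 0 0] by simp
  define e where "e = d / H"
  have e: "e > 0" "e * H = d" using d H0 by (simp_all add: e_def)
  have "nf b r c (\<lambda>i. x i - e * h (r i)) (\<lambda>j. y j + e * h (c j))"
    unfolding nf_def
  proof (intro allI impI)
    fix i j :: nat assume ij: "i < 5" "j < 5"
    show "if r i = c j then b i j = x i - e * h (r i) + (y j + e * h (c j))
       else b i j > x i - e * h (r i) + (y j + e * h (c j))"
    proof (cases "r i = c j")
      case True
      then show ?thesis using eq[OF ij True] by simp
    next
      case False
      have "b i j > x i - e * h (r i) + (y j + e * h (c j))"
      proof (cases "b i j = x i + y j")
        case True
        have "e * h (c j) < e * h (r i)" using ht[OF ij False True] e(1) by simp
        then show ?thesis using True by simp
      next
        case F: False
        then have "d \<le> b i j - x i - y j" using dle[OF ij] ge[OF ij] by simp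
        moreover have "e * (h (c j) - h (r i)) < e * H" using H[OF ij] e(1) by (intro mult_strict_left_mono) auto
        ultimately show ?thesis using e by (simp add: algebra_simps)
      qed
      then show ?thesis using False by simp
    qed
  qed
  then show ?thesis by (intro exI)
qed

section \<open>Constructions for classes of sizes (3, 1, 1)\<close>

lemma tw_three_zeros:
  assumes "\<And>k. k < 5 \<Longrightarrow> v k \<ge> 0" "card {k. k < (5::nat) \<and> v k = (0::real)} \<ge> 3"
    and "distinct [p,q,s,t]" "{p,q,s,t} \<subseteq> {..<5}"
  shows "tw (v p) (v q) (v s) (v t)"
proof -
  have *: "\<exists>u\<in>{p,q,s,t}-{w}. v u = 0" if w: "w \<in> {p,q,s,t}" for w
  proof (rule ccontr)
    assume n: "\<not> ?thesis"
    have "{k. k < 5 \<and> v k = 0} \<subseteq> {..<5} - ({p,q,s,t} - {w})" using n by auto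
    then have "card {k. k < 5 \<and> v k = 0} \<le> card ({..<5} - ({p,q,s,t} - {w}))" by (intro card_mono) auto
    also have "\<dots> = card {..<5::nat} - card ({p,q,s,t} - {w})" using assms(4) by (intro card_Diff_subset) auto
    also have "card ({p,q,s,t} - {w}) = 3" using w assms(3) by (auto simp: card_Diff_singleton)
    finally show False using assms(2) by simp
  qed
  have nn: "v p \<ge> 0" "v q \<ge> 0" "v s \<ge> 0" "v t \<ge> 0" using assms(1,4) by auto
  have "v q = 0 \<or> v s = 0 \<or> v t = 0" using *[of p] by auto
  moreover have "v p = 0 \<or> v s = 0 \<or> v t = 0" using *[of q] by auto
  moreover have "v p = 0 \<or> v q = 0 \<or> v t = 0" using *[of s] by auto
  moreover have "v p = 0 \<or> v q = 0 \<or> v s = 0" using *[of t] by auto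
  ultimately show ?thesis using nn unfolding tw_def by argo
qed

text \<open>Five distinct points of the projective line, namely 0, infinity, 1, \<open>w\<close> and
  \<open>v\<close>, have all determinants of degree 0. A relation then asks for a double minimum
  among four entries of a column, and of three zeros at least two survive the deletion of a
  row.\<close>

lemma star_lift:
  assumes F: "infinite (UNIV :: 'a::field set) \<or> card (UNIV :: 'a set) \<ge> 4"
    and ge: "\<And>i j. i < 5 \<Longrightarrow> j < 5 \<Longrightarrow> b i j \<ge> 0"
    and z: "\<And>j. j < 5 \<Longrightarrow> card {i. i < 5 \<and> b i j = 0} \<ge> 3"
  shows "lift3 TYPE('a) b"
proof -
  obtain w :: 'a where w: "w \<noteq> 0" "w \<noteq> 1" using exists_three_nonzero[OF F, of 1] by metis
  obtain v :: 'a where v: "v \<noteq> 0" "v \<noteq> 1" "v \<noteq> w" using exists_three_nonzero[OF F, of w] by metis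
  let ?c = "\<lambda>a::'a. hmonom a 0"
  have h: "hval (?c a) 0" if "a \<noteq> 0" for a :: 'a using that by (rule hval_hmonom)
  have d: "?c a - ?c b = ?c (a - b)" "?c a * ?c b = ?c (a * b)" for a b :: 'a
    by (rule hahn_eqI, simp add: hmonom.rep_eq) (simp add: hmonom_mult)
  have E: "hval (?c a * ?c b - ?c c * ?c e) 0" if "a * b - c * e \<noteq> 0" for a b c e :: 'a
    unfolding d by (rule h) (rule that)
  have T: "tw (0 + b p j) (0 + b q j) (0 + b s j) (0 + b t j)"
    if "j < 5" "distinct [p,q,s,t]" "{p,q,s,t} \<subseteq> {..<5}" for j p q s t
    using tw_three_zeros[of "\<lambda>i. b i j" p q s t] ge z that by simp
  show ?thesis
    by (rule tree_tw[OF F, where ?f0.0="?c 1" and ?g0.0="?c 0" and ?f1.0="?c 0" and ?g1.0="?c 1" and ?f2.0="?c 1" and ?g2.0="?c 1"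
          and ?f3.0="?c 1" and ?g3.0="?c w" and ?f4.0="?c 1" and ?g4.0="?c v"
          and ?p01.0=0 and ?p02.0=0 and ?p03.0=0 and ?p04.0=0 and ?p12.0=0 and ?p13.0=0 and ?p14.0=0 and ?p23.0=0 and ?p24.0=0 and ?p34.0=0])
      ((rule E, use w v in simp) | (rule T; simp))+
qed

lemma less_3_cases: "i < (3::nat) \<Longrightarrow> i = 0 \<or> i = 1 \<or> i = 2"
  by auto

text \<open>Rows 3 and 4 of the lift are themselves two of the three generating rows,
  \<open>w\<close> is the third.\<close>

lemma lift3_rows:
  fixes u :: "nat \<Rightarrow> 'a::field hahn"
  assumes "\<And>i j. i < 3 \<Longrightarrow> j < 5 \<Longrightarrow> hval (u i * w j + s i * A j + r i * B j) (b i j)"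
    and "\<And>j. j < 5 \<Longrightarrow> hval (A j) (b 3 j)" "\<And>j. j < 5 \<Longrightarrow> hval (B j) (b 4 j)"
  shows "lift3 TYPE('a) b"
  unfolding lift3_def
proof (intro exI allI impI)
  fix i j :: nat assume ij: "i < 5" "j < 5"
  let ?M = "\<lambda>i k. if i < 3 then (if k = 0 then u i else if k = 1 then s i else r i)
    else if i = 3 then (if k = 1 then 1 else 0) else (if k = (2::nat) then 1 else 0)"
  let ?N = "\<lambda>k j. if k = (0::nat) then w j else if k = 1 then A j else B j"
  have "(\<Sum>k<3. ?M i k * ?N k j) = ?M i 0 * w j + ?M i 1 * A j + ?M i 2 * B j"
    by (simp add: sum_lessThan_3)
  also have "hval \<dots> (b i j)"
  proof (cases "i < 3")
    case True
    then show ?thesis using assms(1)[OF True ij(2)] by simp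
  next
    case False
    then have "i = 3 \<or> i = 4" using ij by auto
    then show ?thesis using assms(2,3)[OF ij(2)] by auto
  qed
  finally show "hval (\<Sum>k<3. ?M i k * ?N k j) (b i j)" .
qed

lemma cramer2:
  fixes a b D x y :: "'a::comm_ring_1"
  assumes "(1 - a * b) * D = 1"
  shows "(x - b * y) * D + (y - a * x) * D * b = x" "(x - b * y) * D * a + (y - a * x) * D = y"
proof -
  have "(x - b * y) * D + (y - a * x) * D * b = x * ((1 - a * b) * D)" by (simp add: algebra_simps)
  then show "(x - b * y) * D + (y - a * x) * D * b = x" using assms by simp
  have "(x - b * y) * D * a + (y - a * x) * D = y * ((1 - a * b) * D)" by (simp add: algebra_simps)
  then show "(x - b * y) * D * a + (y - a * x) * D = y" using assms by simp
qed

text \<open>The large classes of rows and columns match. Each of the first three rows is row 0 plus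
  a combination of rows 3 and 4, chosen by Cramer's rule so that columns 3 and 4 come out exactly.
  Its coefficients have positive order, so the zero block keeps degree 0.\<close>

lemma type3_lift:
  assumes z: "\<And>i j. i < 3 \<Longrightarrow> j < 3 \<Longrightarrow> b i j = 0"
    and p: "\<And>i. i < 3 \<Longrightarrow> b i 3 > 0" "\<And>i. i < 3 \<Longrightarrow> b i 4 > 0" "\<And>j. j < 3 \<Longrightarrow> b 3 j > 0" "\<And>j. j < 3 \<Longrightarrow> b 4 j > 0"
    and d: "b 3 3 = 0" "b 3 4 > 0" "b 4 3 > 0" "b 4 4 = 0"
  shows "lift3 TYPE('a::field) b"
proof -
  let ?t = "\<lambda>x. hmonom (1::'a) x"
  define a where "a = ?t (b 3 4)"
  define c where "c = ?t (b 4 3)"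
  define D where "D = inverse (1 - a * c)"
  have ac: "vge 0 a" "vge 0 c" using d by (simp_all add: a_def c_def vge_hmonom)
  have "vge (b 3 4 + b 4 3) (a * c)" unfolding a_def c_def by (intro vge_mult vge_hmonom order_refl)
  then have ac1: "hval (1 - a * c) 0"
    using hval_add_dominant[OF hval_one, of "b 3 4 + b 4 3" "- (a * c)"] d by (simp add: vge_uminus)
  have D: "(1 - a * c) * D = 1" "vge 0 D"
    using hval_inverse[OF ac1] hval_nz[OF ac1] unfolding D_def by (simp_all add: hval_iff)
  \<comment> \<open>The changes against row 0 that are wanted in column 3 and, as \<open>y\<close>,
    in column 4.\<close>
  define x where "x i = ?t (b i 3) - ?t (b 0 3)" for i
  define y where "y i = ?t (b i 4) - ?t (b 0 4)" for i
  define g where "g i = (x i - c * y i) * D" for i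
  define h where "h i = (y i - a * x i) * D" for i
  define e where "e i = min (min (b i 3) (b 0 3)) (min (b i 4) (b 0 4))" for i
  have e: "e i > 0" "vge (e i) (g i)" "vge (e i) (h i)" if "i < 3" for i
  proof -
    show "e i > 0" using p[OF that] p[of 0] by (simp add: e_def)
    have x: "vge (e i) (x i)" "vge (e i) (y i)" unfolding x_def y_def e_def by (intro vge_diff vge_hmonom; simp)+
    show "vge (e i) (g i)" "vge (e i) (h i)" unfolding g_def h_def
      using vge_mult[OF vge_diff[OF x(1) vge_mult[OF ac(2) x(2), simplified]] D(2)]
       vge_mult[OF vge_diff[OF x(2) vge_mult[OF ac(1) x(1), simplified]] D(2)] by simp_all
  qed
  show ?thesis
  proof (rule lift3_rows[where u="\<lambda>i. 1" and w="\<lambda>j. ?t (b 0 j)" and A="\<lambda>j. ?t (b 3 j)" and B="\<lambda>j. ?t (b 4 j)" and s=g and r=h])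
    fix i j :: nat assume ij: "i < 3" "j < 5"
    show "hval (1 * ?t (b 0 j) + g i * ?t (b 3 j) + h i * ?t (b 4 j)) (b i j)"
    proof (cases "j < 3")
      case True
      have "vge (e i) (g i * ?t (b 3 j) + h i * ?t (b 4 j))"
        using vge_add[OF vge_mult[OF e(2)[OF ij(1)] vge_hmonom[of 0 "b 3 j"]] vge_mult[OF e(3)[OF ij(1)] vge_hmonom[of 0 "b 4 j"]]]
          p(3,4)[OF True] by simp
      from hval_add_dominant[OF hval_one this e(1)[OF ij(1)]] show ?thesis
        using z[OF ij(1) True] z[of 0 j] True by (simp add: hmonom_1_0 add.assoc)
    next
      case False
      then have "j = 3 \<or> j = 4" using ij by auto
      then show ?thesis
      proof
        assume j: "j = 3"
        have "g i * ?t (b 3 j) + h i * ?t (b 4 j) = x i"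
          using cramer2(1)[OF D(1), of "x i" "y i"] unfolding j d hmonom_1_0 g_def h_def c_def[symmetric] by simp
        then show ?thesis using hval_hmonom[of "1::'a" "b i 3"] unfolding j x_def by (simp add: add.assoc)
      next
        assume j: "j = 4"
        have "g i * ?t (b 3 j) + h i * ?t (b 4 j) = y i"
          using cramer2(2)[OF D(1), of "x i" "y i"] unfolding j d hmonom_1_0 g_def h_def a_def[symmetric] by simp
        then show ?thesis using hval_hmonom[of "1::'a" "b i 4"] unfolding j y_def by (simp add: add.assoc)
      qed
    qed
  qed (auto intro: hval_hmonom)
qed

text \<open>In contrast to \<open>hval\<close> the coefficient may be 0, which makes the notion
  additive.\<close>

definition lead :: "real \<Rightarrow> 'a::comm_ring_1 hahn \<Rightarrow> 'a \<Rightarrow> bool" where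
  "lead x a c \<longleftrightarrow> vge x a \<and> hcoeff a x = c"

lemma lead_add: "lead x a c \<Longrightarrow> lead x b d \<Longrightarrow> lead x (a + b) (c + d)"
  by (simp add: lead_def vge_add)

lemma lead_diff: "lead x a c \<Longrightarrow> lead x b d \<Longrightarrow> lead x (a - b) (c - d)"
  by (simp add: lead_def vge_diff)

lemma lead_mult: "lead x a c \<Longrightarrow> lead y b d \<Longrightarrow> lead (x + y) (a * b) (c * d)"
  by (simp add: lead_def vge_mult hcoeff_mult_lead)

lemma lead_vge: "vge y a \<Longrightarrow> x < y \<Longrightarrow> lead x a 0"
  by (auto simp: lead_def vge_def)

lemma lead_hmonom: "lead x (hmonom c x) c"
  by (simp add: lead_def vge_hmonom hmonom.rep_eq)

lemma lead_hval: "lead x a c \<Longrightarrow> c \<noteq> 0 \<Longrightarrow> hval a x"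
  by (simp add: lead_def hval_iff)

lemma lead_one: "lead 0 (1 :: 'a::field hahn) 1"
  using lead_hmonom[of 0 "1::'a"] by (simp add: hmonom_1_0)

lemma lead_inverse:
  fixes a :: "'a::field hahn"
  assumes "lead 0 a 1"
  shows "lead 0 (inverse a) 1"
proof -
  have h: "hval a 0" using lead_hval[OF assms] by simp
  have i: "lead 0 (inverse a) (hcoeff (inverse a) 0)" using hval_inverse[OF h] by (simp add: lead_def hval_iff)
  have "lead 0 (1 :: 'a hahn) (hcoeff (inverse a) 0)" using lead_mult[OF assms i] hval_nz[OF h] by simp
  then show ?thesis using i lead_one[where 'a='a] by (simp add: lead_def)
qed

text \<open>The large classes do not match: rows 0 to 2 belong to the class of column 0, columns 1
  to 3 to that of row 3. Row 4 and column 4 form the third class.\<close>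

definition type4 :: "(nat \<Rightarrow> nat \<Rightarrow> real) \<Rightarrow> bool" where
  "type4 b \<longleftrightarrow> (\<forall>i<3. b i 0 = 0 \<and> b i 4 > 0 \<and> (\<forall>l\<in>{1,2,3}. b i l > 0)) \<and>
    (\<forall>l\<in>{1,2,3}. b 3 l = 0 \<and> b 4 l > 0) \<and> b 3 0 > 0 \<and> b 3 4 > 0 \<and> b 4 0 > 0 \<and> b 4 4 = 0"

text \<open>Rows 0 to 2 combine a new row \<open>w\<close> with rows 3 and 4, with coefficients
  \<open>u i\<close>, \<open>s i\<close> and \<open>r i\<close>. Column 4 determines
  \<open>r i\<close> and column 0 determines \<open>u i\<close>, which has residue 1. In columns 1
  to 3 the coefficient at degree \<open>h\<close> is therefore that of \<open>w\<close> plus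
  \<open>sg i\<close>. As the \<open>sg i\<close> are distinct, it can be cancelled in one row of a
  column, which is what \<open>one\<close> calls for.\<close>

lemma type4_direct:
  assumes F: "infinite (UNIV :: 'a::field set) \<or> card (UNIV :: 'a set) \<ge> 4"
    and t4: "type4 b" and h: "h > 0"
    and ge: "\<And>i l. i < 3 \<Longrightarrow> l \<in> {1,2,3} \<Longrightarrow> b i l \<ge> h"
    and gt: "\<And>i l. i < 3 \<Longrightarrow> l \<in> {1,2,3} \<Longrightarrow> b i 4 + b 4 l > h"
    and one: "\<And>i k l. i < 3 \<Longrightarrow> k < 3 \<Longrightarrow> l \<in> {1,2,3} \<Longrightarrow> b i l > h \<Longrightarrow> b k l > h \<Longrightarrow> i = k"
  shows "lift3 TYPE('a) b"
proof -
  let ?t = "\<lambda>x. hmonom (1::'a) x"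
  \<comment> \<open>The residues 0, 1, \<open>w0\<close> distinguish the three rows;
    \<open>v0\<close> serves columns in which no row exceeds \<open>h\<close>. This takes four field
    elements.\<close>
  obtain w0 :: 'a where w0: "w0 \<noteq> 0" "w0 \<noteq> 1" using exists_three_nonzero[OF F, of 1] by metis
  obtain v0 :: 'a where v0: "v0 \<noteq> 0" "v0 \<noteq> 1" "v0 \<noteq> w0" using exists_three_nonzero[OF F, of w0] by metis
  define sg where "sg i = (if i = 0 then 0 else if i = (1::nat) then 1 else w0)" for i
  have sg: "sg i \<noteq> v0" if "i < 3" for i using v0 by (auto simp: sg_def)
  have sginj: "sg i \<noteq> sg k" if "i < 3" "k < 3" "i \<noteq> k" for i k
    using less_3_cases[OF that(1)] less_3_cases[OF that(2)] that(3) w0 by (auto simp: sg_def)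
  define s where "s i = hmonom (sg i) h" for i
  define r where "r i = ?t (b i 4) - s i * ?t (b 3 4)" for i
  define u where "u i = 1 - s i * ?t (b 3 0) - r i * ?t (b 4 0)" for i
  note T = t4[unfolded type4_def]
  have sl: "lead h (s i) (sg i)" "vge h (s i)" for i unfolding s_def by (rule lead_hmonom, rule vge_hmonom) simp
  have rv: "vge (min (b i 4) (h + b 3 4)) (r i)" for i unfolding r_def
    by (intro vge_diff vge_hmonom vge_mono[OF vge_mult[OF sl(2) vge_hmonom[OF order_refl]]]) simp_all
  have ul: "lead 0 (u i) 1" if "i < 3" for i
  proof -
    have "lead 0 (s i * ?t (b 3 0)) 0"
      by (rule lead_vge[OF vge_mult[OF sl(2) vge_hmonom[OF order_refl]]]) (use h T in simp)
    moreover have "b i 4 > 0" "b 3 4 > 0" "b 4 0 > 0" using T that by blast+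
    then have "0 < min (b i 4) (h + b 3 4) + b 4 0" using h by simp
    then have "lead 0 (r i * ?t (b 4 0)) 0"
      by (rule lead_vge[OF vge_mult[OF rv vge_hmonom[OF order_refl]]])
    ultimately show ?thesis unfolding u_def using lead_diff[OF lead_diff[OF lead_one]] by fastforce
  qed
  have un: "u i \<noteq> 0" if "i < 3" for i using lead_hval[OF ul[OF that]] hval_nz by auto
  have rq: "lead h (r i * ?t (b 4 l)) 0" if "i < 3" "l \<in> {1,2,3}" for i l
  proof (rule lead_vge[OF vge_mult[OF rv vge_hmonom[OF order_refl]]])
    have "b 3 4 > 0" "b 4 l > 0" using T that by blast+
    then show "h < min (b i 4) (h + b 3 4) + b 4 l" using gt[OF that] by simp
  qed
  have col: "\<exists>w. \<forall>i<3. hval (u i * w + s i + r i * ?t (b 4 l)) (b i l)" if l: "l \<in> {1,2,3}" for l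
  proof (cases "\<exists>k<3. b k l > h")
    case True
    then obtain k where k: "k < 3" "b k l > h" by blast
    \<comment> \<open>Solved for the entry of row \<open>k\<close>; the coefficient of
      \<open>w\<close> at \<open>h\<close> becomes the negative of \<open>sg k\<close>, so the other
      rows keep a nonzero term.\<close>
    define w where "w = (?t (b k l) - s k - r k * ?t (b 4 l)) * inverse (u k)"
    have "lead h (?t (b k l)) 0" by (rule lead_vge[OF vge_hmonom[OF order_refl] k(2)])
    from lead_mult[OF lead_diff[OF lead_diff[OF this sl(1)[of k]] rq[OF k(1) l]] lead_inverse[OF ul[OF k(1)]]]
    have wl: "lead h w (- sg k)" unfolding w_def by simp
    have "hval (u i * w + s i + r i * ?t (b 4 l)) (b i l)" if i: "i < 3" for i
    proof (cases "i = k")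
      case True
      have "u i * w = ?t (b k l) - s k - r k * ?t (b 4 l)" unfolding w_def True using un[OF k(1)] by simp
      then show ?thesis using hval_hmonom[of "1::'a" "b k l"] unfolding True by simp
    next
      case False
      then have b: "b i l = h" using one[OF i k(1) l _ k(2)] ge[OF i l] by force
      have "lead h (u i * w + s i + r i * ?t (b 4 l)) (sg i - sg k)"
        using lead_add[OF lead_add[OF lead_mult[OF ul[OF i] wl, simplified] sl(1)] rq[OF i l]] by simp
      then show ?thesis unfolding b using sginj[OF i k(1) False] by (intro lead_hval) auto
    qed
    then show ?thesis by (intro exI allI impI)
  next
    case False
    have "hval (u i * hmonom (- v0) h + s i + r i * ?t (b 4 l)) (b i l)" if i: "i < 3" for i
    proof -
      have b: "b i l = h" using False i ge[OF i l] by force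
      have "lead h (u i * hmonom (- v0) h + s i + r i * ?t (b 4 l)) (sg i - v0)"
        using lead_add[OF lead_add[OF lead_mult[OF ul[OF i] lead_hmonom[of h "- v0"], simplified] sl(1)] rq[OF i l]] by simp
      then show ?thesis unfolding b using sg[OF i] by (intro lead_hval) auto
    qed
    then show ?thesis by (intro exI allI impI)
  qed
  then have "\<forall>l\<in>{1,2,3}. \<exists>w. \<forall>i<3. hval (u i * w + s i + r i * ?t (b 4 l)) (b i l)" by (rule ballI)
  from bchoice[OF this] obtain w where w: "\<forall>l\<in>{1,2,3}. \<forall>i<3. hval (u i * w l + s i + r i * ?t (b 4 l)) (b i l)" ..
  let ?w = "\<lambda>j. if j = 0 then 1 else if j = 4 then 0 else w j"
  show ?thesis
  proof (rule lift3_rows[where u=u and s=s and r=r and w="?w" and A="\<lambda>j. ?t (b 3 j)" and B="\<lambda>j. ?t (b 4 j)"])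
    fix i j :: nat assume ij: "i < 3" "j < 5"
    then have "j = 0 \<or> j = 4 \<or> j \<in> {1,2,3}" by auto
    then show "hval (u i * ?w j + s i * ?t (b 3 j) + r i * ?t (b 4 j)) (b i j)"
    proof (elim disjE)
      assume j: "j = 0"
      have "b i 0 = 0" using T ij by blast
      then show ?thesis unfolding j u_def using hval_one[where 'a='a] by simp
    next
      assume j: "j = 4"
      have "b 4 4 = 0" using T by blast
      then show ?thesis unfolding j r_def using hval_hmonom[of "1::'a" "b i 4"] by (simp add: hmonom_1_0)
    next
      assume j: "j \<in> {1,2,3}"
      then have n: "j \<noteq> 0" "j \<noteq> 4" by auto
      have "b 3 j = 0" using T j by blast
      moreover have "hval (u i * w j + s i + r i * ?t (b 4 j)) (b i j)" using w j ij(1) by blast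
      ultimately show ?thesis using n by (simp add: hmonom_1_0)
    qed
  qed (auto intro: hval_hmonom)
qed

text \<open>The points are (1, 0), (0, 1), (1, 1), a point 4 on the line of (1, \<open>d\<close>)
  and a point 3 close to that line. A tropical dependence of rows 0 to 3 has the weights 0, 0,
  \<open>th\<close>, \<open>po\<close>; shifted by \<open>x\<close> they are the degrees of the
  determinants against point 4.\<close>

lemma type4_star_core:
  assumes F: "infinite (UNIV :: 'a::field set) \<or> card (UNIV :: 'a set) \<ge> 4"
    and t4: "type4 b" and x: "\<And>i. i < 3 \<Longrightarrow> b i 4 = x" and q: "\<And>l. l \<in> {1,2,3} \<Longrightarrow> b 4 l = q"
    and V: "\<And>i l. i < 3 \<Longrightarrow> l \<in> {1,2,3} \<Longrightarrow> b i l > x + q"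
    and th: "th \<ge> 0" and tws: "\<And>j. j < 5 \<Longrightarrow> tw (b 0 j) (b 1 j) (th + b 2 j) (po + b 3 j)"
  shows "lift3 TYPE('a) b"
proof -
  note T = t4[unfolded type4_def]
  have xq: "x > 0" "q > 0" using T x[of 0] q[of 1] by auto
  have V1: "b 0 1 > x + q" "b 1 1 > x + q" "b 2 1 > x + q" using V by simp_all
  \<comment> \<open>Otherwise row 3 would be the strict minimum of column 1 in the given
    dependence.\<close>
  have p: "po > x + q"
  proof (rule ccontr)
    assume "\<not> po > x + q"
    moreover have "b 3 1 = 0" using T by simp
    ultimately show False using tws[of 1] V1 th unfolding tw_def by auto
  qed
  obtain w :: 'a where w: "w \<noteq> 0" "w \<noteq> 1" using exists_three_nonzero[OF F, of 1] by metis
  \<comment> \<open>For \<open>th = 0\<close> the residue of \<open>d\<close> has to avoid 0, 1 and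
    \<open>w\<close>. For \<open>th > 0\<close> it is 1, and \<open>de\<close> must not let the two
    terms of the determinant of points 2 and 3 cancel when their degrees agree.\<close>
  obtain de :: 'a where de: "de \<noteq> 0" "th = 0 \<Longrightarrow> 1 + de \<noteq> 0 \<and> 1 + de \<noteq> w" "th > 0 \<Longrightarrow> de \<noteq> 1 - w"
  proof (cases "th = 0")
    case True
    obtain e :: 'a where e: "e \<noteq> 0" "e \<noteq> 1" "e \<noteq> w" using exists_three_nonzero[OF F, of w] by metis
    show ?thesis by (rule that[of "e - 1"]) (use e True in auto)
  next
    case False
    obtain e :: 'a where e: "e \<noteq> 0" "e \<noteq> 1" "e \<noteq> 1 - w" using exists_three_nonzero[OF F, of "1 - w"] by metis
    show ?thesis by (rule that[of e]) (use e False in auto)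
  qed
  let ?t = "\<lambda>x. hmonom (1::'a) x"
  define d where "d = 1 + hmonom de th"
  have hm: "hmonom c x = hmonom c 0 * ?t x" for c :: 'a and x by (simp add: hmonom_mult)
  have d: "hval d 0"
  proof (cases "th = 0")
    case True
    have "lead 0 d (1 + de)" unfolding d_def True by (intro lead_add lead_one lead_hmonom)
    then show ?thesis using de(2)[OF True] by (intro lead_hval) auto
  next
    case False
    then show ?thesis unfolding d_def using th by (intro hval_add_dominant[OF hval_one vge_hmonom[OF order_refl]]) simp
  qed
  have dw: "hval (d - hmonom w 0) 0"
  proof (cases "th = 0")
    case True
    have "lead 0 (d - hmonom w 0) (1 + de - w)" unfolding d_def True by (intro lead_add lead_diff lead_one lead_hmonom)
    then show ?thesis using de(2)[OF True] by (intro lead_hval) auto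
  next
    case False
    have "lead 0 (d - hmonom w 0) (1 + 0 - w)" unfolding d_def
      by (intro lead_add lead_diff lead_one lead_hmonom lead_vge[OF vge_hmonom[OF order_refl]]) (use False th in simp)
    then show ?thesis by (rule lead_hval) (use w in simp)
  qed
  have p23: "hval (hmonom de (x + q + th) + hmonom (w - 1) po) (min (x + q + th) po)"
  proof -
    consider "x + q + th < po" | "x + q + th > po" | "x + q + th = po" by linarith
    then show ?thesis
    proof cases
      case 1
      then show ?thesis using hval_add_dominant[OF hval_hmonom[OF de(1)] vge_hmonom[OF order_refl] 1] by simp
    next
      case 2
      have "hval (hmonom (w - 1) po + hmonom de (x + q + th)) po"
        by (rule hval_add_dominant[OF hval_hmonom vge_hmonom[OF order_refl] 2]) (use w in simp)
      then show ?thesis using 2 by (simp add: add.commute)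
    next
      case 3
      have "lead po (hmonom de po + hmonom (w - 1) po) (de + (w - 1))" by (intro lead_add lead_hmonom)
      moreover have "de + (w - 1) \<noteq> 0" using de(3) 3 p by (auto simp: algebra_simps)
      ultimately show ?thesis using 3 lead_hval by auto
    qed
  qed
  have pt: "hval (?t (x + q) + ?t po) (x + q)"
    by (rule hval_add_dominant[OF hval_hmonom vge_hmonom[OF order_refl] p]) simp
  have pd: "hval (?t (x + q) * d + hmonom w po) (x + q)"
    by (rule hval_add_dominant[OF _ vge_hmonom[OF order_refl] p]) (use hval_mult[OF hval_hmonom d, of 1 "x+q"] in simp)
  have dm: "?t y * d = ?t y + hmonom de (y + th)" for y
    by (simp add: d_def distrib_left hmonom_mult)
  have wm: "hmonom (w - 1) po = hmonom w po - ?t po" by (rule hahn_eqI) (simp add: hmonom.rep_eq)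
  have e34: "(?t (x + q) + ?t po) * (?t x * d) - ?t x * (?t (x + q) * d + hmonom w po) = ?t (x + po) * (d - hmonom w 0)"
  proof -
    have g: "(A + P) * (X * D) - X * (A * D + W * P) = (X * P) * (D - W)" for A P X D W :: "'a hahn"
      by (simp add: algebra_simps)
    show ?thesis unfolding hm[of w po] g by (simp add: hmonom_mult)
  qed
  have h34: "hval (?t (x + po) * (d - hmonom w 0)) (x + po)"
    using hval_mult[OF hval_hmonom dw, of 1 "x + po"] by simp
  have cols: "j = 0 \<or> j = 4 \<or> j \<in> {1,2,3}" if "j < 5" for j :: nat using that by auto
  show ?thesis
  proof (rule tree_tw[OF F, where ?f0.0="1" and ?g0.0="0" and ?f1.0="0" and ?g1.0="1" and ?f2.0="1" and ?g2.0="1"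
        and ?f3.0="?t (x + q) + ?t po" and ?g3.0="?t (x + q) * d + hmonom w po" and ?f4.0="?t x" and ?g4.0="?t x * d"
        and ?p01.0=0 and ?p02.0=0 and ?p12.0=0 and ?p03.0="x + q" and ?p13.0="x + q" and ?p23.0="min (x + q + th) po"
        and ?p04.0=x and ?p14.0=x and ?p24.0="x + th" and ?p34.0="x + po"])
    show "hval (1 * (?t (x + q) * d + hmonom w po) - (?t (x + q) + ?t po) * 0) (x + q)" using pd by simp
    show "hval (1 * (?t x * d) - ?t x * 0) x" using hval_mult[OF hval_hmonom d, of 1 x] by simp
    show "hval (0 * (?t (x + q) * d + hmonom w po) - (?t (x + q) + ?t po) * 1) (x + q)"
      using pt hval_uminus by (simp del: minus_add_distrib)
    show "hval (0 * (?t x * d) - ?t x * 1) x" using hval_hmonom[of "1::'a" x] hval_uminus by simp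
    show "hval (1 * (?t (x + q) * d + hmonom w po) - (?t (x + q) + ?t po) * 1) (min (x + q + th) po)"
      using p23 unfolding dm wm by (simp add: algebra_simps)
    show "hval (1 * (?t x * d) - ?t x * 1) (x + th)" unfolding dm using hval_hmonom[OF de(1), of "x + th"] by simp
    show "hval ((?t (x + q) + ?t po) * (?t x * d) - ?t x * (?t (x + q) * d + hmonom w po)) (x + po)"
      unfolding e34 by (rule h34)
  next
    fix j :: nat assume j: "j < 5"
    have B0: "b 0 0 = 0" "b 1 0 = 0" "b 2 0 = 0" "b 3 0 > 0" "b 4 0 > 0" using T by simp_all
    have B4: "b 0 4 = x" "b 1 4 = x" "b 2 4 = x" "b 3 4 > 0" "b 4 4 = 0" using T x by simp_all
    have Bl: "b 0 j > x + q" "b 1 j > x + q" "b 2 j > x + q" "b 3 j = 0" "b 4 j = q"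
      "tw (b 0 j) (b 1 j) (th + b 2 j) (po + b 3 j)" if "j \<in> {1,2,3}"
      using T V[OF _ that] q[OF that] that tws[OF j] by auto
    show "tw (0 + b 1 j) (0 + b 2 j) (x + q + b 3 j) (x + b 4 j)"
      using cols[OF j] by (elim disjE) (use B0 B4 Bl xq p th in \<open>simp_all add: tw_def\<close>)
    show "tw (0 + b 0 j) (0 + b 2 j) (x + q + b 3 j) (x + b 4 j)"
      using cols[OF j] by (elim disjE) (use B0 B4 Bl xq p th in \<open>simp_all add: tw_def\<close>)
    show "tw (0 + b 0 j) (0 + b 1 j) (min (x + q + th) po + b 3 j) (x + th + b 4 j)"
      using cols[OF j]
    proof (elim disjE)
      assume "j \<in> {1,2,3}"
      from Bl[OF this] show ?thesis using xq p th unfolding tw_def min_def by (smt (verit))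
    qed (use B0 B4 xq p th in \<open>simp_all add: tw_def min_def\<close>)
    show "tw (x + q + b 0 j) (x + q + b 1 j) (min (x + q + th) po + b 2 j) (x + po + b 4 j)"
      using cols[OF j]
    proof (elim disjE)
      assume "j \<in> {1,2,3}"
      from Bl[OF this] show ?thesis using xq p th unfolding tw_def min_def by (smt (verit))
    qed (use B0 B4 xq p th in \<open>simp_all add: tw_def min_def\<close>)
  qed (use hval_one hval_uminus in simp_all)
qed

lemma type4_perm:
  assumes "type4 b" "{i0,i1,i2} = {..<3}" "{l1,l2,l3} = {1,2,3}"
  shows "type4 (\<lambda>i j. b (perm5 i0 i1 i2 3 4 i) (perm5 0 l1 l2 l3 4 j))"
proof -
  have i: "i0 < 3" "i1 < 3" "i2 < 3" using assms(2) by auto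
  have l: "l1 \<in> {1,2,3}" "l2 \<in> {1,2,3}" "l3 \<in> {1,2,3}" using assms(3) by blast+
  have "perm5 i0 i1 i2 3 4 i < 3" if "i < 3" for i using less_3_cases[OF that] i by auto
  moreover have "perm5 0 l1 l2 l3 4 j \<in> {1,2,3}" if "j \<in> {1,2,3}" for j
    using that l by (elim insertE) (simp_all only: perm5_simps perm5_1, simp_all)
  ultimately show ?thesis using assms(1) unfolding type4_def by (simp only: perm5_simps perm5_1) blast
qed

lemma tw_acb: "tw a b c d \<Longrightarrow> tw a c b d"
  unfolding tw_def by (smt (verit))

lemma tw_minus: "tw a b c d \<Longrightarrow> tw (a - e) (b - e) (c - e) (d - e)"
  unfolding tw_def by (smt (verit))

lemma tw_bca: "tw a b c d \<Longrightarrow> tw b c a d"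
  unfolding tw_def by (smt (verit))

text \<open>Two of \<open>z 0\<close>, \<open>z 1\<close>, \<open>z 2\<close> tie for the least
  value: otherwise column 4 forces \<open>z 3\<close> so low that row 3 is the strict minimum of
  column 1. Renumbering the rows moves the tie to rows 0 and 1.\<close>

lemma type4_star:
  assumes F: "infinite (UNIV :: 'a::field set) \<or> card (UNIV :: 'a set) \<ge> 4"
    and r3: "rank3 b" and t4: "type4 b" and x: "\<And>i. i < 3 \<Longrightarrow> b i 4 = x" and q: "\<And>l. l \<in> {1,2,3} \<Longrightarrow> b 4 l = q"
    and V: "\<And>i l. i < 3 \<Longrightarrow> l \<in> {1,2,3} \<Longrightarrow> b i l > x + q"
  shows "lift3 TYPE('a) b"
proof -
  obtain z :: "nat \<Rightarrow> real" where z: "\<forall>j<5. tw (z 0 + b 0 j) (z 1 + b 1 j) (z 2 + b 2 j) (z 3 + b 3 j)"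
    using kernel_tw[OF r3, of 4 0 1 2 3] by force
  note T = t4[unfolded type4_def]
  have z1: "tw (z 0 + b 0 1) (z 1 + b 1 1) (z 2 + b 2 1) (z 3 + b 3 1)" using z by simp
  have z4: "tw (z 0 + b 0 4) (z 1 + b 1 4) (z 2 + b 2 4) (z 3 + b 3 4)" using z by simp
  have B: "b 0 4 = x" "b 1 4 = x" "b 2 4 = x" "b 3 4 > 0" "b 3 1 = 0" using T x by simp_all
  have xq: "x > 0" "q > 0" using T x[of 0] q[of 1] by auto
  have V1: "b 0 1 > x + q" "b 1 1 > x + q" "b 2 1 > x + q" using V by simp_all
  have "z 0 = z 1 \<and> z 0 \<le> z 2 \<or> z 0 = z 2 \<and> z 0 \<le> z 1 \<or> z 1 = z 2 \<and> z 1 \<le> z 0"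
    using z1 z4 B V1 xq unfolding tw_def by (smt (verit))
  moreover have "{0,1,2} = {..<3::nat}" "{0,2,1} = {..<3::nat}" "{1,2,0} = {..<3::nat}" by auto
  moreover have "\<forall>j<5. tw (z 0 + b 0 j) (z 2 + b 2 j) (z 1 + b 1 j) (z 3 + b 3 j)"
    "\<forall>j<5. tw (z 1 + b 1 j) (z 2 + b 2 j) (z 0 + b 0 j) (z 3 + b 3 j)"
    using z tw_acb tw_bca by blast+
  ultimately have "\<exists>i0 i1 i2. {i0,i1,i2} = {..<3::nat} \<and> z i0 = z i1 \<and> z i0 \<le> z i2 \<and>
    (\<forall>j<5. tw (z i0 + b i0 j) (z i1 + b i1 j) (z i2 + b i2 j) (z 3 + b 3 j))"
    using z by blast
  then obtain i0 i1 i2 where i: "{i0,i1,i2} = {..<3::nat}" "z i0 = z i1" "z i0 \<le> z i2"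
    and zi: "\<forall>j<5. tw (z i0 + b i0 j) (z i1 + b i1 j) (z i2 + b i2 j) (z 3 + b 3 j)"
    by (elim exE conjE) (rule that)
  let ?b = "\<lambda>i j. b (perm5 i0 i1 i2 3 4 i) (perm5 0 1 2 3 4 j)"
  have lt: "i0 < 3" "i1 < 3" "i2 < 3" using i(1) by auto
  have c: "perm5 0 (Suc 0) 2 3 4 j = j" if "j < 5" for j using that unfolding less_5_cases by auto
  have r: "perm5 i0 i1 i2 3 4 i < 3" if "i < 3" for i using less_3_cases[OF that] lt by auto
  have "lift3 TYPE('a) ?b"
  proof (rule type4_star_core[where x=x and q=q and th="z i2 - z i0" and po="z 3 - z i0", OF F type4_perm[OF t4 i(1) refl]])
    show "tw (?b 0 j) (?b 1 j) (z i2 - z i0 + ?b 2 j) (z 3 - z i0 + ?b 3 j)" if "j < 5" for j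
      using tw_minus[OF zi[rule_format, OF that], of "z i0"] i(2) by (simp add: c that add_diff_eq diff_add_eq)
    show "?b i 4 = x" if "i < 3" for i using x[OF r[OF that]] by simp
    show "?b 4 l = q" if "l \<in> {1,2,3}" for l 
    proof -
      have "l < 5" using that by auto
      then show ?thesis using q[OF that] by (simp add: c)
    qed
    show "?b i l > x + q" if "i < 3" "l \<in> {1,2,3}" for i l
    proof -
      have "l < 5" using that by auto
      then show ?thesis using V[OF r[OF that(1)] that(2)] by (simp add: c)
    qed
    show "z i2 - z i0 \<ge> 0" using i by simp
  qed
  moreover have "{i0,i1,i2,3,4} = {..<5}"
  proof -
    have "{i0,i1,i2,3,4} = {i0,i1,i2} \<union> {3,4}" by auto
    also have "\<dots> = {..<5}" by (subst i(1)) auto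
    finally show ?thesis .
  qed
  ultimately show ?thesis by (rule lift3_perm5) auto
qed

section \<open>Zero patterns when the large classes do not match\<close>

lemma all_less_5: "(\<forall>i<5. P i) \<longleftrightarrow> P 0 \<and> P 1 \<and> P 2 \<and> P 3 \<and> P (4::nat)"
  by (auto simp only: less_5_cases)

lemma ex_less_5: "(\<exists>i<5. P i) \<longleftrightarrow> P 0 \<or> P 1 \<or> P 2 \<or> P 3 \<or> P (4::nat)"
  by (auto simp only: less_5_cases)

text \<open>Fifteen entries are left open: rows 0 to 2 and row 4 in columns 1 to 3, and rows 0 to 2
  in column 4. Which of them vanish decides the construction.\<close>

definition pat :: "(nat \<Rightarrow> nat \<Rightarrow> real) \<Rightarrow> bool" where
  "pat b \<longleftrightarrow> (\<forall>i<5. \<forall>j<5. b i j \<ge> 0) \<and> b 0 0 = 0 \<and> b 1 0 = 0 \<and> b 2 0 = 0 \<and> b 3 0 \<noteq> 0 \<and> b 4 0 \<noteq> 0 \<and>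
    b 3 1 = 0 \<and> b 3 2 = 0 \<and> b 3 3 = 0 \<and> b 3 4 \<noteq> 0 \<and> b 4 4 = 0"

text \<open>What \<open>weak_nf\<close> needs for zero potentials, with every class inhabited on
  both sides.\<close>

definition nf_labels :: "(nat \<Rightarrow> nat \<Rightarrow> real) \<Rightarrow> (nat \<Rightarrow> nat) \<Rightarrow> (nat \<Rightarrow> nat) \<Rightarrow> (nat \<Rightarrow> real) \<Rightarrow> bool" where
  "nf_labels b r c h \<longleftrightarrow> (\<forall>i<5. \<forall>j<5. if r i = c j then b i j = 0 else b i j = 0 \<longrightarrow> h (r i) > h (c j)) \<and>
    (\<forall>j<5. c j \<in> {0,1,2} \<and> r j \<in> {0,1,2}) \<and>
    (\<exists>j<5. c j = 0) \<and> (\<exists>j<5. c j = 1) \<and> (\<exists>j<5. c j = 2) \<and> (\<exists>j<5. r j = 0) \<and> (\<exists>j<5. r j = 1) \<and> (\<exists>j<5. r j = 2)"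

lemma nf_labels_nf:
  assumes "pat b" "nf_labels b r c h"
  shows "\<exists>x y. nf b r c x y"
proof (rule weak_nf[where x="\<lambda>_. 0" and y="\<lambda>_. 0" and h=h])
  fix i j :: nat assume ij: "i < 5" "j < 5"
  show "0 + 0 \<le> b i j" using assms(1) ij unfolding pat_def by simp
  have L: "if r i = c j then b i j = 0 else b i j = 0 \<longrightarrow> h (r i) > h (c j)"
    using assms(2) ij unfolding nf_labels_def by blast
  show "b i j = 0 + 0" if "r i = c j" using L that by simp
  show "h (r i) > h (c j)" if "r i \<noteq> c j" "b i j = 0 + 0" using L that by simp
qed

lemma nf_labels_lift:
  assumes F: "infinite (UNIV :: 'a::field set) \<or> card (UNIV :: 'a set) \<ge> 4"
    and r3: "rank3 b" and p: "pat b" and n: "nf_labels b r c h" and A: "{a0,a1,a2,a3,a4} = {..<5}"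
    and e: "e0 \<noteq> e1" "e0 \<noteq> e2" "e1 \<noteq> e2" "e0 < 3" "e1 < 3" "e2 < 3"
    and r: "r a0 = e0 \<and> r a1 = e0 \<and> r a2 = e1 \<and> r a3 = e1 \<and> r a4 = e2 \<or>
      c a0 = e0 \<and> c a1 = e0 \<and> c a2 = e1 \<and> c a3 = e1 \<and> c a4 = e2"
  shows "lift3 TYPE('a) b"
proof -
  obtain x y where N: "nf b r c x y" using nf_labels_nf[OF p n] by blast
  have e': "e0 = 0 \<or> e0 = 1 \<or> e0 = 2" "e1 = 0 \<or> e1 = 1 \<or> e1 = 2" "e2 = 0 \<or> e2 = 1 \<or> e2 = 2"
    using e by auto
  have "{e0,e1,e2} = {0,1,2}"
    by (rule card_subset_eq) (use e e' in simp_all)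
  then have cov: "k = e0 \<or> k = e1 \<or> k = e2" if "k \<in> {0,1,2}" for k :: nat using that by blast
  note n' = n[unfolded nf_labels_def, THEN conjunct2]
  have c: "c j = e0 \<or> c j = e1 \<or> c j = e2" "r j = e0 \<or> r j = e1 \<or> r j = e2" if "j < 5" for j
    using n'[THEN conjunct1, rule_format, OF that] cov by blast+
  have "\<exists>j<5. c j = k" "\<exists>j<5. r j = k" if "k = 0 \<or> k = 1 \<or> k = 2" for k
    using n'[THEN conjunct2] that by (elim disjE; simp only:)+
  note ex = this[OF e'(1)] this[OF e'(2)] this[OF e'(3)]
  from r show ?thesis
  proof (elim disjE conjE)
    assume "r a0 = e0" "r a1 = e0" "r a2 = e1" "r a3 = e1" "r a4 = e2"
    from nf_lift_221[OF F r3 N A this e(1-3) c(1) ex(1,3,5)] show ?thesis .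
  next
    assume "c a0 = e0" "c a1 = e0" "c a2 = e1" "c a3 = e1" "c a4 = e2"
    from nf_lift_221T[OF F r3 N A this e(1-3) c(2) ex(2,4,6)] show ?thesis .
  qed
qed

lemma nf_lift_311:
  assumes n: "nf b r c x y" and A: "{a0,a1,a2,a3,a4} = {..<5}" and C: "{c0,c1,c2,c3,c4} = {..<5}"
    and r: "r a0 = e0" "r a1 = e0" "r a2 = e0" "r a3 = e1" "r a4 = e2"
    and c: "c c0 = e0" "c c1 = e0" "c c2 = e0" "c c3 = e1" "c c4 = e2"
    and e: "e0 \<noteq> e1" "e0 \<noteq> e2" "e1 \<noteq> e2"
  shows "lift3 TYPE('a::field) b"
proof (rule lift3_scaled[of b x y], rule lift3_perm5[OF type3_lift A C])
  let ?p = "perm5 a0 a1 a2 a3 a4" and ?q = "perm5 c0 c1 c2 c3 c4"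
  have N: "if r (?p i) = c (?q j) then b (?p i) (?q j) = x (?p i) + y (?q j) else b (?p i) (?q j) > x (?p i) + y (?q j)"
    if "i < 5" "j < 5" for i j
    using n perm5_in[OF A that(1)] perm5_in[OF C that(2)] unfolding nf_def by blast
  have r': "r (?p i) = e0" if "i < 3" for i using less_3_cases[OF that] r by auto
  have c': "c (?q i) = e0" if "i < 3" for i using less_3_cases[OF that] c by auto
  show "b (?p i) (?q j) - x (?p i) - y (?q j) = 0" if "i < 3" "j < 3" for i j
    using N[of i j] that r' c' by simp
  show "b (?p i) (?q 3) - x (?p i) - y (?q 3) > 0" if "i < 3" for i
    using N[of i 3] that r'[OF that] c e by simp
  show "b (?p i) (?q 4) - x (?p i) - y (?q 4) > 0" if "i < 3" for i
    using N[of i 4] that r'[OF that] c e by simp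
  show "b (?p 3) (?q j) - x (?p 3) - y (?q j) > 0" if "j < 3" for j
    using N[of 3 j] that c'[OF that] r e by simp
  show "b (?p 4) (?q j) - x (?p 4) - y (?q j) > 0" if "j < 3" for j
    using N[of 4 j] that c'[OF that] r e by simp
  show "b (?p 3) (?q 3) - x (?p 3) - y (?q 3) = 0" using N[of 3 3] r c by simp
  show "b (?p 4) (?q 4) - x (?p 4) - y (?q 4) = 0" using N[of 4 4] r c by simp
  show "b (?p 3) (?q 4) - x (?p 3) - y (?q 4) > 0" using N[of 3 4] r c e by simp
  show "b (?p 4) (?q 3) - x (?p 4) - y (?q 3) > 0" using N[of 4 3] r c e by simp
qed

text \<open>Each disjunct is a zero pattern for which other classes of rows and columns can be chosen such that the
zeros outside the diagonal blocks only lead from higher to lower classes.\<close>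

definition nfmove :: "(nat \<Rightarrow> nat \<Rightarrow> bool) \<Rightarrow> bool" where
  "nfmove z \<longleftrightarrow>
    z 0 4 \<and> \<not> z 1 4 \<and> \<not> z 2 4 \<or>
    \<not> z 0 4 \<and> z 1 4 \<and> z 2 4 \<and> z 0 1 \<and> \<not> z 0 2 \<and> \<not> z 0 3 \<or>
    (z 0 1 \<or> z 0 2 \<or> z 0 3) \<and> \<not> (z 0 1 \<and> z 0 2 \<and> z 0 3) \<and> z 1 4 \<and> z 2 4 \<and>
      (\<forall>l\<in>{1,2,3}. \<not> z 1 l \<and> \<not> z 2 l \<and> (z 0 l \<or> z 4 l)) \<or>
    (z 1 1 \<or> z 1 2 \<or> z 1 3) \<and> \<not> (z 1 1 \<and> z 1 2 \<and> z 1 3) \<and> z 0 4 \<and>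
      (\<forall>l\<in>{1,2,3}. \<not> z 0 l \<and> (z 1 l \<longleftrightarrow> z 2 l) \<and> (z 1 l \<or> z 4 l)) \<or>
    \<not> (z 1 1 \<and> z 1 2 \<and> z 1 3) \<and> \<not> z 0 4 \<and> z 1 4 \<and> z 2 4 \<and>
      (\<forall>l\<in>{1,2,3}. \<not> z 0 l \<and> (z 1 l \<longleftrightarrow> z 2 l) \<and> (z 1 l \<or> z 4 l)) \<or>
    \<not> z 0 4 \<and> z 1 4 \<and> z 2 4 \<and> \<not> z 4 1 \<and> z 4 2 \<and> z 4 3 \<and> \<not> z 0 1 \<and> \<not> z 0 2 \<and> \<not> z 0 3 \<and>
      \<not> z 1 1 \<and> z 1 2 \<and> z 1 3 \<and> \<not> z 2 1 \<and> z 2 2 \<and> z 2 3 \<or>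
    \<not> z 0 4 \<and> \<not> z 1 4 \<and> \<not> z 2 4 \<and> \<not> (z 1 1 \<and> z 1 2 \<and> z 1 3) \<and>
      (\<forall>l\<in>{1,2,3}. \<not> z 4 l \<and> (z 1 l \<longleftrightarrow> z 2 l) \<and> (z 1 l \<or> z 0 l))"

lemma nfmove_lift:
  assumes F: "infinite (UNIV :: 'a::field set) \<or> card (UNIV :: 'a set) \<ge> 4"
    and r3: "rank3 b" and p: "pat b" and m: "nfmove (\<lambda>i j. b i j = 0)"
  shows "lift3 TYPE('a) b"
proof -
  have all: "{4,0,1,2,3} = {..<5::nat}" "{0,3,1,2,4} = {..<5::nat}" "{1,2,3,4,0} = {..<5::nat}" "{0,1,2,3,4} = {..<5::nat}"
    "{2,3,4,0,1} = {..<5::nat}" "{1,2,4,0,3} = {..<5::nat}" by auto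
  note P = p[unfolded pat_def, THEN conjunct2]
  note S = nf_labels_def all_less_5 ex_less_5
  \<comment> \<open>Columns 1 to 3 are divided between the classes 0 and 2 according to whether they
    vanish in row \<open>i\<close>.\<close>
  let ?L = "\<lambda>i. perm5 1 (if b i 1 = 0 then 0 else 2) (if b i 2 = 0 then 0 else 2) (if b i 3 = 0 then 0 else 2)"
  show ?thesis
    using m unfolding nfmove_def
  proof (elim disjE)
    assume "b 0 4 = 0 \<and> \<not> b 1 4 = 0 \<and> \<not> b 2 4 = 0"
    then have "nf_labels b (perm5 2 0 0 1 2) (perm5 0 1 1 1 2) (perm5 1 0 2 0 0)"
      using P by (simp add: S)
    then show ?thesis by (rule nf_labels_lift[OF F r3 p _ all(1), of _ _ _ 2 0 1]) simp_all
  next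
    assume "\<not> b 0 4 = 0 \<and> b 1 4 = 0 \<and> b 2 4 = 0 \<and> b 0 1 = 0 \<and> \<not> b 0 2 = 0 \<and> \<not> b 0 3 = 0"
    then have "nf_labels b (perm5 1 0 0 2 0) (perm5 1 1 2 2 0) (perm5 2 0 1 0 0)"
      using P by (simp add: S)
    then show ?thesis by (rule nf_labels_lift[OF F r3 p _ all(4), of _ _ _ 1 2 0]) simp_all
  next
    assume "(b 0 1 = 0 \<or> b 0 2 = 0 \<or> b 0 3 = 0) \<and> \<not> (b 0 1 = 0 \<and> b 0 2 = 0 \<and> b 0 3 = 0) \<and> b 1 4 = 0 \<and> b 2 4 = 0 \<and>
      (\<forall>l\<in>{1,2,3}. \<not> b 1 l = 0 \<and> \<not> b 2 l = 0 \<and> (b 0 l = 0 \<or> b 4 l = 0))"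
    then have "nf_labels b (perm5 0 1 1 2 2) (?L 0 1) (perm5 1 0 2 0 0)"
      using P by (cases "b 0 1 = 0"; cases "b 0 2 = 0"; cases "b 0 3 = 0"; simp add: S)
    then show ?thesis by (rule nf_labels_lift[OF F r3 p _ all(3), of _ _ _ 1 2 0]) simp_all
  next
    assume "(b 1 1 = 0 \<or> b 1 2 = 0 \<or> b 1 3 = 0) \<and> \<not> (b 1 1 = 0 \<and> b 1 2 = 0 \<and> b 1 3 = 0) \<and> b 0 4 = 0 \<and>
      (\<forall>l\<in>{1,2,3}. \<not> b 0 l = 0 \<and> (b 1 l = 0 \<longleftrightarrow> b 2 l = 0) \<and> (b 1 l = 0 \<or> b 4 l = 0))"
    then have "nf_labels b (perm5 1 0 0 2 2) (?L 1 1) (perm5 1 0 2 0 0)"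
      using P by (cases "b 1 1 = 0"; cases "b 1 2 = 0"; cases "b 1 3 = 0"; simp add: S)
    then show ?thesis by (rule nf_labels_lift[OF F r3 p _ all(3), of _ _ _ 0 2 1]) simp_all
  next
    assume "\<not> (b 1 1 = 0 \<and> b 1 2 = 0 \<and> b 1 3 = 0) \<and> \<not> b 0 4 = 0 \<and> b 1 4 = 0 \<and> b 2 4 = 0 \<and>
      (\<forall>l\<in>{1,2,3}. \<not> b 0 l = 0 \<and> (b 1 l = 0 \<longleftrightarrow> b 2 l = 0) \<and> (b 1 l = 0 \<or> b 4 l = 0))"
    then have "nf_labels b (perm5 1 0 0 2 2) (?L 1 0) (perm5 1 0 2 0 0)"
      using P by (cases "b 1 1 = 0"; cases "b 1 2 = 0"; cases "b 1 3 = 0"; simp add: S)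
    then show ?thesis by (rule nf_labels_lift[OF F r3 p _ all(3), of _ _ _ 0 2 1]) simp_all
  next
    assume "\<not> b 0 4 = 0 \<and> b 1 4 = 0 \<and> b 2 4 = 0 \<and> \<not> b 4 1 = 0 \<and> b 4 2 = 0 \<and> b 4 3 = 0 \<and>
      \<not> b 0 1 = 0 \<and> \<not> b 0 2 = 0 \<and> \<not> b 0 3 = 0 \<and>
      \<not> b 1 1 = 0 \<and> b 1 2 = 0 \<and> b 1 3 = 0 \<and> \<not> b 2 1 = 0 \<and> b 2 2 = 0 \<and> b 2 3 = 0"
    then have "nf_labels b (perm5 1 0 0 2 0) (perm5 1 2 0 0 0) (perm5 1 0 2 0 0)"
      using P by (simp add: S)
    from nf_labels_nf[OF p this] obtain x y where N: "nf b (perm5 1 0 0 2 0) (perm5 1 2 0 0 0) x y" by blast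
    show ?thesis by (rule nf_lift_311[OF N all(6) all(5), of 0 1 2]) simp_all
  next
    assume "\<not> b 0 4 = 0 \<and> \<not> b 1 4 = 0 \<and> \<not> b 2 4 = 0 \<and> \<not> (b 1 1 = 0 \<and> b 1 2 = 0 \<and> b 1 3 = 0) \<and>
      (\<forall>l\<in>{1,2,3}. \<not> b 4 l = 0 \<and> (b 1 l = 0 \<longleftrightarrow> b 2 l = 0) \<and> (b 1 l = 0 \<or> b 0 l = 0))"
    then have "nf_labels b (perm5 1 0 0 1 2) (perm5 0 (if b 1 1 = 0 then 0 else 1) (if b 1 2 = 0 then 0 else 1) (if b 1 3 = 0 then 0 else 1) 2)
       (perm5 0 1 2 0 0)"
      using P by (cases "b 1 1 = 0"; cases "b 1 2 = 0"; cases "b 1 3 = 0"; simp add: S)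
    then show ?thesis by (rule nf_labels_lift[OF F r3 p _ all(2), of _ _ _ 1 0 2]) simp_all
  qed
qed

lemma pat_perm:
  assumes "pat b" "{i0,i1,i2} = {..<3}" "{l1,l2,l3} = {1,2,3}"
  shows "pat (\<lambda>i j. b (perm5 i0 i1 i2 3 4 i) (perm5 0 l1 l2 l3 4 j))"
proof -
  have i: "i0 < 3" "i1 < 3" "i2 < 3" using assms(2) by auto
  have l: "l1 \<in> {1,2,3}" "l2 \<in> {1,2,3}" "l3 \<in> {1,2,3}" using assms(3) by blast+
  note P = assms(1)[unfolded pat_def]
  have z0: "b i 0 = 0" if "i < 3" for i using less_3_cases[OF that] P by auto
  have z3: "b 3 l = 0" if "l \<in> {1,2,3}" for l using that P by auto
  have A: "{i0,i1,i2,3,4} = {..<5}"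
  proof -
    have "{i0,i1,i2,3,4} = {i0,i1,i2} \<union> {3,4}" by auto
    also have "\<dots> = {..<5}" by (subst assms(2)) auto
    finally show ?thesis .
  qed
  have B: "{0,l1,l2,l3,4} = {..<5}"
  proof -
    have "{0,l1,l2,l3,4} = {l1,l2,l3} \<union> {0,4}" by auto
    also have "\<dots> = {..<5}" by (subst assms(3)) auto
    finally show ?thesis .
  qed
  have "b (perm5 i0 i1 i2 3 4 i) (perm5 0 l1 l2 l3 4 j) \<ge> 0" if "i < 5" "j < 5" for i j
    using P perm5_in[OF A that(1)] perm5_in[OF B that(2)] by blast
  then show ?thesis unfolding pat_def perm5_simps perm5_1
    using z0[OF i(1)] z0[OF i(2)] z0[OF i(3)] z3[OF l(1)] z3[OF l(2)] z3[OF l(3)] P by blast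
qed

text \<open>Transposition, with rows and columns renumbered so that the zero blocks keep their places.\<close>

definition flip :: "(nat \<Rightarrow> nat \<Rightarrow> 'b) \<Rightarrow> nat \<Rightarrow> nat \<Rightarrow> 'b" where
  "flip b = (\<lambda>i j. b (perm5 3 0 1 2 4 j) (perm5 1 2 3 0 4 i))"

lemma flip_perms: "{3,0,1,2,4} = {..<5::nat}" "{1,2,3,0,4} = {..<5::nat}"
  by auto

lemma rank3_flip: "rank3 b \<Longrightarrow> rank3 (flip b)"
  unfolding flip_def by (rule rank3_transpose[OF rank3_perm5[OF _ flip_perms]])

lemma lift3_flip: "lift3 TYPE('a::field) (flip b) \<Longrightarrow> lift3 TYPE('a) b"
  unfolding flip_def by (rule lift3_perm5[OF lift3_transpose flip_perms])

lemma pat_flip: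
  assumes "pat b"
  shows "pat (flip b)"
proof -
  note P = assms[unfolded pat_def]
  have "flip b i j \<ge> 0" if "i < 5" "j < 5" for i j
    using P perm5_in[OF flip_perms(1) that(2)] perm5_in[OF flip_perms(2) that(1)] unfolding flip_def by blast
  then show ?thesis unfolding pat_def using P unfolding flip_def by (simp add: numeral_eq_Suc[symmetric])
qed

definition two_of :: "bool \<Rightarrow> bool \<Rightarrow> bool \<Rightarrow> bool \<Rightarrow> bool" where
  "two_of p q r s \<longleftrightarrow> p \<and> q \<or> p \<and> r \<or> p \<and> s \<or> q \<and> r \<or> q \<and> s \<or> r \<and> s"

text \<open>Column 0 already has three zeros, columns 1 to 3 have one in row 3 and column 4 has one
  in row 4. Two more in each of these give the hypothesis of \<open>star_lift\<close>.\<close>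

definition starz :: "(nat \<Rightarrow> nat \<Rightarrow> bool) \<Rightarrow> bool" where
  "starz z \<longleftrightarrow> two_of (z 0 4) (z 1 4) (z 2 4) False \<and> two_of (z 0 1) (z 1 1) (z 2 1) (z 4 1) \<and>
    two_of (z 0 2) (z 1 2) (z 2 2) (z 4 2) \<and> two_of (z 0 3) (z 1 3) (z 2 3) (z 4 3)"

text \<open>Patterns with a triangular 4 by 4 minor of zeros, hence incompatible with
  \<open>rank3\<close>.\<close>

definition triz :: "(nat \<Rightarrow> nat \<Rightarrow> bool) \<Rightarrow> bool" where
  "triz z \<longleftrightarrow> 
    \<not> z 0 3 \<and> \<not> z 1 3 \<and> \<not> z 2 3 \<and> z 0 1 \<and> z 1 2 \<and> \<not> z 0 2 \<and> \<not> z 2 1 \<and> \<not> z 2 2 \<or>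
    \<not> z 0 3 \<and> \<not> z 1 3 \<and> \<not> z 2 3 \<and> z 1 1 \<and> \<not> z 0 1 \<and> \<not> z 2 1 \<and> z 0 4 \<and> \<not> z 2 4 \<or>
    z 0 4 \<and> \<not> z 2 4 \<and> z 4 2 \<and> \<not> z 4 1 \<and> \<not> z 0 1 \<and> \<not> z 2 1 \<and> \<not> z 0 2 \<and> \<not> z 2 2 \<or>
    \<not> z 0 4 \<and> \<not> z 1 4 \<and> \<not> z 2 4 \<and> \<not> z 4 1 \<and> \<not> z 4 2 \<and> \<not> z 4 3 \<and> z 0 1 \<and> \<not> z 0 2 \<and> \<not> z 1 1 \<and> \<not> z 1 2"

lemma tri_zero:
  assumes r3: "rank3 b" and p: "pat b" and d: "distinct [r0,r1,r2,r3]" "distinct [c0,c1,c2,c3]" "{r0,r1,r2,r3,c0,c1,c2,c3} \<subseteq> {..<5}"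
    and z: "b r0 c0 = 0" "b r1 c1 = 0" "b r2 c2 = 0" "b r3 c3 = 0"
    and n: "b r1 c0 \<noteq> 0" "b r2 c0 \<noteq> 0" "b r3 c0 \<noteq> 0" "b r2 c1 \<noteq> 0" "b r3 c1 \<noteq> 0" "b r3 c2 \<noteq> 0"
  shows False
proof -
  have l: "r0 < 5" "r1 < 5" "r2 < 5" "r3 < 5" "c0 < 5" "c1 < 5" "c2 < 5" "c3 < 5" using d(3) by simp_all
  have ge: "b i j \<ge> 0" if "i < 5" "j < 5" for i j using p that unfolding pat_def by blast
  have gt: "b i j > 0 + 0" if "b i j \<noteq> 0" "i < 5" "j < 5" for i j using ge[OF that(2,3)] that(1) by simp
  have ge': "b i j \<ge> 0 + 0" if "i < 5" "j < 5" for i j using ge[OF that] by simp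
  show False
    by (rule tri_contra[OF r3 d, of "\<lambda>_. 0" "\<lambda>_. 0"])
      ((simp only: z add_0; fail) | (rule gt, rule n; rule l) | (rule ge'; rule l))+
qed

lemma triz_False:
  assumes r3: "rank3 b" and p: "pat b" and t: "triz (\<lambda>i j. b i j = 0)"
  shows False
proof -
  note P = p[unfolded pat_def, THEN conjunct2]
  show False
    using t unfolding triz_def
  proof (elim disjE conjE, goal_cases)
    case 1 then show ?case by (intro tri_zero[OF r3 p, of 3 1 0 2 3 2 1 0]) (use P in simp_all)
  next
    case 2 then show ?case by (intro tri_zero[OF r3 p, of 3 1 0 2 3 1 4 0]) (use P in simp_all)
  next
    case 3 then show ?case by (intro tri_zero[OF r3 p, of 3 4 0 2 1 2 4 0]) (use P in simp_all)
  next
    case 4 then show ?case by (intro tri_zero[OF r3 p, of 4 3 0 1 4 2 1 0]) (use P in simp_all)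
  qed
qed

lemma starz_lift:
  assumes F: "infinite (UNIV :: 'a::field set) \<or> card (UNIV :: 'a set) \<ge> 4"
    and p: "pat b" and s: "starz (\<lambda>i j. b i j = 0)"
  shows "lift3 TYPE('a) b"
proof (rule star_lift[OF F])
  note P = p[unfolded pat_def]
  show "b i j \<ge> 0" if "i < 5" "j < 5" for i j using P that by blast
  fix j :: nat assume "j < 5"
  have c: "card {i. i < 5 \<and> b i j = 0} \<ge> 3" if "distinct [p,q,r]" "p < 5" "q < 5" "r < 5" "b p j = 0" "b q j = 0" "b r j = 0" for p q r
  proof -
    have "card {p,q,r} \<le> card {i. i < 5 \<and> b i j = 0}" by (rule card_mono) (use that in auto)
    then show ?thesis using that(1) by simp
  qed
  have two: "card {i. i < 5 \<and> b i j = 0} \<ge> 3" if "two_of (b 0 j = 0) (b 1 j = 0) (b 2 j = 0) (v < 5 \<and> v \<noteq> w \<and> 3 \<le> v \<and> b v j = 0)"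
    "w = 3 \<or> w = 4" "b w j = 0" for v w
    using that(1) unfolding two_of_def
    by (elim disjE) (use that(2,3) c[of 0 1 w] c[of 0 2 w] c[of 1 2 w] c[of 0 v w] c[of 1 v w] c[of 2 v w] in auto)
  from \<open>j < 5\<close> consider "j = 0" | "j = 4" | "j = 1" | "j = 2" | "j = 3" unfolding less_5_cases by blast
  then show "card {i. i < 5 \<and> b i j = 0} \<ge> 3"
  proof cases
    case 1 then show ?thesis using c[of 0 1 2] P by simp
  next
    case 2 then show ?thesis using two[of 4 4] s P unfolding starz_def by simp
  next
    case 3 then show ?thesis using two[of 4 3] s P unfolding starz_def by simp
  next
    case 4 then show ?thesis using two[of 4 3] s P unfolding starz_def by simp
  next
    case 5 then show ?thesis using two[of 4 3] s P unfolding starz_def by simp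
  qed
qed

definition S3 :: "(nat \<times> nat \<times> nat) set" where
  "S3 = {(0,1,2),(0,2,1),(1,0,2),(1,2,0),(2,0,1),(2,1,0)}"

definition S3' :: "(nat \<times> nat \<times> nat) set" where
  "S3' = {(1,2,3),(1,3,2),(2,1,3),(2,3,1),(3,1,2),(3,2,1)}"

text \<open>Rows 0 to 2 and columns 1 to 3 may be renumbered freely; \<open>starz\<close> is
  invariant under this and is asked for once.\<close>

definition good :: "(nat \<Rightarrow> nat \<Rightarrow> bool) \<Rightarrow> bool" where
  "good z \<longleftrightarrow> (\<exists>i0 i1 i2 l1 l2 l3. (i0,i1,i2) \<in> S3 \<and> (l1,l2,l3) \<in> S3' \<and>
      (nfmove (\<lambda>i j. z (perm5 i0 i1 i2 3 4 i) (perm5 0 l1 l2 l3 4 j)) \<or>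
       triz (\<lambda>i j. z (perm5 i0 i1 i2 3 4 i) (perm5 0 l1 l2 l3 4 j)))) \<or> starz z"

lemma good_lift:
  assumes F: "infinite (UNIV :: 'a::field set) \<or> card (UNIV :: 'a set) \<ge> 4"
    and r3: "rank3 b" and p: "pat b" and g: "good (\<lambda>i j. b i j = 0)"
  shows "lift3 TYPE('a) b"
proof (rule ccontr)
  assume nl: "\<not> lift3 TYPE('a) b"
  let ?b = "\<lambda>i0 i1 i2 l1 l2 l3 i j. b (perm5 i0 i1 i2 3 4 i) (perm5 0 l1 l2 l3 4 j)"
  have "\<not> (nfmove (\<lambda>i j. ?b i0 i1 i2 l1 l2 l3 i j = 0) \<or> triz (\<lambda>i j. ?b i0 i1 i2 l1 l2 l3 i j = 0))"
    if i: "(i0,i1,i2) \<in> S3" and l: "(l1,l2,l3) \<in> S3'" for i0 i1 i2 l1 l2 l3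
  proof
    assume n: "nfmove (\<lambda>i j. ?b i0 i1 i2 l1 l2 l3 i j = 0) \<or> triz (\<lambda>i j. ?b i0 i1 i2 l1 l2 l3 i j = 0)"
    have I: "{i0,i1,i2} = {..<3}" "{i0,i1,i2,3,4} = {..<5}" using i unfolding S3_def by auto
    have L: "{l1,l2,l3} = {1,2,3}" "{0,l1,l2,l3,4} = {..<5}" using l unfolding S3'_def by auto
    have r: "rank3 (?b i0 i1 i2 l1 l2 l3)" by (rule rank3_perm5[OF r3 I(2) L(2)])
    have q: "pat (?b i0 i1 i2 l1 l2 l3)" by (rule pat_perm[OF p I(1) L(1)])
    have "lift3 TYPE('a) (?b i0 i1 i2 l1 l2 l3)" using n nfmove_lift[OF F r q] triz_False[OF r q] by (elim disjE) simp_all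
    from lift3_perm5[OF this I(2) L(2)] nl show False by simp
  qed
  moreover have "\<not> starz (\<lambda>i j. b i j = 0)" using starz_lift[OF F p] nl by (rule contrapos_nn[rotated])
  ultimately have "\<not> good (\<lambda>i j. b i j = 0)" unfolding good_def by blast
  with g show False by simp
qed

lemma not_goodD:
  assumes "\<not> good z" "(i0,i1,i2) \<in> S3" "(l1,l2,l3) \<in> S3'"
  shows "\<not> (z i0 4 \<and> \<not> z i1 4 \<and> \<not> z i2 4)"
    "\<not> (\<not> z i0 4 \<and> z i1 4 \<and> z i2 4 \<and> z i0 l1 \<and> \<not> z i0 l2 \<and> \<not> z i0 l3)"
    "\<not> ((z i0 l1 \<or> z i0 l2 \<or> z i0 l3) \<and> \<not> (z i0 l1 \<and> z i0 l2 \<and> z i0 l3) \<and> z i1 4 \<and> z i2 4 \<and>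
      (\<forall>l\<in>{l1,l2,l3}. \<not> z i1 l \<and> \<not> z i2 l \<and> (z i0 l \<or> z 4 l)))"
    "\<not> ((z i1 l1 \<or> z i1 l2 \<or> z i1 l3) \<and> \<not> (z i1 l1 \<and> z i1 l2 \<and> z i1 l3) \<and> z i0 4 \<and>
      (\<forall>l\<in>{l1,l2,l3}. \<not> z i0 l \<and> (z i1 l \<longleftrightarrow> z i2 l) \<and> (z i1 l \<or> z 4 l)))"
    "\<not> (\<not> (z i1 l1 \<and> z i1 l2 \<and> z i1 l3) \<and> \<not> z i0 4 \<and> z i1 4 \<and> z i2 4 \<and>
      (\<forall>l\<in>{l1,l2,l3}. \<not> z i0 l \<and> (z i1 l \<longleftrightarrow> z i2 l) \<and> (z i1 l \<or> z 4 l)))"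
    "\<not> (\<not> z i0 4 \<and> z i1 4 \<and> z i2 4 \<and> \<not> z 4 l1 \<and> z 4 l2 \<and> z 4 l3 \<and> \<not> z i0 l1 \<and> \<not> z i0 l2 \<and> \<not> z i0 l3 \<and>
      \<not> z i1 l1 \<and> z i1 l2 \<and> z i1 l3 \<and> \<not> z i2 l1 \<and> z i2 l2 \<and> z i2 l3)"
    "\<not> (\<not> z i0 4 \<and> \<not> z i1 4 \<and> \<not> z i2 4 \<and> \<not> (z i1 l1 \<and> z i1 l2 \<and> z i1 l3) \<and>
      (\<forall>l\<in>{l1,l2,l3}. \<not> z 4 l \<and> (z i1 l \<longleftrightarrow> z i2 l) \<and> (z i1 l \<or> z i0 l)))"
    "\<not> (\<not> z i0 l3 \<and> \<not> z i1 l3 \<and> \<not> z i2 l3 \<and> z i0 l1 \<and> z i1 l2 \<and> \<not> z i0 l2 \<and> \<not> z i2 l1 \<and> \<not> z i2 l2)"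
    "\<not> (\<not> z i0 l3 \<and> \<not> z i1 l3 \<and> \<not> z i2 l3 \<and> z i1 l1 \<and> \<not> z i0 l1 \<and> \<not> z i2 l1 \<and> z i0 4 \<and> \<not> z i2 4)"
    "\<not> (z i0 4 \<and> \<not> z i2 4 \<and> z 4 l2 \<and> \<not> z 4 l1 \<and> \<not> z i0 l1 \<and> \<not> z i2 l1 \<and> \<not> z i0 l2 \<and> \<not> z i2 l2)"
    "\<not> (\<not> z i0 4 \<and> \<not> z i1 4 \<and> \<not> z i2 4 \<and> \<not> z 4 l1 \<and> \<not> z 4 l2 \<and> \<not> z 4 l3 \<and> z i0 l1 \<and> \<not> z i0 l2 \<and> \<not> z i1 l1 \<and> \<not> z i1 l2)"
    "\<not> starz z"
proof -
  let ?z = "\<lambda>i j. z (perm5 i0 i1 i2 3 4 i) (perm5 0 l1 l2 l3 4 j)"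
  have N: "\<not> nfmove ?z" "\<not> triz ?z" and "\<not> starz z"
    using assms unfolding good_def by blast+
  note N' = N[unfolded nfmove_def triz_def ball_simps perm5_simps perm5_1 de_Morgan_disj]
  show "\<not> starz z" by fact
  note A = N'(1)[THEN conjunct1] N'(1)[THEN conjunct2, THEN conjunct1]
  note B = N'(1)[THEN conjunct2, THEN conjunct2]
  note C = N'(2)
  show "\<not> (z i0 4 \<and> \<not> z i1 4 \<and> \<not> z i2 4)" by (rule A(1))
  show "\<not> (\<not> z i0 4 \<and> z i1 4 \<and> z i2 4 \<and> z i0 l1 \<and> \<not> z i0 l2 \<and> \<not> z i0 l3)" by (rule A(2))
  show "\<not> ((z i0 l1 \<or> z i0 l2 \<or> z i0 l3) \<and> \<not> (z i0 l1 \<and> z i0 l2 \<and> z i0 l3) \<and> z i1 4 \<and> z i2 4 \<and>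
      (\<forall>l\<in>{l1,l2,l3}. \<not> z i1 l \<and> \<not> z i2 l \<and> (z i0 l \<or> z 4 l)))" unfolding ball_simps by (rule B[THEN conjunct1])
  show "\<not> ((z i1 l1 \<or> z i1 l2 \<or> z i1 l3) \<and> \<not> (z i1 l1 \<and> z i1 l2 \<and> z i1 l3) \<and> z i0 4 \<and>
      (\<forall>l\<in>{l1,l2,l3}. \<not> z i0 l \<and> (z i1 l \<longleftrightarrow> z i2 l) \<and> (z i1 l \<or> z 4 l)))" unfolding ball_simps by (rule B[THEN conjunct2, THEN conjunct1])
  show "\<not> (\<not> (z i1 l1 \<and> z i1 l2 \<and> z i1 l3) \<and> \<not> z i0 4 \<and> z i1 4 \<and> z i2 4 \<and>
      (\<forall>l\<in>{l1,l2,l3}. \<not> z i0 l \<and> (z i1 l \<longleftrightarrow> z i2 l) \<and> (z i1 l \<or> z 4 l)))" unfolding ball_simps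
    by (rule B[THEN conjunct2, THEN conjunct2, THEN conjunct1])
  show "\<not> (\<not> z i0 4 \<and> z i1 4 \<and> z i2 4 \<and> \<not> z 4 l1 \<and> z 4 l2 \<and> z 4 l3 \<and> \<not> z i0 l1 \<and> \<not> z i0 l2 \<and> \<not> z i0 l3 \<and>
      \<not> z i1 l1 \<and> z i1 l2 \<and> z i1 l3 \<and> \<not> z i2 l1 \<and> z i2 l2 \<and> z i2 l3)"
    by (rule B[THEN conjunct2, THEN conjunct2, THEN conjunct2, THEN conjunct1])
  show "\<not> (\<not> z i0 4 \<and> \<not> z i1 4 \<and> \<not> z i2 4 \<and> \<not> (z i1 l1 \<and> z i1 l2 \<and> z i1 l3) \<and>
      (\<forall>l\<in>{l1,l2,l3}. \<not> z 4 l \<and> (z i1 l \<longleftrightarrow> z i2 l) \<and> (z i1 l \<or> z i0 l)))" unfolding ball_simps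
    by (rule B[THEN conjunct2, THEN conjunct2, THEN conjunct2, THEN conjunct2])
  show "\<not> (\<not> z i0 l3 \<and> \<not> z i1 l3 \<and> \<not> z i2 l3 \<and> z i0 l1 \<and> z i1 l2 \<and> \<not> z i0 l2 \<and> \<not> z i2 l1 \<and> \<not> z i2 l2)"
    by (rule C[THEN conjunct1])
  show "\<not> (\<not> z i0 l3 \<and> \<not> z i1 l3 \<and> \<not> z i2 l3 \<and> z i1 l1 \<and> \<not> z i0 l1 \<and> \<not> z i2 l1 \<and> z i0 4 \<and> \<not> z i2 4)"
    by (rule C[THEN conjunct2, THEN conjunct1])
  show "\<not> (z i0 4 \<and> \<not> z i2 4 \<and> z 4 l2 \<and> \<not> z 4 l1 \<and> \<not> z i0 l1 \<and> \<not> z i2 l1 \<and> \<not> z i0 l2 \<and> \<not> z i2 l2)"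
    by (rule C[THEN conjunct2, THEN conjunct2, THEN conjunct1])
  show "\<not> (\<not> z i0 4 \<and> \<not> z i1 4 \<and> \<not> z i2 4 \<and> \<not> z 4 l1 \<and> \<not> z 4 l2 \<and> \<not> z 4 l3 \<and> z i0 l1 \<and> \<not> z i0 l2 \<and> \<not> z i1 l1 \<and> \<not> z i1 l2)"
    by (rule C[THEN conjunct2, THEN conjunct2, THEN conjunct2])
qed

text \<open>Propositional consequences of \<open>\<not> good z\<close> for patterns with a zero in
  column 4 above row 3. Conditions symmetric in \<open>i1\<close> and \<open>i2\<close>, or in the
  columns, are instantiated at cyclic permutations only, which keeps the formula small for the
  solver.\<close>

definition goodfree :: "(nat \<Rightarrow> nat \<Rightarrow> bool) \<Rightarrow> bool" where
  "goodfree z \<longleftrightarrow> \<not> starz z \<and>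
   (\<forall>(i0,i1,i2)\<in>{(0,1,2),(1,2,0),(2,0,1)}. \<not> (z i0 4 \<and> \<not> z i1 4 \<and> \<not> z i2 4) \<and>
     \<not> ((z i0 1 \<or> z i0 2 \<or> z i0 3) \<and> \<not> (z i0 1 \<and> z i0 2 \<and> z i0 3) \<and> z i1 4 \<and> z i2 4 \<and>
      (\<forall>l\<in>{1,2,3}. \<not> z i1 l \<and> \<not> z i2 l \<and> (z i0 l \<or> z 4 l))) \<and>
     \<not> ((z i1 1 \<or> z i1 2 \<or> z i1 3) \<and> \<not> (z i1 1 \<and> z i1 2 \<and> z i1 3) \<and> z i0 4 \<and>
      (\<forall>l\<in>{1,2,3}. \<not> z i0 l \<and> (z i1 l \<longleftrightarrow> z i2 l) \<and> (z i1 l \<or> z 4 l))) \<and>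
     \<not> (\<not> (z i1 1 \<and> z i1 2 \<and> z i1 3) \<and> \<not> z i0 4 \<and> z i1 4 \<and> z i2 4 \<and>
      (\<forall>l\<in>{1,2,3}. \<not> z i0 l \<and> (z i1 l \<longleftrightarrow> z i2 l) \<and> (z i1 l \<or> z 4 l))) \<and>
     (\<forall>(l1,l2,l3)\<in>{(1,2,3),(2,3,1),(3,1,2)}. 
       \<not> (\<not> z i0 4 \<and> z i1 4 \<and> z i2 4 \<and> z i0 l1 \<and> \<not> z i0 l2 \<and> \<not> z i0 l3) \<and>
       \<not> (\<not> z i0 4 \<and> z i1 4 \<and> z i2 4 \<and> \<not> z 4 l1 \<and> z 4 l2 \<and> z 4 l3 \<and> \<not> z i0 l1 \<and> \<not> z i0 l2 \<and> \<not> z i0 l3 \<and>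
         \<not> z i1 l1 \<and> z i1 l2 \<and> z i1 l3 \<and> \<not> z i2 l1 \<and> z i2 l2 \<and> z i2 l3))) \<and>
   (\<forall>(i0,i1,i2)\<in>S3. \<forall>(l1,l2,l3)\<in>S3'.
     \<not> (\<not> z i0 l3 \<and> \<not> z i1 l3 \<and> \<not> z i2 l3 \<and> z i0 l1 \<and> z i1 l2 \<and> \<not> z i0 l2 \<and> \<not> z i2 l1 \<and> \<not> z i2 l2) \<and>
     \<not> (\<not> z i0 l3 \<and> \<not> z i1 l3 \<and> \<not> z i2 l3 \<and> z i1 l1 \<and> \<not> z i0 l1 \<and> \<not> z i2 l1 \<and> z i0 4 \<and> \<not> z i2 4) \<and>
     \<not> (z i0 4 \<and> \<not> z i2 4 \<and> z 4 l2 \<and> \<not> z 4 l1 \<and> \<not> z i0 l1 \<and> \<not> z i2 l1 \<and> \<not> z i0 l2 \<and> \<not> z i2 l2))"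

lemma goodfree:
  assumes "\<not> good z"
  shows "goodfree z"
proof -
  have C: "(i0,i1,i2) \<in> S3" if "(i0,i1,i2) \<in> {(0,1,2),(1,2,0),(2,0,1)}" for i0 i1 i2 using that unfolding S3_def by blast
  have D: "(i0,i1,i2) \<in> S3'" if "(i0,i1,i2) \<in> {(1,2,3),(2,3,1),(3,1,2)}" for i0 i1 i2 using that unfolding S3'_def by blast
  have E: "(1,2,3) \<in> S3'" unfolding S3'_def by blast
  show ?thesis unfolding goodfree_def
    by (intro conjI ballI case_prodI2; (simp only:)?; (rule not_goodD[OF assms C E] not_goodD[OF assms C D] not_goodD[OF assms]; assumption)?)
      (use assms in \<open>unfold good_def, blast\<close>)?
qed

text \<open>A finite check over the fifteen open entries. The excluded pattern has all zeros in
  column 4 and row 4 and none in the block; it is invariant under \<open>flip\<close> and belongs to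
  \<open>type4_star\<close>.\<close>

lemma good_cases_equal:
  assumes "z 0 4 \<or> z 1 4 \<or> z 2 4" "z 4 1 \<or> z 4 2 \<or> z 4 3"
    "\<not> (z 0 4 \<and> z 1 4 \<and> z 2 4 \<and> z 4 1 \<and> z 4 2 \<and> z 4 3 \<and> (\<forall>i\<in>{0,1,2}. \<forall>l\<in>{1,2,3}. \<not> z i l))"
  shows "good z \<or> good (flip z)"
proof (rule ccontr)
  assume "\<not> (good z \<or> good (flip z))"
  then have "goodfree z" "goodfree (flip z)" using goodfree by blast+
  then show False
    using assms unfolding goodfree_def S3_def S3'_def starz_def two_of_def flip_def ball_simps case_prod_conv perm5_simps perm5_1
    by sat
qed

text \<open>Only the nine entries of the block are open. The excluded patterns have at least two
  zeros in each column, or in each row, of the block; they belong to \<open>type4_direct\<close>,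
  used directly or after transposition.\<close>

lemma good_cases_less:
  assumes "\<not> z 0 4 \<and> \<not> z 1 4 \<and> \<not> z 2 4 \<and> \<not> z 4 1 \<and> \<not> z 4 2 \<and> \<not> z 4 3" "\<exists>i\<in>{0,1,2}. \<exists>l\<in>{1,2,3}. z i l"
    "\<not> (two_of (z 0 1) (z 1 1) (z 2 1) False \<and> two_of (z 0 2) (z 1 2) (z 2 2) False \<and> two_of (z 0 3) (z 1 3) (z 2 3) False)"
    "\<not> (two_of (z 0 1) (z 0 2) (z 0 3) False \<and> two_of (z 1 1) (z 1 2) (z 1 3) False \<and> two_of (z 2 1) (z 2 2) (z 2 3) False)"
  shows "good z \<or> good (flip z)"
proof (rule ccontr)
  assume n: "\<not> (good z \<or> good (flip z))"
  then have n1: "\<not> good z" and n2: "\<not> good (flip z)" by simp_all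
  have 0: "\<not> z 0 4" "\<not> z 1 4" "\<not> z 2 4" "\<not> z 4 1" "\<not> z 4 2" "\<not> z 4 3" using assms(1) by blast+
  have C: "(i0,i1,i2) \<in> S3" if "(i0,i1,i2) \<in> {(0,1,2),(1,2,0),(2,0,1)}" for i0 i1 i2 using that unfolding S3_def by blast
  have E: "(1,2,3) \<in> S3'" unfolding S3'_def by blast
  have A: "\<not> (\<not> (z i1 1 \<and> z i1 2 \<and> z i1 3) \<and> (\<forall>l\<in>{1,2,3}. (z i1 l \<longleftrightarrow> z i2 l) \<and> (z i1 l \<or> z i0 l)))"
    "\<not> (\<not> (flip z i1 1 \<and> flip z i1 2 \<and> flip z i1 3) \<and> (\<forall>l\<in>{1,2,3}. (flip z i1 l \<longleftrightarrow> flip z i2 l) \<and> (flip z i1 l \<or> flip z i0 l)))"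
    if "(i0,i1,i2) \<in> {(0,1,2),(1,2,0),(2,0,1)}" for i0 i1 i2
  proof -
    have m: "\<not> z i0 4" "\<not> z i1 4" "\<not> z i2 4" "\<forall>l\<in>{1,2,3}. \<not> z 4 l" using that 0 by auto
    have m': "\<not> flip z i0 4" "\<not> flip z i1 4" "\<not> flip z i2 4" "\<forall>l\<in>{1,2,3}. \<not> flip z 4 l"
      using that 0 by (auto simp: flip_def)
    show "\<not> (\<not> (z i1 1 \<and> z i1 2 \<and> z i1 3) \<and> (\<forall>l\<in>{1,2,3}. (z i1 l \<longleftrightarrow> z i2 l) \<and> (z i1 l \<or> z i0 l)))"
      using not_goodD(7)[OF n1 C[OF that] E] m by blast
    show "\<not> (\<not> (flip z i1 1 \<and> flip z i1 2 \<and> flip z i1 3) \<and> (\<forall>l\<in>{1,2,3}. (flip z i1 l \<longleftrightarrow> flip z i2 l) \<and> (flip z i1 l \<or> flip z i0 l)))"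
      using not_goodD(7)[OF n2 C[OF that] E] m' by blast
  qed
  have B: "\<not> (z i0 l1 \<and> \<not> z i0 l2 \<and> \<not> z i1 l1 \<and> \<not> z i1 l2)" if "(i0,i1,i2) \<in> S3" "(l1,l2,l3) \<in> S3'" for i0 i1 i2 l1 l2 l3
  proof -
    have "\<not> z i0 4" "\<not> z i1 4" "\<not> z i2 4" using that(1) 0 unfolding S3_def by auto
    moreover have "\<not> z 4 l1" "\<not> z 4 l2" "\<not> z 4 l3" using that(2) 0 unfolding S3'_def by auto
    ultimately show ?thesis using not_goodD(11)[OF n1 that] by blast
  qed
  have A': "\<forall>(i0,i1,i2)\<in>{(0,1,2),(1,2,0),(2,0,1)}. 
      \<not> (\<not> (z i1 1 \<and> z i1 2 \<and> z i1 3) \<and> (\<forall>l\<in>{1,2,3}. (z i1 l \<longleftrightarrow> z i2 l) \<and> (z i1 l \<or> z i0 l))) \<and>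
      \<not> (\<not> (flip z i1 1 \<and> flip z i1 2 \<and> flip z i1 3) \<and> (\<forall>l\<in>{1,2,3}. (flip z i1 l \<longleftrightarrow> flip z i2 l) \<and> (flip z i1 l \<or> flip z i0 l)))"
    by (intro conjI ballI case_prodI2; simp only:; rule A; assumption)
  have B': "\<forall>(i0,i1,i2)\<in>S3. \<forall>(l1,l2,l3)\<in>S3'. \<not> (z i0 l1 \<and> \<not> z i0 l2 \<and> \<not> z i1 l1 \<and> \<not> z i1 l2)"
    by (intro ballI case_prodI2; simp only:; rule B; assumption)
  show False
    using assms(2-4) A' B'
    unfolding S3_def S3'_def starz_def two_of_def flip_def ball_simps bex_simps case_prod_conv perm5_simps perm5_1
    by sat
qed

lemma type4_flip: "type4 b \<Longrightarrow> type4 (flip b)"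
proof -
  assume "type4 b"
  note T = this[unfolded type4_def]
  have "flip b i 0 = 0 \<and> flip b i 4 > 0 \<and> (\<forall>l\<in>{1,2,3}. flip b i l > 0)" if "i < 3" for i
    using less_3_cases[OF that] by (elim disjE) (use T in \<open>simp_all add: flip_def\<close>)
  moreover have "(\<forall>l\<in>{1,2,3}. flip b 3 l = 0 \<and> flip b 4 l > 0) \<and> flip b 3 0 > 0 \<and> flip b 3 4 > 0 \<and> flip b 4 0 > 0 \<and> flip b 4 4 = 0"
    using T by (simp add: flip_def)
  ultimately show ?thesis unfolding type4_def by blast
qed

definition vec5 :: "'b \<Rightarrow> 'b \<Rightarrow> 'b \<Rightarrow> 'b \<Rightarrow> 'b \<Rightarrow> nat \<Rightarrow> 'b" where
  "vec5 a0 a1 a2 a3 a4 = (\<lambda>i. if i = 0 then a0 else if i = 1 then a1 else if i = 2 then a2 else if i = 3 then a3 else a4)"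

lemma vec5_simps [simp]:
  "vec5 a0 a1 a2 a3 a4 0 = a0" "vec5 a0 a1 a2 a3 a4 1 = a1" "vec5 a0 a1 a2 a3 a4 (Suc 0) = a1" "vec5 a0 a1 a2 a3 a4 2 = a2"
  "vec5 a0 a1 a2 a3 a4 3 = a3" "vec5 a0 a1 a2 a3 a4 4 = a4"
  by (simp_all add: vec5_def)

text \<open>This scaling keeps the prescribed zeros and the other prescribed entries positive. It
  subtracts \<open>h\<close> from the block, \<open>k\<close> from the open entries of column 4 and
  \<open>h - k\<close> from those of row 4.\<close>

lemma pat_scaled:
  assumes "type4 b" and k: "0 < k" "k < h"
    and x: "\<And>i. i < 3 \<Longrightarrow> b i 4 \<ge> k" and q: "\<And>l. l \<in> {1,2,3} \<Longrightarrow> b 4 l \<ge> h - k"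
    and V: "\<And>i l. i < 3 \<Longrightarrow> l \<in> {1,2,3} \<Longrightarrow> b i l \<ge> h"
  shows "pat (\<lambda>i j. b i j - vec5 0 0 0 (-h) (-k) i - vec5 0 h h h k j)"
proof -
  note T = assms(1)[unfolded type4_def]
  have "b i 0 = 0" if "i < 3" for i using T that by blast
  then have "b 0 0 = 0" "b 1 0 = 0" "b 2 0 = 0" by simp_all
  moreover have "b 0 4 \<ge> k" "b 1 4 \<ge> k" "b 2 4 \<ge> k" by (rule x; simp)+
  moreover have "b 4 1 \<ge> h - k" "b 4 2 \<ge> h - k" "b 4 3 \<ge> h - k" by (rule q; simp)+
  moreover have "b 0 1 \<ge> h" "b 1 1 \<ge> h" "b 2 1 \<ge> h" "b 0 2 \<ge> h" "b 1 2 \<ge> h" "b 2 2 \<ge> h" "b 0 3 \<ge> h" "b 1 3 \<ge> h" "b 2 3 \<ge> h" 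
    by (rule V; simp)+
  moreover have "b 3 1 = 0" "b 3 2 = 0" "b 3 3 = 0" "b 3 0 > 0" "b 3 4 > 0" "b 4 0 > 0" "b 4 4 = 0" using T by simp_all
  ultimately show ?thesis unfolding pat_def all_less_5 vec5_simps using k by simp
qed

text \<open>The least entry of the block is compared with the sum of the least open entries of
  column 4 and row 4. If it is smaller, a scaling leaves zeros in the block only; otherwise column 4
  and row 4 both receive zeros.\<close>

lemma type4_lift:
  assumes F: "infinite (UNIV :: 'a::field set) \<or> card (UNIV :: 'a set) \<ge> 4"
    and r3: "rank3 b" and t4: "type4 b"
  shows "lift3 TYPE('a) b"
proof -
  note T = t4[unfolded type4_def]
  define vh where "vh = Min ((\<lambda>(i,l). b i l) ` ({0,1,2} \<times> {1,2,3}))"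
  define xh where "xh = Min ((\<lambda>i. b i 4) ` {0,1,2})"
  define qh where "qh = Min ((\<lambda>l. b 4 l) ` {1,2,3})"
  have I: "i \<in> {0,1,2}" if "i < 3" for i :: nat using less_3_cases[OF that] by auto
  have vle: "vh \<le> b i l" if "i < 3" "l \<in> {1,2,3}" for i l
    unfolding vh_def by (rule Min_le) (use I[OF that(1)] that(2) in \<open>auto intro!: image_eqI[of _ _ "(i,l)"]\<close>)
  have xle: "xh \<le> b i 4" if "i < 3" for i unfolding xh_def by (rule Min_le) (use I[OF that] in auto)
  have qle: "qh \<le> b 4 l" if "l \<in> {1,2,3}" for l unfolding qh_def by (rule Min_le) (use that in auto)
  have "vh \<in> (\<lambda>(i,l). b i l) ` ({0,1,2} \<times> {1,2,3})" unfolding vh_def by (rule Min_in) auto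
  then have vex: "\<exists>i\<in>{0,1,2}. \<exists>l\<in>{1,2,3}. b i l = vh" by fastforce
  have "xh \<in> (\<lambda>i. b i 4) ` {0,1,2}" unfolding xh_def by (rule Min_in) auto
  then have xex: "b 0 4 = xh \<or> b 1 4 = xh \<or> b 2 4 = xh" by auto
  have "qh \<in> (\<lambda>l. b 4 l) ` {1,2,3}" unfolding qh_def by (rule Min_in) auto
  then have qex: "b 4 1 = qh \<or> b 4 2 = qh \<or> b 4 3 = qh" by auto
  have v0: "vh > 0" using vex T by auto
  have x0: "xh > 0" using xex T by auto
  have q0: "qh > 0" using qex T by auto
  have fin: "lift3 TYPE('a) b" if p: "pat (\<lambda>i j. b i j - x i - y j)"
    and g: "good (\<lambda>i j. b i j - x i - y j = 0) \<or> good (flip (\<lambda>i j. b i j - x i - y j = 0))" for x y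
  proof -
    let ?B = "\<lambda>i j. b i j - x i - y j"
    have rB: "rank3 ?B" by (rule rank3_scaled[OF r3])
    have e: "flip (\<lambda>i j. b i j - x i - y j = 0) = (\<lambda>i j. flip ?B i j = 0)" by (simp add: flip_def)
    have "lift3 TYPE('a) ?B"
      using g unfolding e
      by (elim disjE) (rule good_lift[OF F rB p], assumption, rule lift3_flip, rule good_lift[OF F rank3_flip[OF rB] pat_flip[OF p]])
    then show ?thesis by (rule lift3_scaled)
  qed
  show ?thesis
  proof (cases "vh < xh + qh")
    case less: True
    have gt: "b i 4 + b 4 l > vh" if "i < 3" "l \<in> {1,2,3}" for i l using xle[OF that(1)] qle[OF that(2)] less by simp
    let ?e = "\<lambda>i l. b i l = vh"
    show ?thesis
    proof (cases "two_of (?e 0 1) (?e 1 1) (?e 2 1) False \<and> two_of (?e 0 2) (?e 1 2) (?e 2 2) False \<and> two_of (?e 0 3) (?e 1 3) (?e 2 3) False")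
      case True
      show ?thesis
      proof (rule type4_direct[OF F t4 v0 vle gt])
        fix i k l assume a: "i < 3" "k < 3" "l \<in> {1,2,3::nat}" "b i l > vh" "b k l > vh"
        have t: "two_of (?e 0 l) (?e 1 l) (?e 2 l) False" using True a(3) by auto
        show "i = k" using less_3_cases[OF a(1)] less_3_cases[OF a(2)] t a(4,5) unfolding two_of_def by auto
      qed
    next
      case c: False
      show ?thesis
      proof (cases "two_of (?e 0 1) (?e 0 2) (?e 0 3) False \<and> two_of (?e 1 1) (?e 1 2) (?e 1 3) False \<and> two_of (?e 2 1) (?e 2 2) (?e 2 3) False")
        case True
        let ?r = "perm5 3 0 1 2 4" and ?c = "perm5 1 2 3 0 4"
        have r: "?r l < 3" if "l \<in> {1,2,3}" for l using that by auto
        have cc: "?c i \<in> {1,2,3}" if "i < 3" for i using less_3_cases[OF that] by auto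
        have "lift3 TYPE('a) (flip b)"
        proof (rule type4_direct[OF F type4_flip[OF t4] v0])
          show "vh \<le> flip b i l" if "i < 3" "l \<in> {1,2,3}" for i l
            unfolding flip_def by (rule vle[OF r[OF that(2)] cc[OF that(1)]])
          show "vh < flip b i 4 + flip b 4 l" if "i < 3" "l \<in> {1,2,3}" for i l
            using gt[OF r[OF that(2)] cc[OF that(1)]] by (simp add: flip_def)
          fix i k l assume a: "i < 3" "k < 3" "l \<in> {1,2,3::nat}" "flip b i l > vh" "flip b k l > vh"
          have t: "two_of (flip b 0 l = vh) (flip b 1 l = vh) (flip b 2 l = vh) False"
            using True a(3) by (auto simp: flip_def)
          show "i = k" using less_3_cases[OF a(1)] less_3_cases[OF a(2)] t a(4,5) unfolding two_of_def by auto
        qed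
        then show ?thesis by (rule lift3_flip)
      next
        case d: False
        \<comment> \<open>These bounds keep the open entries of column 4 and row 4 positive;
          \<open>vh < xh + qh\<close> leaves room between them.\<close>
        obtain k where k: "max (vh - qh) 0 < k" "k < min xh vh"
          using dense[of "max (vh - qh) 0" "min xh vh"] less v0 x0 q0 by auto
        let ?B = "\<lambda>i j. b i j - vec5 0 0 0 (-vh) (-k) i - vec5 0 vh vh vh k j"
        have p: "pat ?B"
        proof (rule pat_scaled[OF t4])
          show "k \<le> b i 4" if "i < 3" for i using xle[OF that] k by simp
          show "vh - k \<le> b 4 l" if "l \<in> {1,2,3}" for l using qle[OF that] k by simp
        qed (use k vle in simp_all)
        have z: "(?B i l = 0) = (b i l = vh)" if "i < 3" "l \<in> {1,2,3}" for i l
          using less_3_cases[OF that(1)] that(2) by auto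
        have z1: "(?B 0 1 = 0) = ?e 0 1" "(?B 0 2 = 0) = ?e 0 2" "(?B 0 3 = 0) = ?e 0 3"
          "(?B 1 1 = 0) = ?e 1 1" "(?B 1 2 = 0) = ?e 1 2" "(?B 1 3 = 0) = ?e 1 3"
          "(?B 2 1 = 0) = ?e 2 1" "(?B 2 2 = 0) = ?e 2 2" "(?B 2 3 = 0) = ?e 2 3" by (rule z; simp)+
        have x4: "b 0 4 \<ge> xh" "b 1 4 \<ge> xh" "b 2 4 \<ge> xh" by (rule xle; simp)+
        have q4: "b 4 1 \<ge> qh" "b 4 2 \<ge> qh" "b 4 3 \<ge> qh" by (rule qle; simp)+
        have m: "?B 0 4 \<noteq> 0 \<and> ?B 1 4 \<noteq> 0 \<and> ?B 2 4 \<noteq> 0 \<and> ?B 4 1 \<noteq> 0 \<and> ?B 4 2 \<noteq> 0 \<and> ?B 4 3 \<noteq> 0"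
          using x4 q4 k by auto
        have ex: "\<exists>i\<in>{0,1,2}. \<exists>l\<in>{1,2,3}. ?B i l = 0" using vex by auto
        show ?thesis
          by (rule fin[OF p good_cases_less[OF m ex]]) (use c d in \<open>simp_all only: z1 not_False_eq_True\<close>)
      qed
    qed
  next
    case ge: False
    let ?h = "xh + qh"
    let ?B = "\<lambda>i j. b i j - vec5 0 0 0 (-?h) (-xh) i - vec5 0 ?h ?h ?h xh j"
    have p: "pat ?B"
    proof (rule pat_scaled[OF t4])
      show "xh \<le> b i 4" if "i < 3" for i using xle[OF that] .
      show "?h - xh \<le> b 4 l" if "l \<in> {1,2,3}" for l using qle[OF that] by simp
      show "?h \<le> b i l" if "i < 3" "l \<in> {1,2,3}" for i l using vle[OF that] ge by simp
    qed (use x0 q0 in simp_all)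
    show ?thesis
    proof (cases "?B 0 4 = 0 \<and> ?B 1 4 = 0 \<and> ?B 2 4 = 0 \<and> ?B 4 1 = 0 \<and> ?B 4 2 = 0 \<and> ?B 4 3 = 0 \<and> (\<forall>i\<in>{0,1,2}. \<forall>l\<in>{1,2,3}. ?B i l \<noteq> 0)")
      case True
      have x: "b i 4 = xh" if "i < 3" for i using less_3_cases[OF that] True by auto
      have q: "b 4 l = qh" if "l \<in> {1,2,3}" for l using that True by auto
      have V: "b i l > ?h" if "i < 3" "l \<in> {1,2,3}" for i l
      proof -
        have "?B i l \<noteq> 0" using True I[OF that(1)] that(2) by blast
        then have "b i l \<noteq> ?h" using less_3_cases[OF that(1)] that(2) by auto
        then show ?thesis using vle[OF that] ge by simp
      qed
      show ?thesis by (rule type4_star[OF F r3 t4 x q V])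
    next
      case False
      have "?B 0 4 = 0 \<or> ?B 1 4 = 0 \<or> ?B 2 4 = 0" using xex by auto
      moreover have "?B 4 1 = 0 \<or> ?B 4 2 = 0 \<or> ?B 4 3 = 0" using qex by auto
      ultimately show ?thesis by (intro fin[OF p] good_cases_equal False)
    qed
  qed
qed

section \<open>Existence of the normal form\<close>

lemma real_interval_avoid:
  fixes a b :: real
  assumes "a < b" "finite S"
  shows "\<exists>u. a < u \<and> u < b \<and> u \<notin> S"
proof -
  have "infinite ({a<..<b} - S)" using assms by (simp add: infinite_Ioo)
  then obtain u where "u \<in> {a<..<b} - S" using infinite_imp_nonempty by blast
  then show ?thesis by auto
qed

text \<open>All cycles have positive weight, so the difference constraints have an open set of
  solutions: \<open>u\<close> is chosen in the interval left after eliminating \<open>v\<close>,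
  then \<open>v\<close>. Openness leaves room to avoid the finite set.\<close>

lemma generic_potential:
  fixes w01 w10 w02 w20 w12 w21 :: real
  assumes "w01 + w10 > 0" "w02 + w20 > 0" "w12 + w21 > 0" "w01 + w12 + w20 > 0" "w02 + w21 + w10 > 0" "finite S"
  shows "\<exists>u v. w01 > - u \<and> w10 > u \<and> w02 > - v \<and> w20 > v \<and> w12 > u - v \<and> w21 > v - u \<and> u \<notin> S \<and> v \<notin> S \<and> v - u \<notin> S"
proof -
  obtain u where u: "max (- w01) (- w02 - w21) < u" "u < min w10 (w20 + w12)" "u \<notin> S"
    using real_interval_avoid[of "max (- w01) (- w02 - w21)" "min w10 (w20 + w12)" S] assms by auto
  obtain v where v: "max (- w02) (u - w12) < v" "v < min w20 (u + w21)" "v \<notin> S \<union> (\<lambda>s. s + u) ` S"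
    using real_interval_avoid[of "max (- w02) (u - w12)" "min w20 (u + w21)" "S \<union> (\<lambda>s. s + u) ` S"] u assms by auto
  have "v - u \<notin> S" using v(3) by (auto simp: image_iff)
  then show ?thesis using u v by (intro exI[of _ u] exI[of _ v]) auto
qed

lemma unique_min3:
  fixes a :: "nat \<Rightarrow> real"
  assumes "a 0 \<noteq> a 1" "a 0 \<noteq> a 2" "a 1 \<noteq> a 2"
  shows "\<exists>k<3. \<forall>l<3. l \<noteq> k \<longrightarrow> a k < a l"
proof -
  consider "a 0 < a 1" "a 0 < a 2" | "a 1 < a 0" "a 1 < a 2" | "a 2 < a 0" "a 2 < a 1" using assms by linarith
  then show ?thesis
  proof cases
    case 1
    then have "\<forall>l<3. l \<noteq> 0 \<longrightarrow> a 0 < a l" by (auto dest!: less_3_cases)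
    then show ?thesis by (intro exI[of _ 0]) simp
  next
    case 2
    then have "\<forall>l<3. l \<noteq> 1 \<longrightarrow> a 1 < a l" by (auto dest!: less_3_cases)
    then show ?thesis by (intro exI[of _ 1]) simp
  next
    case 3
    then have "\<forall>l<3. l \<noteq> 2 \<longrightarrow> a 2 < a l" by (auto dest!: less_3_cases)
    then show ?thesis by (intro exI[of _ 2]) simp
  qed
qed

text \<open>A potential makes the non-singular 3 by 3 minor positive off its diagonal. Every row and
  column is labelled by the place in the minor where its scaled entry is least and is scaled to 0
  there. An entry outside the rows and columns of the minor that broke the rule would complete a
  triangular 4 by 4 minor.\<close>

lemma nf_exists:
  assumes r3: "rank3 b" and R: "inj_on R {..<3}" "\<And>k. k < 3 \<Longrightarrow> R k < 5" and C: "inj_on C {..<3}" "\<And>k. k < 3 \<Longrightarrow> C k < 5"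
    and w: "\<And>k l. w k l = b (R k) (C l) - b (R l) (C l)"
    and pos: "w 0 1 + w 1 0 > 0" "w 0 2 + w 2 0 > 0" "w 1 2 + w 2 1 > 0" "w 0 1 + w 1 2 + w 2 0 > 0" "w 0 2 + w 2 1 + w 1 0 > 0"
  shows "\<exists>r c x y. nf b r c x y \<and> (\<forall>i<5. r i < 3 \<and> c i < 3) \<and> (\<forall>k<3. r (R k) = k \<and> c (C k) = k)"
proof -
  let ?T = "{..<5::nat} \<times> {..<3::nat} \<times> {..<3::nat}"
  \<comment> \<open>Avoiding these differences makes the least scaled entry of every row and column
    unique.\<close>
  define S where "S = (\<lambda>(i,k,l). (b (R k) (C k) - b i (C k)) - (b (R l) (C l) - b i (C l))) ` ?T \<union>
     (\<lambda>(j,k,l). b (R k) j - b (R l) j) ` ?T"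
  have "finite S" unfolding S_def by auto
  from generic_potential[OF pos this] obtain u v where uv: "w 0 1 > - u" "w 1 0 > u" "w 0 2 > - v" "w 2 0 > v" "w 1 2 > u - v" "w 2 1 > v - u"
    "u \<notin> S" "v \<notin> S" "v - u \<notin> S" by blast
  define X where "X k = (if k = 0 then 0 else if k = (1::nat) then u else v)" for k
  define Y where "Y k = b (R k) (C k) - X k" for k
  have gap: "b (R k) (C l) > X k + Y l" if "k < 3" "l < 3" "k \<noteq> l" for k l
  proof -
    have "w k l > X k - X l" using less_3_cases[OF that(1)] less_3_cases[OF that(2)] that(3) uv by (auto simp: X_def)
    then show ?thesis unfolding w Y_def by simp
  qed
  have SR: "(b (R k) (C k) - b i (C k)) - (b (R l) (C l) - b i (C l)) \<in> S" if "i < 5" "k < 3" "l < 3" for i k l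
    unfolding S_def by (rule UnI1, rule image_eqI[of _ _ "(i,k,l)"]) (use that in auto)
  have SC: "b (R k) j - b (R l) j \<in> S" if "j < 5" "k < 3" "l < 3" for j k l
    unfolding S_def by (rule UnI2, rule image_eqI[of _ _ "(j,k,l)"]) (use that in auto)
  have Xd: "X 1 - X 0 \<notin> S" "X 2 - X 0 \<notin> S" "X 2 - X 1 \<notin> S" using uv by (simp_all add: X_def)
  have "\<exists>k<3. \<forall>l<3. l \<noteq> k \<longrightarrow> b i (C k) - Y k < b i (C l) - Y l" if i: "i < 5" for i
  proof (rule unique_min3)
    show "b i (C 0) - Y 0 \<noteq> b i (C 1) - Y 1"
    proof
      assume "b i (C 0) - Y 0 = b i (C 1) - Y 1"
      then have "X 1 - X 0 = (b (R 1) (C 1) - b i (C 1)) - (b (R 0) (C 0) - b i (C 0))" by (simp add: Y_def)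
      then show False using SR[OF i, of 1 0] Xd(1) by simp
    qed
    show "b i (C 0) - Y 0 \<noteq> b i (C 2) - Y 2"
    proof
      assume "b i (C 0) - Y 0 = b i (C 2) - Y 2"
      then have "X 2 - X 0 = (b (R 2) (C 2) - b i (C 2)) - (b (R 0) (C 0) - b i (C 0))" by (simp add: Y_def)
      then show False using SR[OF i, of 2 0] Xd(2) by simp
    qed
    show "b i (C 1) - Y 1 \<noteq> b i (C 2) - Y 2"
    proof
      assume "b i (C 1) - Y 1 = b i (C 2) - Y 2"
      then have "X 2 - X 1 = (b (R 2) (C 2) - b i (C 2)) - (b (R 1) (C 1) - b i (C 1))" by (simp add: Y_def)
      then show False using SR[OF i, of 2 1] Xd(3) by simp
    qed
  qed
  then have "\<forall>i\<in>{..<5}. \<exists>k. k < 3 \<and> (\<forall>l<3. l \<noteq> k \<longrightarrow> b i (C k) - Y k < b i (C l) - Y l)" by simp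
  from bchoice[OF this] obtain r where "\<forall>i\<in>{..<5}. r i < 3 \<and> (\<forall>l<3. l \<noteq> r i \<longrightarrow> b i (C (r i)) - Y (r i) < b i (C l) - Y l)" ..
  then have r: "\<And>i. i < 5 \<Longrightarrow> r i < 3" "\<And>i l. i < 5 \<Longrightarrow> l < 3 \<Longrightarrow> l \<noteq> r i \<Longrightarrow> b i (C (r i)) - Y (r i) < b i (C l) - Y l" by simp_all
  have "\<exists>k<3. \<forall>l<3. l \<noteq> k \<longrightarrow> b (R k) j - X k < b (R l) j - X l" if j: "j < 5" for j
  proof (rule unique_min3)
    show "b (R 0) j - X 0 \<noteq> b (R 1) j - X 1"
    proof
      assume "b (R 0) j - X 0 = b (R 1) j - X 1"
      then have "X 1 - X 0 = b (R 1) j - b (R 0) j" by simp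
      then show False using SC[OF j, of 1 0] Xd(1) by simp
    qed
    show "b (R 0) j - X 0 \<noteq> b (R 2) j - X 2"
    proof
      assume "b (R 0) j - X 0 = b (R 2) j - X 2"
      then have "X 2 - X 0 = b (R 2) j - b (R 0) j" by simp
      then show False using SC[OF j, of 2 0] Xd(2) by simp
    qed
    show "b (R 1) j - X 1 \<noteq> b (R 2) j - X 2"
    proof
      assume "b (R 1) j - X 1 = b (R 2) j - X 2"
      then have "X 2 - X 1 = b (R 2) j - b (R 1) j" by simp
      then show False using SC[OF j, of 2 1] Xd(3) by simp
    qed
  qed
  then have "\<forall>j\<in>{..<5}. \<exists>k. k < 3 \<and> (\<forall>l<3. l \<noteq> k \<longrightarrow> b (R k) j - X k < b (R l) j - X l)" by simp
  from bchoice[OF this] obtain c where "\<forall>j\<in>{..<5}. c j < 3 \<and> (\<forall>l<3. l \<noteq> c j \<longrightarrow> b (R (c j)) j - X (c j) < b (R l) j - X l)" ..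
  then have c: "\<And>j. j < 5 \<Longrightarrow> c j < 3" "\<And>j l. j < 5 \<Longrightarrow> l < 3 \<Longrightarrow> l \<noteq> c j \<Longrightarrow> b (R (c j)) j - X (c j) < b (R l) j - X l" by simp_all
  have rR: "r (R k) = k" if k: "k < 3" for k
  proof (rule ccontr)
    assume n: "r (R k) \<noteq> k"
    have "b (R k) (C (r (R k))) - Y (r (R k)) < b (R k) (C k) - Y k" using r(2)[OF R(2)[OF k] k] n by simp
    moreover have "b (R k) (C (r (R k))) > X k + Y (r (R k))" using gap[OF k r(1)[OF R(2)[OF k]]] n by simp
    ultimately show False by (simp add: Y_def)
  qed
  have cC: "c (C k) = k" if k: "k < 3" for k
  proof (rule ccontr)
    assume n: "c (C k) \<noteq> k"
    have "b (R (c (C k))) (C k) - X (c (C k)) < b (R k) (C k) - X k" using c(2)[OF C(2)[OF k] k] n by simp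
    moreover have "b (R (c (C k))) (C k) > X (c (C k)) + Y k" using gap[OF c(1)[OF C(2)[OF k]] k] n by simp
    ultimately show False by (simp add: Y_def)
  qed
  define x where "x i = b i (C (r i)) - Y (r i)" for i
  define y where "y j = b (R (c j)) j - X (c j)" for j
  have xR: "x (R k) = X k" if "k < 3" for k using rR[OF that] by (simp add: x_def Y_def)
  have yC: "y (C k) = Y k" if "k < 3" for k using cC[OF that] by (simp add: y_def Y_def)
  have rowz: "b i (C (r i)) = x i + Y (r i)" for i by (simp add: x_def)
  have rowp: "b i (C l) > x i + Y l" if "i < 5" "l < 3" "l \<noteq> r i" for i l using r(2)[OF that] by (simp add: x_def)
  have colz: "b (R (c j)) j = X (c j) + y j" for j by (simp add: y_def)
  have colp: "b (R l) j > X l + y j" if "j < 5" "l < 3" "l \<noteq> c j" for j l using c(2)[OF that] by (simp add: y_def)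
  have rowg: "b i (C l) \<ge> x i + Y l" if "i < 5" "l < 3" for i l using rowz[of i] rowp[OF that] by (cases "l = r i") auto
  have colg: "b (R l) j \<ge> X l + y j" if "j < 5" "l < 3" for j l using colz[of j] colp[OF that] by (cases "l = c j") auto
  have diag: "b (R k) (C k) = X k + Y k" for k by (simp add: Y_def)
  have gapg: "b (R k) (C l) \<ge> X k + Y l" if "k < 3" "l < 3" for k l using gap[OF that] diag[of k] by (cases "k = l") auto
  have main: "if r i = c j then b i j = x i + y j else b i j > x i + y j" if ij: "i < 5" "j < 5" for i j
  proof (cases "i \<in> R ` {..<3}")
    case True
    then obtain k where k: "k < 3" "i = R k" by auto
    show ?thesis unfolding k(2) rR[OF k(1)] xR[OF k(1)] using colz[of j] colp[OF ij(2) k(1)] by auto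
  next
    case iR: False
    show ?thesis
    proof (cases "j \<in> C ` {..<3}")
      case True
      then obtain k where k: "k < 3" "j = C k" by auto
      show ?thesis unfolding k(2) cC[OF k(1)] yC[OF k(1)] using rowz[of i] rowp[OF ij(1) k(1)] by auto
    next
      case jC: False
      define d where "d = b i j - x i - y j"
      have nR: "R k \<noteq> i" "C k \<noteq> j" if "k < 3" for k using iR jC that by auto
      have RR: "R k \<noteq> R l" "C k \<noteq> C l" if "k < 3" "l < 3" "k \<noteq> l" for k l
        using that inj_onD[OF R(1), of k l] inj_onD[OF C(1), of k l] by auto
      have D: "distinct [R a0, R a1, R a2, i]" "distinct [C a0, C a1, C a2, j]" "{R a0, R a1, R a2, i, C a0, C a1, C a2, j} \<subseteq> {..<5}"
        if "a0 < 3" "a1 < 3" "a2 < 3" "a0 \<noteq> a1" "a0 \<noteq> a2" "a1 \<noteq> a2" for a0 a1 a2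
        using that nR RR R(2) C(2) ij by simp_all
      \<comment> \<open>The potential at column \<open>j\<close> changed so that the entry at
        (\<open>i\<close>, \<open>j\<close>) becomes tight, for the cases in which \<open>d\<close>
        is not positive.\<close>
      define yd where "yd = y(j := y j + d)"
      have y': "yd (C k) = Y k" if "k < 3" for k using nR(2)[OF that] yC[OF that] by (simp add: yd_def)
      have ydj: "yd j = y j + d" by (simp add: yd_def)
      show ?thesis
      proof (cases "r i = c j")
        case False
        define e f where "e = r i" and "f = c j"
        have ef: "e < 3" "f < 3" "e \<noteq> f" using r(1)[OF ij(1)] c(1)[OF ij(2)] False by (simp_all add: e_def f_def)
        obtain g where g: "g < 3" "g \<noteq> e" "g \<noteq> f"
        proof -
          have "\<exists>g<3. g \<noteq> e \<and> g \<noteq> f" using less_3_cases[OF ef(1)] less_3_cases[OF ef(2)]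
            by (elim disjE) (rule exI[of _ 0], simp; fail | rule exI[of _ 1], simp; fail | rule exI[of _ 2], simp; fail)+
          then show ?thesis using that by blast
        qed
        have xx: "x (R e) = X e" "x (R f) = X f" "x (R g) = X g" using xR ef g by simp_all
        have gs: "b (R f) (C e) > X f + Y e" "b (R f) (C g) > X f + Y g" "b (R e) (C f) > X e + Y f"
          "b (R e) (C g) > X e + Y g" "b (R g) (C f) > X g + Y f" "b (R g) (C e) > X g + Y e"
          "b (R e) (C e) = X e + Y e" "b (R f) (C f) = X f + Y f" "b (R g) (C g) = X g + Y g"
          using gap diag ef g by simp_all
        have cs: "b (R f) j = X f + y j" "b (R e) j > X e + y j" "b (R g) j > X g + y j"
          using colz[of j] colp[OF ij(2)] ef g unfolding f_def[symmetric] by simp_all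
        have rs: "b i (C e) = x i + Y e" "b i (C f) > x i + Y f" "b i (C g) > x i + Y g"
          using rowz[of i] rowp[OF ij(1)] ef g unfolding e_def[symmetric] by simp_all
        have "d > 0"
        proof (rule ccontr)
          assume d: "\<not> d > 0"
          show False
          proof (rule tri_contra[OF r3, of "R f" i "R e" "R g" "C f" j "C e" "C g" x yd])
            show "distinct [R f, i, R e, R g]" "distinct [C f, j, C e, C g]" "{R f, i, R e, R g, C f, j, C e, C g} \<subseteq> {..<5}"
              using D[of f e g] ef g by auto
          qed (use ef g d xx gs cs rs in \<open>simp_all add: y' ydj d_def\<close>)
        qed
        then show ?thesis using False by (simp add: d_def)
      next
        case True
        define e where "e = r i"
        have e: "e < 3" "c j = e" "r i = e" using r(1)[OF ij(1)] True by (simp_all add: e_def)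
        obtain g h where gh: "g < 3" "h < 3" "g \<noteq> e" "h \<noteq> e" "g \<noteq> h"
        proof -
          have "\<exists>g<3. \<exists>h<3. g \<noteq> e \<and> h \<noteq> e \<and> g \<noteq> h" using less_3_cases[OF e(1)]
          proof (elim disjE)
            assume "e = 0" then show ?thesis by (intro exI[of _ 1] conjI exI[of _ 2]) auto
          next
            assume "e = 1" then show ?thesis by (intro exI[of _ 0] conjI exI[of _ 2]) auto
          next
            assume "e = 2" then show ?thesis by (intro exI[of _ 0] conjI exI[of _ 1]) auto
          qed
          then show ?thesis using that by blast
        qed
        have xx: "x (R e) = X e" "x (R g) = X g" "x (R h) = X h" "y (C e) = Y e" "y (C g) = Y g" "y (C h) = Y h"
          "yd (C e) = Y e" "yd (C g) = Y g" "yd (C h) = Y h" using xR yC y' e gh by simp_all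
        have gs: "b (R h) (C e) > X h + Y e" "b (R h) (C g) > X h + Y g" "b (R e) (C h) > X e + Y h"
          "b (R e) (C g) > X e + Y g" "b (R g) (C h) > X g + Y h" "b (R g) (C e) > X g + Y e"
          "b (R e) (C e) = X e + Y e" "b (R h) (C h) = X h + Y h" "b (R g) (C g) = X g + Y g"
          using gap diag e(1) gh by simp_all
        have cs: "b (R e) j = X e + y j" "b (R h) j > X h + y j" "b (R g) j > X g + y j"
          using colz[of j] colp[OF ij(2)] e(1) gh unfolding e(2) by simp_all
        have rs: "b i (C e) = x i + Y e" "b i (C h) > x i + Y h" "b i (C g) > x i + Y g"
          using rowz[of i] rowp[OF ij(1)] e(1) gh unfolding e(3) by simp_all
        \<comment> \<open>The tight entries at (\<open>R e\<close>, \<open>j\<close>) and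
          (\<open>i\<close>, \<open>C e\<close>) form the start of the diagonal; a positive
          \<open>d\<close> makes the entry at (\<open>i\<close>, \<open>j\<close>) below them
          strict.\<close>
        have "\<not> d > 0"
        proof
          assume d: "d > 0"
          show False
          proof (rule tri_contra[OF r3, of "R e" i "R g" "R h" j "C e" "C g" "C h" x y])
            show "distinct [R e, i, R g, R h]" "distinct [j, C e, C g, C h]" "{R e, i, R g, R h, j, C e, C g, C h} \<subseteq> {..<5}"
              using D[of e g h] e gh by auto
          qed (use d xx gs cs rs in \<open>simp_all add: d_def\<close>)
        qed
        moreover have "\<not> d < 0"
        proof
          assume d: "d < 0"
          show False
          proof (rule tri_contra[OF r3, of i "R e" "R g" "R h" j "C e" "C g" "C h" x yd])
            show "distinct [i, R e, R g, R h]" "distinct [j, C e, C g, C h]" "{i, R e, R g, R h, j, C e, C g, C h} \<subseteq> {..<5}"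
              using D[of e g h] e gh by auto
          qed (use d xx gs cs rs in \<open>simp_all add: ydj d_def\<close>)
        qed
        ultimately show ?thesis using True by (simp add: d_def)
      qed
    qed
  qed
  have "nf b r c x y" unfolding nf_def using main by blast
  then show ?thesis using r(1) c(1) rR cC by blast
qed

text \<open>Three rows and three columns represent the labels, so the sizes depend on the remaining
  two: different labels give (2, 2, 1), equal ones (3, 1, 1). In the second case on both sides the
  large classes match or not.\<close>

lemma nf_lift:
  assumes F: "infinite (UNIV :: 'a::field set) \<or> card (UNIV :: 'a set) \<ge> 4"
    and r3: "rank3 b" and n: "nf b r c x y" and lab: "\<forall>i<5. r i < 3 \<and> c i < 3"
    and R: "inj_on R {..<3}" "\<And>k. k < 3 \<Longrightarrow> R k < 5" "\<And>k. k < 3 \<Longrightarrow> r (R k) = k"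
    and C: "inj_on C {..<3}" "\<And>k. k < 3 \<Longrightarrow> C k < 5" "\<And>k. k < 3 \<Longrightarrow> c (C k) = k"
  shows "lift3 TYPE('a) b"
proof -
  have rest: "\<exists>u v. \<forall>a0 a1 a2. a0 < 3 \<longrightarrow> a1 < 3 \<longrightarrow> a2 < 3 \<longrightarrow> a0 \<noteq> a1 \<longrightarrow> a0 \<noteq> a2 \<longrightarrow> a1 \<noteq> a2 \<longrightarrow>
      {R a0, R a1, R a2, u, v} = {..<5} \<and> u < 5 \<and> v < 5"
    if R: "inj_on R {..<3}" "\<And>k. k < 3 \<Longrightarrow> R k < (5::nat)" for R :: "nat \<Rightarrow> nat"
  proof -
    have sub: "R ` {..<3} \<subseteq> {..<5}" using R(2) by auto
    have "card ({..<5} - R ` {..<3}) = 2" using sub card_image[OF R(1)] by (simp add: card_Diff_subset)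
    then obtain u v where uv: "{..<5} - R ` {..<3} = {u,v}" by (auto simp: card_2_iff)
    have "{R a0, R a1, R a2, u, v} = {..<5} \<and> u < 5 \<and> v < 5"
      if a: "a0 < 3" "a1 < 3" "a2 < 3" "a0 \<noteq> a1" "a0 \<noteq> a2" "a1 \<noteq> a2" for a0 a1 a2
    proof -
      have "{a0,a1,a2} = {..<3}" by (rule card_subset_eq) (use a in auto)
      then have "R ` {..<3} = {R a0, R a1, R a2}" by (metis image_empty image_insert)
      moreover have "{R a0, R a1, R a2, u, v} = {R a0, R a1, R a2} \<union> {u,v}" by auto
      ultimately have "{R a0, R a1, R a2, u, v} = {..<5}" using uv sub by auto
      then show ?thesis by auto
    qed
    then show ?thesis by blast
  qed
  from rest[OF R(1,2)] obtain u v where uv: "\<And>a0 a1 a2. a0 < 3 \<Longrightarrow> a1 < 3 \<Longrightarrow> a2 < 3 \<Longrightarrow> a0 \<noteq> a1 \<Longrightarrow> a0 \<noteq> a2 \<Longrightarrow> a1 \<noteq> a2 \<Longrightarrow>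
      {R a0, R a1, R a2, u, v} = {..<5} \<and> u < 5 \<and> v < 5" by blast
  from rest[OF C(1,2)] obtain s t where st: "\<And>a0 a1 a2. a0 < 3 \<Longrightarrow> a1 < 3 \<Longrightarrow> a2 < 3 \<Longrightarrow> a0 \<noteq> a1 \<Longrightarrow> a0 \<noteq> a2 \<Longrightarrow> a1 \<noteq> a2 \<Longrightarrow>
      {C a0, C a1, C a2, s, t} = {..<5} \<and> s < 5 \<and> t < 5" by blast
  have third: "\<exists>g<3. g \<noteq> e \<and> g \<noteq> f" for e f :: nat
  proof -
    have "card {e,f} < card {..<3::nat}" by (simp add: card_insert_if)
    then obtain g where "g \<in> {..<3} - {e,f}" using card_mono[of "{e,f}" "{..<3::nat}"] by fastforce
    then show ?thesis by auto
  qed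
  have lt: "u < 5" "v < 5" "s < 5" "t < 5" using uv[of 0 1 2] st[of 0 1 2] by simp_all
  have l3: "r u < 3" "r v < 3" "c s < 3" "c t < 3" using lab lt by blast+
  have cov: "c j = e \<or> c j = f \<or> c j = g" "r j = e \<or> r j = f \<or> r j = g"
    if "e < 3" "f < 3" "g < 3" "e \<noteq> f" "e \<noteq> g" "f \<noteq> g" "j < 5" for e f g j
  proof -
    have "{e,f,g} = {..<3}" by (rule card_subset_eq) (use that in auto)
    moreover have "c j \<in> {..<3}" "r j \<in> {..<3}" using lab that(7) by auto
    ultimately show "c j = e \<or> c j = f \<or> c j = g" "r j = e \<or> r j = f \<or> r j = g" by blast+
  qed
  have ex: "\<exists>j<5. c j = e" "\<exists>j<5. r j = e" if "e < 3" for e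
    using C(2,3)[OF that] R(2,3)[OF that] by blast+
  show ?thesis
  proof (cases "r u = r v")
    case False
    obtain g where g: "g < 3" "g \<noteq> r u" "g \<noteq> r v" using third by blast
    have A: "{R (r u), u, R (r v), v, R g} = {..<5}" using uv[OF l3(1,2) g(1)] False g by auto
    show ?thesis
      by (rule nf_lift_221[OF F r3 n A, of "r u" "r v" g]) (use R(3) l3 g False cov[OF l3(1,2) g(1)] ex in auto)
  next
    case ru: True
    show ?thesis
    proof (cases "c s = c t")
      case False
      obtain g where g: "g < 3" "g \<noteq> c s" "g \<noteq> c t" using third by blast
      have A: "{C (c s), s, C (c t), t, C g} = {..<5}" using st[OF l3(3,4) g(1)] False g by auto
      show ?thesis
        by (rule nf_lift_221T[OF F r3 n A, of "c s" "c t" g]) (use C(3) l3 g False cov[OF l3(3,4) g(1)] ex in auto)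
    next
      case cs: True
      show ?thesis
      proof (cases "r u = c s")
        case True
        obtain f where f: "f < 3" "f \<noteq> r u" using third[of "r u" "r u"] by blast
        obtain g where g: "g < 3" "g \<noteq> r u" "g \<noteq> f" using third by blast
        have A: "{R (r u), u, v, R f, R g} = {..<5}" using uv[OF l3(1) f(1) g(1)] f g by auto
        have B: "{C (r u), s, t, C f, C g} = {..<5}" using st[OF l3(1) f(1) g(1)] f g by auto
        show ?thesis
          by (rule nf_lift_311[OF n A B, of "r u" f g]) (use R(3) C(3) l3 f g ru cs True in auto)
      next
        case False
        define e f where "e = r u" and "f = c s"
        have ef: "e < 3" "f < 3" "e \<noteq> f" "r u = e" "r v = e" "c s = f" "c t = f"
          using l3 False ru cs by (simp_all add: e_def f_def)
        obtain g where g: "g < 3" "g \<noteq> e" "g \<noteq> f" using third by blast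
        have A: "{R e, u, v, R f, R g} = {..<5}" using uv[OF ef(1,2) g(1)] ef(3) g by auto
        have B: "{C e, C f, s, t, C g} = {..<5}" using st[OF ef(1,2) g(1)] ef(3) g by auto
        let ?p = "perm5 (R e) u v (R f) (R g)" and ?q = "perm5 (C e) (C f) s t (C g)"
        let ?B = "\<lambda>i j. b i j - x i - y j"
        have N: "if r i = c j then ?B i j = 0 else ?B i j > 0" if "i < 5" "j < 5" for i j
        proof -
          have "if r i = c j then b i j = x i + y j else b i j > x i + y j" using n that unfolding nf_def by blast
          then show ?thesis by (auto split: if_splits)
        qed
        have rl: "r (?p i) = e" "?p i < 5" if "i < 3" for i
          using less_3_cases[OF that] ef R(2,3) lt by auto
        have cl: "c (?q j) = f" "?q j < 5" if "j \<in> {1,2,3}" for j using that ef C(2,3) lt by auto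
        have o: "r (R f) = f" "r (R g) = g" "c (C e) = e" "c (C g) = g" "R f < 5" "R g < 5" "C e < 5" "C g < 5"
          using R(2,3) C(2,3) ef g by simp_all
        have "type4 (\<lambda>i j. ?B (?p i) (?q j))"
          unfolding type4_def
        proof (intro conjI allI impI ballI)
          fix i :: nat assume i: "i < 3"
          show "?B (?p i) (?q 0) = 0" using N[OF rl(2)[OF i] o(7)] rl(1)[OF i] o by simp
          show "?B (?p i) (?q 4) > 0" using N[OF rl(2)[OF i] o(8)] rl(1)[OF i] o g by simp
          show "?B (?p i) (?q l) > 0" if "l \<in> {1,2,3}" for l using N[OF rl(2)[OF i] cl(2)[OF that]] rl(1)[OF i] cl(1)[OF that] ef by simp
        next
          fix l :: nat assume l: "l \<in> {1,2,3}"
          show "?B (?p 3) (?q l) = 0" using N[OF o(5) cl(2)[OF l]] cl(1)[OF l] o by simp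
          show "?B (?p 4) (?q l) > 0" using N[OF o(6) cl(2)[OF l]] cl(1)[OF l] o g by simp
        next
          show "?B (?p 3) (?q 0) > 0" using N[OF o(5) o(7)] o ef by simp
          show "?B (?p 3) (?q 4) > 0" using N[OF o(5) o(8)] o g by simp
          show "?B (?p 4) (?q 0) > 0" using N[OF o(6) o(7)] o g by simp
          show "?B (?p 4) (?q 4) = 0" using N[OF o(6) o(8)] o by simp
        qed
        from type4_lift[OF F rank3_perm5[OF rank3_scaled[OF r3] A B] this]
        show ?thesis by (rule lift3_scaled[OF lift3_perm5[OF _ A B]])
      qed
    qed
  qed
qed

section \<open>From submatrices and matrix rank to the combinatorial form\<close>

lemma bij_betw_pick:
  assumes "finite I"
  shows "bij_betw (pick I) {..<card I} I"
proof -
  have sub: "pick I ` {..<card I} \<subseteq> I" using pick_in_set_le by auto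
  have inj: "inj_on (pick I) {..<card I}"
    by (rule inj_on_inverseI[of _ "\<lambda>a. card {c\<in>I. c < a}"]) (simp add: card_pick_le)
  have "pick I ` {..<card I} = I"
    by (rule card_subset_eq[OF assms sub]) (simp add: card_image[OF inj])
  then show ?thesis using inj by (simp add: bij_betw_def)
qed

text \<open>Bijections from \<open>I\<close> to \<open>J\<close> replace permutations of positions,
  and a strict inequality against every other bijection replaces uniqueness; the numbering by
  \<open>pick\<close> disappears.\<close>

lemma nonsingular_submatrix_iff:
  fixes B :: "real mat"
  assumes B: "B \<in> carrier_mat n n" and I: "I \<subseteq> {..<n}" "card I = r" and J: "J \<subseteq> {..<n}" "card J = r"
  shows "tropically_nonsingular (submatrix B I J) \<longleftrightarrow>
    (\<exists>f. bij_betw f I J \<and> (\<forall>g. bij_betw g I J \<longrightarrow> (\<exists>i\<in>I. g i \<noteq> f i) \<longrightarrow>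
      (\<Sum>i\<in>I. B $$ (i, f i)) < (\<Sum>i\<in>I. B $$ (i, g i))))"
proof -
  have fin: "finite I" "finite J" using I J finite_subset by blast+
  let ?p = "pick I" and ?q = "pick J" and ?S = "submatrix B I J"
  have p: "bij_betw ?p {..<r} I" and q: "bij_betw ?q {..<r} J"
    using bij_betw_pick[OF fin(1)] bij_betw_pick[OF fin(2)] I J by simp_all
  have cI: "{i. i < dim_row B \<and> i \<in> I} = I" "{i. i < dim_col B \<and> i \<in> J} = J" using B I J by auto
  have dim: "dim_row ?S = r" "dim_col ?S = r" using I J by (simp_all add: dim_submatrix cI)
  have ent: "?S $$ (k, l) = B $$ (?p k, ?q l)" if "k < r" "l < r" for k l
    using submatrix_index[of k B I l J] that I J by (simp add: cI)
  define ip where "ip = inv_into {..<r} ?p"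
  define iq where "iq = inv_into {..<r} ?q"
  have ip: "ip (?p k) = k" if "k < r" for k using bij_betw_inv_into_left[OF p] that by (simp add: ip_def)
  have pi: "?p (ip i) = i" "ip i < r" if "i \<in> I" for i
    using bij_betw_inv_into_right[OF p that] bij_betwE[OF bij_betw_inv_into[OF p]] that by (auto simp: ip_def)
  have iq: "iq (?q k) = k" if "k < r" for k using bij_betw_inv_into_left[OF q] that by (simp add: iq_def)
  have qi: "?q (iq i) = i" "iq i < r" if "i \<in> J" for i
    using bij_betw_inv_into_right[OF q that] bij_betwE[OF bij_betw_inv_into[OF q]] that by (auto simp: iq_def)
  have bip: "bij_betw ip I {..<r}" and biq: "bij_betw iq J {..<r}"
    unfolding ip_def iq_def by (rule bij_betw_inv_into[OF p], rule bij_betw_inv_into[OF q])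
  define F where "F \<sigma> i = ?q (\<sigma> (ip i))" for \<sigma> i
  define G where "G f k = (if k < r then iq (f (?p k)) else k)" for f k
  have bF: "bij_betw (F \<sigma>) I J" if "\<sigma> permutes {..<r}" for \<sigma>
  proof -
    have "bij_betw (?q \<circ> (\<sigma> \<circ> ip)) I J"
      by (rule bij_betw_trans[OF bij_betw_trans[OF bip permutes_imp_bij[OF that]] q])
    then show ?thesis by (simp add: F_def[abs_def] o_def)
  qed
  have pG: "G f permutes {..<r}" if "bij_betw f I J" for f
  proof (rule bij_imp_permutes)
    have "bij_betw (iq \<circ> (f \<circ> ?p)) {..<r} {..<r}"
      by (rule bij_betw_trans[OF bij_betw_trans[OF p that] biq])
    then show "bij_betw (G f) {..<r} {..<r}" by (rule bij_betw_cong[THEN iffD1, rotated]) (simp add: G_def)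
  qed (simp add: G_def)
  have FG: "F (G f) i = f i" if "bij_betw f I J" "i \<in> I" for f i
    using pi[OF that(2)] qi[OF bij_betwE[OF that(1), rule_format, OF that(2)]] by (simp add: F_def G_def)
  have eqI: "\<sigma> = \<tau>" if "\<sigma> permutes {..<r}" "\<tau> permutes {..<r}" "\<And>i. i \<in> I \<Longrightarrow> F \<sigma> i = F \<tau> i" for \<sigma> \<tau>
  proof
    fix k show "\<sigma> k = \<tau> k"
    proof (cases "k < r")
      case True
      have "?p k \<in> I" using bij_betwE[OF p] True by simp
      from that(3)[OF this] have "?q (\<sigma> k) = ?q (\<tau> k)" by (simp add: F_def ip[OF True])
      moreover have "\<sigma> k < r" "\<tau> k < r" using permutes_in_image[OF that(1), of k] permutes_in_image[OF that(2), of k] True by simp_all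
      ultimately show ?thesis using iq by metis
    next
      case False
      then show ?thesis using permutes_not_in[OF that(1), of k] permutes_not_in[OF that(2), of k] by simp
    qed
  qed
  have sum: "(\<Sum>k<r. ?S $$ (k, \<sigma> k)) = (\<Sum>i\<in>I. B $$ (i, F \<sigma> i))" if "\<sigma> permutes {..<r}" for \<sigma>
  proof -
    have "(\<Sum>i\<in>I. B $$ (i, F \<sigma> i)) = (\<Sum>k<r. B $$ (?p k, F \<sigma> (?p k)))"
      using sum.reindex_bij_betw[OF p, of "\<lambda>i. B $$ (i, F \<sigma> i)"] by simp
    also have "\<dots> = (\<Sum>k<r. ?S $$ (k, \<sigma> k))"
    proof (rule sum.cong)
      fix k assume "k \<in> {..<r}"
      then have k: "k < r" by simp
      have "\<sigma> k < r" using permutes_in_image[OF that, of k] k by simp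
      then show "B $$ (?p k, F \<sigma> (?p k)) = ?S $$ (k, \<sigma> k)" using ent[OF k] by (simp add: F_def ip[OF k])
    qed simp
    finally show ?thesis by simp
  qed
  have sumG: "(\<Sum>k<r. ?S $$ (k, G f k)) = (\<Sum>i\<in>I. B $$ (i, f i))" if "bij_betw f I J" for f
    unfolding sum[OF pG[OF that]] by (rule sum.cong) (simp_all add: FG[OF that])
  show ?thesis
  proof
    assume "tropically_nonsingular ?S"
    then obtain \<sigma> where s: "\<sigma> permutes {..<r}"
      and m: "\<And>\<tau>. \<tau> permutes {..<r} \<Longrightarrow> (\<Sum>i<r. ?S $$ (i, \<sigma> i)) \<le> (\<Sum>i<r. ?S $$ (i, \<tau> i))"
      and u: "\<And>\<rho>. \<rho> permutes {..<r} \<Longrightarrow> (\<And>\<tau>. \<tau> permutes {..<r} \<Longrightarrow> (\<Sum>i<r. ?S $$ (i, \<rho> i)) \<le> (\<Sum>i<r. ?S $$ (i, \<tau> i))) \<Longrightarrow> \<rho> = \<sigma>"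
      unfolding tropically_nonsingular_def dim by blast
    have "(\<Sum>i\<in>I. B $$ (i, F \<sigma> i)) < (\<Sum>i\<in>I. B $$ (i, g i))" if g: "bij_betw g I J" "\<exists>i\<in>I. g i \<noteq> F \<sigma> i" for g
    proof -
      have "G g \<noteq> \<sigma>" using g FG[OF g(1)] by auto
      then have "\<not> (\<Sum>i<r. ?S $$ (i, G g i)) \<le> (\<Sum>i<r. ?S $$ (i, \<sigma> i))"
        using u[OF pG[OF g(1)]] m order_trans by meson
      then show ?thesis unfolding sumG[OF g(1)] sum[OF s] by simp
    qed
    then show "\<exists>f. bij_betw f I J \<and> (\<forall>g. bij_betw g I J \<longrightarrow> (\<exists>i\<in>I. g i \<noteq> f i) \<longrightarrow>
      (\<Sum>i\<in>I. B $$ (i, f i)) < (\<Sum>i\<in>I. B $$ (i, g i)))" using bF[OF s] by blast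
  next
    assume "\<exists>f. bij_betw f I J \<and> (\<forall>g. bij_betw g I J \<longrightarrow> (\<exists>i\<in>I. g i \<noteq> f i) \<longrightarrow>
      (\<Sum>i\<in>I. B $$ (i, f i)) < (\<Sum>i\<in>I. B $$ (i, g i)))"
    then obtain f where f: "bij_betw f I J"
      and m: "\<And>g. bij_betw g I J \<Longrightarrow> \<exists>i\<in>I. g i \<noteq> f i \<Longrightarrow> (\<Sum>i\<in>I. B $$ (i, f i)) < (\<Sum>i\<in>I. B $$ (i, g i))" by blast
    have lt: "(\<Sum>i<r. ?S $$ (i, G f i)) < (\<Sum>i<r. ?S $$ (i, \<tau> i))" if t: "\<tau> permutes {..<r}" "\<tau> \<noteq> G f" for \<tau>
    proof -
      have "\<exists>i\<in>I. F \<tau> i \<noteq> f i" using eqI[OF t(1) pG[OF f]] FG[OF f] t(2) by fastforce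
      from m[OF bF[OF t(1)] this] show ?thesis unfolding sumG[OF f] sum[OF t(1)] .
    qed
    have "\<exists>!\<sigma>. \<sigma> permutes {..<r} \<and> (\<forall>\<tau>. \<tau> permutes {..<r} \<longrightarrow> (\<Sum>i<r. ?S $$ (i, \<sigma> i)) \<le> (\<Sum>i<r. ?S $$ (i, \<tau> i)))"
    proof (rule ex1I[of _ "G f"])
      show "G f permutes {..<r} \<and> (\<forall>\<tau>. \<tau> permutes {..<r} \<longrightarrow> (\<Sum>i<r. ?S $$ (i, G f i)) \<le> (\<Sum>i<r. ?S $$ (i, \<tau> i)))"
        using pG[OF f] lt by (metis order_refl less_imp_le)
      fix \<sigma> assume s: "\<sigma> permutes {..<r} \<and> (\<forall>\<tau>. \<tau> permutes {..<r} \<longrightarrow> (\<Sum>i<r. ?S $$ (i, \<sigma> i)) \<le> (\<Sum>i<r. ?S $$ (i, \<tau> i)))"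
      show "\<sigma> = G f"
      proof (rule ccontr)
        assume "\<sigma> \<noteq> G f"
        with s lt[of \<sigma>] pG[OF f] show False by (meson not_le)
      qed
    qed
    then show "tropically_nonsingular ?S" unfolding tropically_nonsingular_def dim by (simp add: dim)
  qed
qed

lemma tropical_rank_eqD:
  fixes B :: "real mat"
  assumes B: "B \<in> carrier_mat n n" and r: "tropical_rank B = r"
  shows "\<exists>I J. I \<subseteq> {..<n} \<and> J \<subseteq> {..<n} \<and> card I = r \<and> card J = r \<and> tropically_nonsingular (submatrix B I J)"
    and "\<And>I J. I \<subseteq> {..<n} \<Longrightarrow> J \<subseteq> {..<n} \<Longrightarrow> card I = card J \<Longrightarrow> tropically_nonsingular (submatrix B I J) \<Longrightarrow> card I \<le> r"
proof -
  let ?T = "{r. \<exists>I J. I \<subseteq> {..<dim_row B} \<and> J \<subseteq> {..<dim_col B} \<and>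
     card I = r \<and> card J = r \<and> tropically_nonsingular (submatrix B I J)}"
  have "?T \<subseteq> {..dim_row B}" using card_mono[of "{..<dim_row B}"] by fastforce
  then have fin: "finite ?T" by (rule finite_subset) simp
  have "tropically_nonsingular (submatrix B {} {})"
    by (subst nonsingular_submatrix_iff[OF B, of _ 0]) (auto intro: exI[of _ id])
  then have "?T \<noteq> {}" by (auto intro!: exI[of _ "{}"])
  from Max_in[OF fin this] r have "r \<in> ?T" unfolding tropical_rank_def by simp
  then show "\<exists>I J. I \<subseteq> {..<n} \<and> J \<subseteq> {..<n} \<and> card I = r \<and> card J = r \<and> tropically_nonsingular (submatrix B I J)"
    using B by auto
  show "card I \<le> r" if "I \<subseteq> {..<n}" "J \<subseteq> {..<n}" "card I = card J" "tropically_nonsingular (submatrix B I J)" for I J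
  proof -
    have "card I \<in> ?T" using that B by (intro CollectI exI[of _ I] exI[of _ J]) simp
    from Max_ge[OF fin this] show ?thesis using r unfolding tropical_rank_def by simp
  qed
qed

lemma tropical_rank_eqI:
  fixes B :: "real mat"
  assumes B: "B \<in> carrier_mat n n" and I: "I \<subseteq> {..<n}" "J \<subseteq> {..<n}" "card I = r" "card J = r" "tropically_nonsingular (submatrix B I J)"
    and s: "\<And>I J. I \<subseteq> {..<n} \<Longrightarrow> J \<subseteq> {..<n} \<Longrightarrow> card I = card J \<Longrightarrow> r < card I \<Longrightarrow> \<not> tropically_nonsingular (submatrix B I J)"
  shows "tropical_rank B = r"
  using tropical_rank_eqD(1)[OF B refl] tropical_rank_eqD(2)[OF B refl I(1,2)] I s by (metis le_antisym not_le)

lemma tropical_rank_3_rank3: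
  fixes B :: "real mat"
  assumes B: "B \<in> carrier_mat 5 5" and r: "tropical_rank B = 3"
  shows "rank3 (\<lambda>i j. B $$ (i, j))"
  unfolding rank3_def
proof (intro allI impI, rule ccontr)
  fix \<rho> \<sigma> :: "nat \<Rightarrow> nat"
  assume a: "inj_on \<rho> {..<4}" "\<rho> ` {..<4} \<subseteq> {..<5}" "inj_on \<sigma> {..<4}" "\<sigma> ` {..<4} \<subseteq> {..<5}"
    and no: "\<not> (\<exists>\<pi>. \<pi> permutes {..<4} \<and> \<pi> \<noteq> id \<and> (\<Sum>i<4. B $$ (\<rho> (\<pi> i), \<sigma> i)) \<le> (\<Sum>i<4. B $$ (\<rho> i, \<sigma> i)))"
  let ?I = "\<rho> ` {..<4}" and ?J = "\<sigma> ` {..<4}"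
  have bI: "bij_betw \<rho> {..<4} ?I" and bJ: "bij_betw \<sigma> {..<4} ?J" using a by (simp_all add: bij_betw_def)
  have card: "card ?I = 4" "card ?J = 4" using a by (simp_all add: card_image)
  define ir where "ir = inv_into {..<4} \<rho>"
  have ir: "ir (\<rho> k) = k" if "k < 4" for k using that a(1) by (simp add: ir_def)
  have ri: "\<rho> (ir i) = i" if "i \<in> ?I" for i using that unfolding ir_def by (rule f_inv_into_f)
  have bir: "bij_betw ir ?I {..<4}" unfolding ir_def by (rule bij_betw_inv_into[OF bI])
  let ?f = "\<sigma> \<circ> ir"
  have bf: "bij_betw ?f ?I ?J" by (rule bij_betw_trans[OF bir bJ])
  have sf: "(\<Sum>i\<in>?I. B $$ (i, ?f i)) = (\<Sum>k<4. B $$ (\<rho> k, \<sigma> k))"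
    using sum.reindex_bij_betw[OF bI, of "\<lambda>i. B $$ (i, ?f i)"] by (simp add: ir)
  have "(\<Sum>i\<in>?I. B $$ (i, ?f i)) < (\<Sum>i\<in>?I. B $$ (i, g i))" if g: "bij_betw g ?I ?J" "\<exists>i\<in>?I. g i \<noteq> ?f i" for g
  proof -
    define ig where "ig = inv_into ?I g"
    have big: "bij_betw ig ?J ?I" unfolding ig_def by (rule bij_betw_inv_into[OF g(1)])
    have gi: "g (ig j) = j" if "j \<in> ?J" for j using bij_betw_inv_into_right[OF g(1) that] by (simp add: ig_def)
    have igg: "ig (g i) = i" if "i \<in> ?I" for i using bij_betw_inv_into_left[OF g(1) that] by (simp add: ig_def)
    define \<pi> where "\<pi> k = (if k < 4 then ir (ig (\<sigma> k)) else k)" for k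
    have b: "bij_betw (ig \<circ> \<sigma>) {..<4} ?I" by (rule bij_betw_trans[OF bJ big])
    have rp: "\<rho> (\<pi> k) = ig (\<sigma> k)" if "k < 4" for k
      using that ri[OF bij_betwE[OF b, rule_format, of k]] by (simp add: \<pi>_def)
    have "\<pi> permutes {..<4}"
    proof (rule bij_imp_permutes)
      have "bij_betw (ir \<circ> (ig \<circ> \<sigma>)) {..<4} {..<4}" by (rule bij_betw_trans[OF b bir])
      then show "bij_betw \<pi> {..<4} {..<4}" by (rule bij_betw_cong[THEN iffD1, rotated]) (simp add: \<pi>_def)
    qed (simp add: \<pi>_def)
    moreover have "\<pi> \<noteq> id"
    proof
      assume id: "\<pi> = id"
      obtain i where i: "i \<in> ?I" "g i \<noteq> ?f i" using g(2) by blast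
      obtain k where k: "k < 4" "i = \<rho> k" using i(1) by auto
      have "\<rho> k = ig (\<sigma> k)" using rp[OF k(1)] id by simp
      then have "g i = \<sigma> k" using gi[of "\<sigma> k"] k by auto
      then show False using i(2) k ir by simp
    qed
    ultimately have "(\<Sum>k<4. B $$ (\<rho> k, \<sigma> k)) < (\<Sum>k<4. B $$ (\<rho> (\<pi> k), \<sigma> k))" using no by (meson not_le)
    also have "\<dots> = (\<Sum>k<4. B $$ ((ig \<circ> \<sigma>) k, g ((ig \<circ> \<sigma>) k)))"
      by (rule sum.cong) (use rp gi in auto)
    also have "\<dots> = (\<Sum>i\<in>?I. B $$ (i, g i))" by (rule sum.reindex_bij_betw[OF b])
    finally show ?thesis unfolding sf .
  qed
  then have "tropically_nonsingular (submatrix B ?I ?J)"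
    unfolding nonsingular_submatrix_iff[OF B a(2) card(1) a(4) card(2)] using bf by blast
  from tropical_rank_eqD(2)[OF B r a(2,4) _ this] card show False by simp
qed

lemma tropical_rank_3_lift3:
  fixes B :: "real mat"
  assumes F: "infinite (UNIV :: 'a::field set) \<or> card (UNIV :: 'a set) \<ge> 4"
    and B: "B \<in> carrier_mat 5 5" and r: "tropical_rank B = 3"
  shows "lift3 TYPE('a) (\<lambda>i j. B $$ (i, j))"
proof -
  let ?b = "\<lambda>i j. B $$ (i, j)"
  have r3: "rank3 ?b" by (rule tropical_rank_3_rank3[OF B r])
  obtain I J where IJ: "I \<subseteq> {..<5}" "J \<subseteq> {..<5}" "card I = 3" "card J = 3" "tropically_nonsingular (submatrix B I J)"
    using tropical_rank_eqD(1)[OF B r] by blast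
  obtain f where f: "bij_betw f I J"
    and m: "\<And>g. bij_betw g I J \<Longrightarrow> \<exists>i\<in>I. g i \<noteq> f i \<Longrightarrow> (\<Sum>i\<in>I. B $$ (i, f i)) < (\<Sum>i\<in>I. B $$ (i, g i))"
    using IJ(5) unfolding nonsingular_submatrix_iff[OF B IJ(1,3) IJ(2,4)] by blast
  have "finite I" using IJ(1) finite_subset by blast
  then have "bij_betw (pick I) {..<3} I" using bij_betw_pick[of I] IJ(3) by simp
  then obtain R :: "nat \<Rightarrow> nat" where R: "bij_betw R {..<3} I" ..
  define C where "C = f \<circ> R"
  have C: "bij_betw C {..<3} J" unfolding C_def by (rule bij_betw_trans[OF R f])
  define ir where "ir = inv_into {..<3} R"
  have ir: "ir (R k) = k" if "k < 3" for k using bij_betw_inv_into_left[OF R] that by (simp add: ir_def)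
  have bir: "bij_betw ir I {..<3}" unfolding ir_def by (rule bij_betw_inv_into[OF R])
  have H: "(\<Sum>k<3. ?b (R k) (C k)) < (\<Sum>k<3. ?b (R k) (C (\<tau> k)))" if t: "\<tau> ` {..<3} = {..<3}" "\<tau> 0 \<noteq> 0 \<or> \<tau> 1 \<noteq> 1" for \<tau> :: "nat \<Rightarrow> nat"
  proof -
    have bt: "bij_betw \<tau> {..<3} {..<3}" using t(1) eq_card_imp_inj_on[of "{..<3::nat}" \<tau>] by (simp add: bij_betw_def)
    have bg: "bij_betw (C \<circ> (\<tau> \<circ> ir)) I J" by (rule bij_betw_trans[OF bij_betw_trans[OF bir bt] C])
    have "\<exists>k<3. \<tau> k \<noteq> k" using t(2) by (elim disjE) (rule exI[of _ 0], simp, rule exI[of _ 1], simp)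
    then obtain k where k: "k < 3" "\<tau> k \<noteq> k" by blast
    have "C (\<tau> k) \<noteq> C k" using inj_onD[OF bij_betw_imp_inj_on[OF C], of "\<tau> k" k] k bij_betwE[OF bt] by auto
    then have "\<exists>i\<in>I. (C \<circ> (\<tau> \<circ> ir)) i \<noteq> f i"
      using bij_betwE[OF R] k(1) ir[OF k(1)] by (intro bexI[of _ "R k"]) (auto simp: C_def)
    from m[OF bg this] show ?thesis
      using sum.reindex_bij_betw[OF R, of "\<lambda>i. B $$ (i, f i)"] sum.reindex_bij_betw[OF R, of "\<lambda>i. B $$ (i, (C \<circ> (\<tau> \<circ> ir)) i)"]
      by (simp add: C_def ir)
  qed
  have three: "{..<3::nat} = {0,1,2}" by auto
  have R': "inj_on R {..<3}" "\<And>k. k < 3 \<Longrightarrow> R k < 5" and C': "inj_on C {..<3}" "\<And>k. k < 3 \<Longrightarrow> C k < 5"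
    using R C IJ(1,2) unfolding bij_betw_def by auto
  define w where "w k l = ?b (R k) (C l) - ?b (R l) (C l)" for k l
  \<comment> \<open>One inequality for each of the five permutations of the minor other than the
    identity.\<close>
  have t1: "w 0 1 + w 1 0 > 0" using H[of "\<lambda>k. if k = 0 then 1 else if k = 1 then 0 else k"] by (simp add: three w_def insert_commute)
  have t2: "w 0 2 + w 2 0 > 0" using H[of "\<lambda>k. if k = 0 then 2 else if k = 2 then 0 else k"] by (simp add: three w_def insert_commute)
  have t3: "w 1 2 + w 2 1 > 0" using H[of "\<lambda>k. if k = 1 then 2 else if k = 2 then 1 else k"] by (simp add: three w_def insert_commute)
  have t4: "w 0 1 + w 1 2 + w 2 0 > 0" using H[of "\<lambda>k. if k = 0 then 1 else if k = 1 then 2 else 0"] by (simp add: three w_def insert_commute)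
  have t5: "w 0 2 + w 2 1 + w 1 0 > 0" using H[of "\<lambda>k. if k = 0 then 2 else if k = 1 then 0 else 1"] by (simp add: three w_def insert_commute)
  obtain r c x y where n: "nf ?b r c x y" "\<forall>i<5. r i < 3 \<and> c i < 3" "\<forall>k<3. r (R k) = k \<and> c (C k) = k"
    using nf_exists[OF r3 R' C' w_def t1 t2 t3 t4 t5] by blast
  show ?thesis by (rule nf_lift[OF F r3 n(1,2) R' _ C']) (use n(3) in auto)
qed

lemma rank_sum_rank_one:
  fixes M N :: "nat \<Rightarrow> nat \<Rightarrow> 'b::field"
  shows "vec_space.rank n (mat n m (\<lambda>(i,j). \<Sum>k<r. M i k * N k j)) \<le> r"
proof (induction r)
  case 0
  have z0: "mat n m (\<lambda>(i,j). \<Sum>k<0::nat. M i k * N k j) = 0\<^sub>m n m" by (rule eq_matI) auto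
  show ?case unfolding z0 by (simp only: vec_space.rank_0I order_refl)
next
  case (Suc r)
  let ?A = "mat n m (\<lambda>(i,j). \<Sum>k<r. M i k * N k j)" and ?C = "mat n m (\<lambda>(i,j). M i r * N r j)"
  have e: "mat n m (\<lambda>(i,j). \<Sum>k<Suc r. M i k * N k j) = ?A + ?C" by (rule eq_matI) auto
  have "vec_space.rank n ?C \<le> 1"
    by (rule vec_space.rank_le_1_product_entries[of _ n m "\<lambda>i. M i r" "N r"]) auto
  moreover have "vec_space.rank n (?A + ?C) \<le> vec_space.rank n ?A + vec_space.rank n ?C"
    by (rule vec_space.rank_subadditive[of _ n m]) auto
  ultimately show ?case using Suc.IH unfolding e by simp
qed

lemma kapranov_rank_le:
  fixes B :: "real mat" and M N :: "nat \<Rightarrow> nat \<Rightarrow> 'a::field hahn"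
  assumes B: "B \<in> carrier_mat n m" and h: "\<And>i j. i < n \<Longrightarrow> j < m \<Longrightarrow> hval (\<Sum>k<r. M i k * N k j) (B $$ (i, j))"
  shows "kapranov_rank TYPE('a) B \<le> r"
proof -
  let ?A = "mat n m (\<lambda>(i,j). \<Sum>k<r. M i k * N k j)"
  have "map_mat hdeg ?A = B" by (rule eq_matI) (use B h in \<open>auto simp: hval_def\<close>)
  then have "kapranov_rank TYPE('a) B \<le> vec_space.rank n ?A"
    unfolding kapranov_rank_def by (intro Least_le exI[of _ ?A]) (use B h in \<open>auto simp: hval_def\<close>)
  also have "\<dots> \<le> r" by (rule rank_sum_rank_one)
  finally show ?thesis .
qed

lemma small_field_if_gap:
  fixes B :: "real mat"
  assumes B: "B \<in> carrier_mat 5 5" "tropical_rank B = 3" "kapranov_rank TYPE('a::field) B = 4"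
  shows "finite (UNIV :: 'a set) \<and> card (UNIV :: 'a set) \<le> 3"
proof (rule ccontr)
  assume "\<not> ?thesis"
  then have F: "infinite (UNIV :: 'a set) \<or> card (UNIV :: 'a set) \<ge> 4" by auto
  from tropical_rank_3_lift3[OF F B(1,2)] obtain M N :: "nat \<Rightarrow> nat \<Rightarrow> 'a hahn"
    where "\<forall>i<5. \<forall>j<5. hval (\<Sum>k<3. M i k * N k j) (B $$ (i, j))" unfolding lift3_def by blast
  then have "kapranov_rank TYPE('a) B \<le> 3" by (intro kapranov_rank_le[where r=3 and M=M and N=N, OF B(1)]) simp
  then show False using B(3) by simp
qed

section \<open>Residues over fields with two or three elements\<close>

lemma field_two_elements:
  assumes "card (UNIV :: 'a::field set) = 2"
  shows "(x :: 'a) = 0 \<or> x = 1" "(1 :: 'a) + 1 = 0"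
proof -
  have f: "finite (UNIV :: 'a set)" by (rule card_ge_0_finite) (simp add: assms)
  have U: "{0, 1} = (UNIV :: 'a set)" by (rule card_subset_eq[OF f]) (simp_all add: assms)
  then have *: "y = 0 \<or> y = 1" for y :: 'a by (metis UNIV_I insert_iff singletonD)
  then show "x = 0 \<or> x = 1" by blast
  have "(1 :: 'a) + 1 \<noteq> 1" by (metis add_cancel_left_right zero_neq_one)
  then show "(1 :: 'a) + 1 = 0" using *[of "1 + 1"] by blast
qed

lemma field_three_elements:
  assumes "card (UNIV :: 'a::field set) = 3"
  shows "(x :: 'a) = 0 \<or> x = 1 \<or> x = - 1" "(1 :: 'a) + 1 = - 1" "(1 :: 'a) \<noteq> - 1"
proof -
  have f: "finite (UNIV :: 'a set)" by (rule card_ge_0_finite) (simp add: assms)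
  have "\<exists>a :: 'a. a \<notin> {0, 1}"
  proof (rule ccontr)
    assume "\<not> ?thesis"
    then have "(UNIV :: 'a set) = {0, 1}" by auto
    moreover have "card {0, 1 :: 'a} = 2" by simp
    ultimately show False using assms by simp
  qed
  then obtain a :: 'a where a: "a \<noteq> 0" "a \<noteq> 1" by blast
  have U: "{0, 1, a} = (UNIV :: 'a set)" by (rule card_subset_eq[OF f]) (use a in \<open>simp_all add: assms\<close>)
  then have *: "y = 0 \<or> y = 1 \<or> y = a" for y :: 'a by (metis UNIV_I insert_iff singletonD)
  have "a + 1 = 0" using *[of "a + 1"] a by auto
  then have am: "a = - 1" by (simp add: eq_neg_iff_add_eq_0)
  show "x = 0 \<or> x = 1 \<or> x = - 1" using * am by blast
  show n: "(1 :: 'a) \<noteq> - 1" using a am by simp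
  have "(1 :: 'a) + 1 \<noteq> 1" by (metis add_cancel_left_right zero_neq_one)
  moreover have "(1 :: 'a) + 1 \<noteq> 0" using n by (metis eq_neg_iff_add_eq_0)
  ultimately show "(1 :: 'a) + 1 = - 1" using *[of "1 + 1"] am by blast
qed

text \<open>Deleting row \<open>i0\<close> and column \<open>j0\<close> leaves a singular matrix.
  Kernel vectors pass to residues more directly than determinants and give short linear
  systems.\<close>

definition null_vectors :: "(nat \<Rightarrow> nat \<Rightarrow> 'a::field) \<Rightarrow> bool" where
  "null_vectors r \<longleftrightarrow> (\<forall>i0<5. \<forall>j0<5. \<exists>w. w j0 = 0 \<and> (\<exists>j<5. w j \<noteq> 0) \<and>
     (\<forall>i<5. i \<noteq> i0 \<longrightarrow> (\<Sum>j<5. r i j * w j) = 0))"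

text \<open>Let \<open>m\<close> be the least degree of the entries of a kernel vector over the Hahn
  field. As the matrix has order at least 0, the coefficients at \<open>m\<close> form a kernel
  vector of the residues, nonzero by the choice of \<open>m\<close>.\<close>

lemma residue_null_vectors:
  fixes A :: "'a::field hahn mat"
  assumes A: "A \<in> carrier_mat 5 5" and rk: "vec_space.rank 5 A \<le> 3" and v0: "\<And>i j. i < 5 \<Longrightarrow> j < 5 \<Longrightarrow> vge 0 (A $$ (i, j))"
  shows "null_vectors (\<lambda>i j. hcoeff (A $$ (i, j)) 0)"
  unfolding null_vectors_def
proof (intro allI impI)
  fix i0 j0 :: nat assume ij: "i0 < 5" "j0 < 5"
  let ?I = "{..<5} - {i0}" and ?J = "{..<5} - {j0}"
  let ?S = "submatrix A ?I ?J"
  have card: "card ?I = 4" "card ?J = 4" using ij by simp_all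
  have p: "bij_betw (pick ?I) {..<4} ?I" and q: "bij_betw (pick ?J) {..<4} ?J"
    using bij_betw_pick[of ?I] bij_betw_pick[of ?J] card by simp_all
  have c: "{i. i < dim_row A \<and> i \<in> ?I} = ?I" "{j. j < dim_col A \<and> j \<in> ?J} = ?J" "{j. j < 5 \<and> j \<in> ?J} = ?J" using A by auto
  have S: "?S \<in> carrier_mat 4 4" unfolding carrier_mat_def by (simp only: dim_submatrix c card mem_Collect_eq simp_thms)
  have ent: "?S $$ (k, l) = A $$ (pick ?I k, pick ?J l)" if "k < 4" "l < 4" for k l
    using submatrix_index[of k A ?I l ?J] that unfolding c card by simp
  have "det ?S = 0"
  proof (rule ccontr)
    assume "det ?S \<noteq> 0"
    from vec_space.rank_gt_minor[OF A this] rk show False unfolding c card by simp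
  qed
  then obtain v where v: "v \<in> carrier_vec 4" "v \<noteq> 0\<^sub>v 4" "?S *\<^sub>v v = 0\<^sub>v 4"
    using det_0_iff_vec_prod_zero_field[OF S] by blast
  define iq where "iq = inv_into {..<4} (pick ?J)"
  have iq: "iq (pick ?J l) = l" if "l < 4" for l using bij_betw_inv_into_left[OF q] that by (simp add: iq_def)
  define V where "V j = (if j = j0 then 0 else v $ iq j)" for j
  have Vq: "V (pick ?J l) = v $ l" "pick ?J l < 5" "pick ?J l \<noteq> j0" if "l < 4" for l
    using iq[OF that] bij_betwE[OF q, rule_format, of l] that by (auto simp: V_def)
  have eq: "(\<Sum>j<5. A $$ (i, j) * V j) = 0" if i: "i < 5" "i \<noteq> i0" for i
  proof -
    obtain k where k: "k < 4" "i = pick ?I k" using i bij_betw_imp_surj_on[OF p] by blast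
    have "(\<Sum>j<5. A $$ (i, j) * V j) = (\<Sum>j\<in>?J. A $$ (i, j) * V j)"
      by (rule sum.mono_neutral_right) (auto simp: V_def)
    also have "\<dots> = (\<Sum>l<4. A $$ (i, pick ?J l) * V (pick ?J l))"
      using sum.reindex_bij_betw[OF q, of "\<lambda>j. A $$ (i, j) * V j"] by simp
    also have "\<dots> = (\<Sum>l<4. ?S $$ (k, l) * v $ l)" by (rule sum.cong) (use Vq ent[OF k(1)] k in simp_all)
    also have "\<dots> = (?S *\<^sub>v v) $ k" using S v(1) k(1) by (simp add: scalar_prod_def atLeast0LessThan)
    also have "\<dots> = 0" unfolding v(3) using k(1) by simp
    finally show ?thesis .
  qed
  have "\<exists>l<4. v $ l \<noteq> 0" using v(1,2) by (metis carrier_vecD dim_vec eq_vecI index_zero_vec)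
  then obtain l where l: "l < 4" "v $ l \<noteq> 0" by blast
  let ?N = "{j. j < 5 \<and> V j \<noteq> 0}"
  define m where "m = Min (hdeg ` V ` ?N)"
  have ne: "?N \<noteq> {}" using Vq[OF l(1)] l(2) by auto
  have fin: "finite (hdeg ` V ` ?N)" by simp
  have "m \<in> hdeg ` V ` ?N" unfolding m_def by (rule Min_in[OF fin]) (use ne in simp)
  then obtain j1 where j1: "j1 < 5" "V j1 \<noteq> 0" "hdeg (V j1) = m" by auto
  have Vm: "vge m (V j)" if "j < 5" for j
  proof (cases "V j = 0")
    case False
    then have "m \<le> hdeg (V j)" unfolding m_def using that by (intro Min_le[OF fin]) auto
    then show ?thesis using hval_vge[of "V j" "hdeg (V j)" m] False by (simp add: hval_def)
  qed simp
  have "hcoeff (V j1) m \<noteq> 0" using j1 hval_iff[of "V j1" m] by (simp add: hval_def)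
  then have A2: "\<exists>j<5. hcoeff (V j) m \<noteq> 0" using j1(1) by blast
  have A3: "(\<Sum>j<5. hcoeff (A $$ (i, j)) 0 * hcoeff (V j) m) = 0" if i: "i < 5" "i \<noteq> i0" for i
  proof -
    have "(\<Sum>j<5. hcoeff (A $$ (i, j)) 0 * hcoeff (V j) m) = (\<Sum>j<5. hcoeff (A $$ (i, j) * V j) m)"
      by (rule sum.cong) (use hcoeff_mult_lead[OF v0[OF i(1)] Vm] in simp_all)
    also have "\<dots> = hcoeff (\<Sum>j<5. A $$ (i, j) * V j) m" by simp
    also have "\<dots> = 0" unfolding eq[OF i] by simp
    finally show ?thesis .
  qed
  have "hcoeff (V j0) m = 0" by (simp add: V_def)
  with A2 A3 have "hcoeff (V j0) m = 0 \<and> (\<exists>j<5. hcoeff (V j) m \<noteq> 0) \<and>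
     (\<forall>i<5. i \<noteq> i0 \<longrightarrow> (\<Sum>j<5. hcoeff (A $$ (i, j)) 0 * hcoeff (V j) m) = 0)" by simp
  then show "\<exists>w. w j0 = 0 \<and> (\<exists>j<5. w j \<noteq> 0) \<and> (\<forall>i<5. i \<noteq> i0 \<longrightarrow> (\<Sum>j<5. hcoeff (A $$ (i, j)) 0 * w j) = 0)"
    by (rule exI[of _ "\<lambda>j. hcoeff (V j) m"])
qed

text \<open>For nonnegative \<open>B\<close> the residues of a lift are nonzero exactly at the zeros
  of \<open>B\<close>, so a lift of rank at most 3 would give \<open>null_vectors\<close> with that
  support.\<close>

lemma kapranov_rank_ge_4:
  fixes B :: "real mat"
  assumes B: "B \<in> carrier_mat 5 5" and nn: "\<And>i j. i < 5 \<Longrightarrow> j < 5 \<Longrightarrow> B $$ (i, j) \<ge> 0"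
    and no: "\<And>r :: nat \<Rightarrow> nat \<Rightarrow> 'a::field. null_vectors r \<Longrightarrow> (\<And>i j. i < 5 \<Longrightarrow> j < 5 \<Longrightarrow> r i j \<noteq> 0 \<longleftrightarrow> B $$ (i, j) = 0) \<Longrightarrow> False"
  shows "kapranov_rank TYPE('a) B \<ge> 4"
proof (rule ccontr)
  assume less: "\<not> ?thesis"
  obtain A :: "'a hahn mat" where A: "A \<in> carrier_mat 5 5" "\<And>i j. i < 5 \<Longrightarrow> j < 5 \<Longrightarrow> A $$ (i, j) \<noteq> 0" "map_mat hdeg A = B"
    and rk: "vec_space.rank 5 A = kapranov_rank TYPE('a) B"
    using kapranov_rank_attained[of B, where 'a='a] B by auto
  have h: "hval (A $$ (i, j)) (B $$ (i, j))" if "i < 5" "j < 5" for i j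
    using A(1) A(2)[OF that] that unfolding A(3)[symmetric] hval_def by auto
  have n: "null_vectors (\<lambda>i j. hcoeff (A $$ (i, j)) 0)"
  proof (rule residue_null_vectors[OF A(1)])
    show "vec_space.rank 5 A \<le> 3" using rk less by simp
    show "vge 0 (A $$ (i, j))" if "i < 5" "j < 5" for i j by (rule hval_vge[OF h[OF that] nn[OF that]])
  qed
  show False
  proof (rule no[OF n])
    fix i j :: nat assume ij: "i < 5" "j < 5"
    show "hcoeff (A $$ (i, j)) 0 \<noteq> 0 \<longleftrightarrow> B $$ (i, j) = 0"
    proof (cases "B $$ (i, j) = 0")
      case True
      then show ?thesis using h[OF ij] by (simp add: hval_iff)
    next
      case False
      then show ?thesis using hcoeff_lead_eq_0[OF h[OF ij], of 0] nn[OF ij] by simp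
    qed
  qed
qed

section \<open>The 0/1 matrices for two and three elements\<close>

definition zmat :: "nat list list \<Rightarrow> real mat" where
  "zmat Z = mat 5 5 (\<lambda>(i, j). if j \<in> set (Z ! i) then 0 else 1)"

fun matchings :: "nat list list \<Rightarrow> nat list \<Rightarrow> nat list \<Rightarrow> nat list list" where
  "matchings Z [] ys = [[]]"
| "matchings Z (x # xs) ys = concat (map (\<lambda>y. if y \<in> set ys then map ((#) y) (matchings Z xs (remove1 y ys)) else []) (Z ! x))"

lemma matchingsD:
  "p \<in> set (matchings Z xs ys) \<Longrightarrow> distinct ys \<Longrightarrow>
    length p = length xs \<and> distinct p \<and> set p \<subseteq> set ys \<and> (\<forall>k<length xs. p ! k \<in> set (Z ! (xs ! k)))"
proof (induction Z xs ys arbitrary: p rule: matchings.induct)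
  case (2 Z x xs ys)
  then obtain y p' where p: "p = y # p'" "y \<in> set ys" "y \<in> set (Z ! x)" "p' \<in> set (matchings Z xs (remove1 y ys))"
    by (auto split: if_splits)
  have "length p' = length xs \<and> distinct p' \<and> set p' \<subseteq> set (remove1 y ys) \<and> (\<forall>k<length xs. p' ! k \<in> set (Z ! (xs ! k)))"
    by (rule "2.IH"[OF p(3) p(2) p(4)]) (simp add: "2.prems"(2))
  then show ?case using p "2.prems"(2) by (auto simp: nth_Cons split: nat.splits)
qed simp

definition two_matchings :: "nat list list \<Rightarrow> nat list \<Rightarrow> nat list \<Rightarrow> bool" where
  "two_matchings Z xs ys \<longleftrightarrow> (case matchings Z xs ys of p # q # _ \<Rightarrow> p \<noteq> q | _ \<Rightarrow> False)"

text \<open>Ranges over all submatrices of size 4 and 5 in executable form, to be decided by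
  evaluation.\<close>

definition all_two_matchings :: "nat list list \<Rightarrow> bool" where
  "all_two_matchings Z \<longleftrightarrow> list_all (\<lambda>xs. list_all (\<lambda>ys. length xs = length ys \<and> 4 \<le> length xs \<longrightarrow> two_matchings Z xs ys)
     (subseqs [0,1,2,3,4])) (subseqs [0,1,2,3,4])"

text \<open>A matching of zeros has weight 0, the least possible, so two of them contradict a unique
  minimum.\<close>

lemma zmat_singular:
  assumes a: "all_two_matchings Z" and I: "I \<subseteq> {..<5}" "J \<subseteq> {..<5}" "card I = card J" "3 < card I"
  shows "\<not> tropically_nonsingular (submatrix (zmat Z) I J)"
proof
  assume ns: "tropically_nonsingular (submatrix (zmat Z) I J)"
  have five: "set [0,1,2,3,4::nat] = {..<5}" by auto
  have "I \<in> set ` set (subseqs [0,1,2,3,4])" "J \<in> set ` set (subseqs [0,1,2,3,4])"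
    unfolding subseqs_powset five using I by (simp_all only: Pow_iff)
  then obtain xs ys where xs: "xs \<in> set (subseqs [0,1,2,3,4])" "I = set xs" and ys: "ys \<in> set (subseqs [0,1,2,3,4])" "J = set ys"
    by blast
  have d: "distinct xs" "distinct ys" by (rule subseqs_distinctD[OF xs(1)], simp, rule subseqs_distinctD[OF ys(1)], simp)
  have len: "length xs = length ys" "4 \<le> length xs" using I d xs ys by (simp_all add: distinct_card)
  have "two_matchings Z xs ys" using a xs(1) ys(1) len unfolding all_two_matchings_def list_all_iff by blast
  then obtain p q where pq: "p \<in> set (matchings Z xs ys)" "q \<in> set (matchings Z xs ys)" "p \<noteq> q"
    unfolding two_matchings_def by (auto split: list.splits)
  have B: "zmat Z \<in> carrier_mat 5 5" by (simp add: zmat_def)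
  have nn: "zmat Z $$ (i, j) \<ge> 0" if "i \<in> I" "j \<in> J" for i j
  proof -
    have "i < 5" "j < 5" using that I by auto
    then show ?thesis by (simp add: zmat_def)
  qed
  define f where "f p i = the (map_of (zip xs p) i)" for p :: "nat list" and i
  have fn: "f p (xs ! k) = p ! k" if "length p = length xs" "k < length xs" for p k
    using that d(1) by (simp add: f_def map_of_zip_nth)
  have bf: "bij_betw (f p) I J" "(\<Sum>i\<in>I. zmat Z $$ (i, f p i)) = 0" if "p \<in> set (matchings Z xs ys)" for p
  proof -
    note P = matchingsD[OF that d(2)]
    have Pl: "length p = length xs" using P by blast
    have "f p ` I = (\<lambda>k. f p (xs ! k)) ` {..<length xs}" unfolding xs(2) set_conv_nth by blast
    also have "\<dots> = (\<lambda>k. p ! k) ` {..<length xs}" by (rule image_cong) (simp_all add: fn[OF Pl])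
    also have "\<dots> = set p" unfolding set_conv_nth Pl by blast
    finally have im: "f p ` I = set p" .
    have "set p = J" unfolding ys(2) by (rule card_subset_eq) (use P len d in \<open>auto simp: distinct_card\<close>)
    moreover have "inj_on (f p) I" by (rule eq_card_imp_inj_on) (use im P d xs in \<open>simp_all add: distinct_card\<close>)
    ultimately show "bij_betw (f p) I J" using im by (simp add: bij_betw_def)
    show "(\<Sum>i\<in>I. zmat Z $$ (i, f p i)) = 0"
    proof (rule sum.neutral, intro ballI)
      fix i assume i: "i \<in> I"
      then obtain k where k: "k < length xs" "i = xs ! k" unfolding xs(2) by (auto simp: in_set_conv_nth)
      have "f p i \<in> set (Z ! i)" unfolding k(2) fn[OF Pl k(1)] using P k by blast
      moreover have "f p i < 5" "i < 5" using im i \<open>set p = J\<close> I by auto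
      ultimately show "zmat Z $$ (i, f p i) = 0" by (simp add: zmat_def)
    qed
  qed
  obtain F where F: "bij_betw F I J" and m: "\<And>g. bij_betw g I J \<Longrightarrow> \<exists>i\<in>I. g i \<noteq> F i \<Longrightarrow> (\<Sum>i\<in>I. zmat Z $$ (i, F i)) < (\<Sum>i\<in>I. zmat Z $$ (i, g i))"
    using ns unfolding nonsingular_submatrix_iff[OF B I(1) refl I(2) I(3)[symmetric]] by blast
  have F0: "(\<Sum>i\<in>I. zmat Z $$ (i, F i)) \<ge> 0" by (rule sum_nonneg) (use nn bij_betwE[OF F] in blast)
  have fF: "f p i = F i" if "p \<in> set (matchings Z xs ys)" "i \<in> I" for p i 
  proof (rule ccontr)
    assume "f p i \<noteq> F i"
    with that(2) have "\<exists>i\<in>I. f p i \<noteq> F i" by blast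
    from m[OF bf(1)[OF that(1)] this] bf(2)[OF that(1)] F0 show False by linarith
  qed
  have e: "f p i = f q i" if "i \<in> I" for i using fF[OF pq(1) that] fF[OF pq(2) that] by simp
  have "p = q"
  proof (rule nth_equalityI)
    show l: "length p = length q" using matchingsD[OF pq(1) d(2)] matchingsD[OF pq(2) d(2)] by simp
    fix k assume k: "k < length p"
    then have "k < length xs" using matchingsD[OF pq(1) d(2)] by simp
    then show "p ! k = q ! k" using fn[of p k] fn[of q k] e[of "xs ! k"] matchingsD[OF pq(1) d(2)] matchingsD[OF pq(2) d(2)] xs(2) by simp
  qed
  with pq(3) show False by simp
qed

text \<open>A minor whose zeros are the graph of a bijection is non-singular, every other bijection
  having positive weight.\<close>

lemma zmat_tropical_rank:
  assumes a: "all_two_matchings Z" and I: "I \<subseteq> {..<5}" "card I = 3" and f: "bij_betw f I J" and J: "J \<subseteq> {..<5}"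
    and z: "\<And>i j. i \<in> I \<Longrightarrow> j \<in> J \<Longrightarrow> j \<in> set (Z ! i) \<longleftrightarrow> j = f i"
  shows "tropical_rank (zmat Z) = 3"
proof (rule tropical_rank_eqI[OF _ I(1) J I(2)])
  show B: "zmat Z \<in> carrier_mat 5 5" by (simp add: zmat_def)
  show cJ: "card J = 3" using bij_betw_same_card[OF f] I(2) by simp
  have e: "zmat Z $$ (i, j) = (if j = f i then 0 else 1)" if "i \<in> I" "j \<in> J" for i j
  proof -
    have "i < 5" "j < 5" using that I(1) J by auto
    then show ?thesis using z[OF that] by (simp add: zmat_def)
  qed
  have fin: "finite I" using I(1) finite_subset by blast
  have 0: "(\<Sum>i\<in>I. zmat Z $$ (i, f i)) = 0" by (rule sum.neutral) (use e bij_betwE[OF f] in auto)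
  have "(\<Sum>i\<in>I. zmat Z $$ (i, f i)) < (\<Sum>i\<in>I. zmat Z $$ (i, g i))" if g: "bij_betw g I J" "\<exists>i\<in>I. g i \<noteq> f i" for g
  proof -
    obtain i where i: "i \<in> I" "g i \<noteq> f i" using g(2) by blast
    have "0 < (\<Sum>i\<in>I. zmat Z $$ (i, g i))"
      by (rule sum_pos2[OF fin i(1)]) (use e i bij_betwE[OF g(1)] in auto)
    then show ?thesis using 0 by simp
  qed
  then show "tropically_nonsingular (submatrix (zmat Z) I J)"
    unfolding nonsingular_submatrix_iff[OF B I J cJ] using f by blast
qed (rule zmat_singular[OF a])

text \<open>The last two rows coincide, and so do columns 2 and 3. The underlying 4 by 4 pattern has
  three matchings of zeros, so with all nonzero residues equal to 1 its determinant over two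
  elements is 1 + 1 + 1 = 1.\<close>

definition Z2 :: "nat list list" where
  "Z2 = [[0,1,2,3],[0,4],[1,4],[2,3,4],[2,3,4]]"

text \<open>Rows 2 to 4 carry the three pairs of columns 1 to 3, row 0 carries all three of them.
  Over three elements a vanishing sum of three nonzero terms has equal terms, which makes the
  residues rigid enough for a contradiction.\<close>

definition Z3 :: "nat list list" where
  "Z3 = [[0,1,2,3],[0,4],[1,2,4],[1,3,4],[2,3,4]]"

lemma all_two_matchings_Z2: "all_two_matchings Z2"
  by code_simp

lemma all_two_matchings_Z3: "all_two_matchings Z3"
  by code_simp

lemma tropical_rank_Z2: "tropical_rank (zmat Z2) = 3"
proof (rule zmat_tropical_rank[OF all_two_matchings_Z2])
  show "bij_betw (\<lambda>i. i - 1) {1,2,3} {0,1,2::nat}" by (auto simp: bij_betw_def inj_on_def)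
qed (auto simp: Z2_def)

lemma tropical_rank_Z3: "tropical_rank (zmat Z3) = 3"
proof (rule zmat_tropical_rank[OF all_two_matchings_Z3])
  show "bij_betw (\<lambda>i. if i = 1 then 0 else i - 2) {1,3,4} {0,1,2::nat}"
    unfolding bij_betw_def by (simp add: inj_on_def) blast
  show "j \<in> set (Z3 ! i) \<longleftrightarrow> j = (if i = 1 then 0 else i - 2)" if "i \<in> {1,3,4}" "j \<in> {0,1,2}" for i j
    using that by (elim insertE emptyE) (simp_all add: Z3_def)
qed simp_all

lemma sum_lessThan_4: "(\<Sum>k<4. f k) = f 0 + f 1 + f 2 + f (3::nat)"
  by (simp add: eval_nat_numeral)

text \<open>The lift by monomials has only four different columns; index 3 of the factorisation
  stands for column 4.\<close>

lemma kapranov_rank_Z2_le: "kapranov_rank TYPE('a::field) (zmat Z2) \<le> 4"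
proof (rule kapranov_rank_le[of _ 5 5])
  let ?M = "\<lambda>i k. hmonom (1::'a) (zmat Z2 $$ (i, if k = 3 then 4 else k))"
  let ?N = "\<lambda>k j. if k = (if j < 3 then j else if j = 3 then 2 else 3) then 1 else 0 :: 'a hahn"
  fix i j :: nat assume ij: "i < 5" "j < 5"
  have "(\<Sum>k<4. ?M i k * ?N k j) = hmonom 1 (zmat Z2 $$ (i, j))"
    using ij unfolding sum_lessThan_4 less_5_cases by (elim disjE) (simp_all add: zmat_def Z2_def)
  then show "hval (\<Sum>k<4. ?M i k * ?N k j) (zmat Z2 $$ (i, j))" using hval_hmonom[of "1::'a"] by simp
qed (simp add: zmat_def)

text \<open>Column 4 is the sum of columns 0 to 2. In row 0 this is 1 + 1 + (1 + t) = t in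
  characteristic 3, of degree 1 as wanted; in the other rows the residues add up to 1 or 2.\<close>

lemma kapranov_rank_Z3_le:
  assumes c: "card (UNIV :: 'a::field set) = 3"
  shows "kapranov_rank TYPE('a) (zmat Z3) \<le> 4"
proof (rule kapranov_rank_le[of _ 5 5])
  note F = field_three_elements[OF c]
  let ?t = "hmonom (1::'a) 1"
  let ?M = "\<lambda>i k. if i = 0 \<and> k = 2 then 1 + ?t else if k \<in> set (Z3 ! i) then 1 else ?t"
  let ?N = "\<lambda>k j. if k = j \<or> j = 4 \<and> k < 3 then 1 else 0 :: 'a hahn"
  have t: "lead 0 ?t 0" by (rule lead_vge[OF vge_hmonom[OF order_refl]]) simp
  have t1: "hval ?t 1" by (rule hval_hmonom) simp
  note l1 = lead_one[where 'a='a]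
  have h1: "hval (1 + ?t) 0" by (rule lead_hval[OF lead_add[OF l1 t]]) simp
  have add: "hmonom a x + hmonom b x = hmonom (a + b) x" for a b :: 'a and x by (rule hahn_eqI) (simp add: hmonom.rep_eq)
  have n2: "(0::'a) + 1 + 1 \<noteq> 0" unfolding add_0 F(2) by simp
  have three: "1 + 1 + (1 + ?t) = ?t"
  proof -
    have "(1::'a) + 1 + 1 = 0" using F(2) by simp
    moreover have "hmonom (1::'a) 0 + hmonom 1 0 + hmonom 1 0 = hmonom (1 + 1 + 1) 0" by (simp only: add)
    ultimately have "(1 :: 'a hahn) + 1 + 1 = hmonom 0 0" unfolding hmonom_1_0[symmetric] by simp
    moreover have "hmonom (0::'a) 0 = 0" by (rule hahn_eqI) (simp add: hmonom.rep_eq)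
    ultimately show ?thesis by (metis add.assoc add_0)
  qed
  have r1: "hval (1 + ?t + ?t) 0" by (rule lead_hval[OF lead_add[OF lead_add[OF l1 t] t]]) simp
  have r2: "hval (?t + 1 + 1) 0" by (rule lead_hval[OF lead_add[OF lead_add[OF t l1] l1] n2])
  have r3: "hval (?t + 1 + ?t) 0" by (rule lead_hval[OF lead_add[OF lead_add[OF t l1] t]]) simp
  have r4: "hval (?t + ?t + 1) 0" by (rule lead_hval[OF lead_add[OF lead_add[OF t t] l1]]) simp
  fix i j :: nat assume ij: "i < 5" "j < 5"
  have "j < 4 \<or> j = 4" using ij by auto
  then show "hval (\<Sum>k<4. ?M i k * ?N k j) (zmat Z3 $$ (i, j))"
  proof
    assume j: "j = 4"
    have s: "(\<Sum>k<4. ?M i k * ?N k j) = ?M i 0 + ?M i 1 + ?M i 2" unfolding sum_lessThan_4 j by simp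
    have row: ?thesis if "?M i 0 = a" "?M i 1 = b" "?M i 2 = c" "zmat Z3 $$ (i, 4) = d" "hval (a + b + c) d" for a b c d
      unfolding s using that unfolding j by (simp only:)
    from ij(1) show ?thesis unfolding less_5_cases
    proof (elim disjE)
      assume i: "i = 0"
      show ?thesis by (rule row[of 1 1 "1 + ?t" 1]) (simp_all only: three t1, simp_all add: i Z3_def zmat_def)
    next
      assume i: "i = 1"
      show ?thesis by (rule row[OF _ _ _ _ r1]) (simp_all add: i Z3_def zmat_def)
    next
      assume i: "i = 2"
      show ?thesis by (rule row[OF _ _ _ _ r2]) (simp_all add: i Z3_def zmat_def)
    next
      assume i: "i = 3"
      show ?thesis by (rule row[OF _ _ _ _ r3]) (simp_all add: i Z3_def zmat_def)
    next
      assume i: "i = 4"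
      show ?thesis by (rule row[OF _ _ _ _ r4]) (simp_all add: i Z3_def zmat_def)
    qed
  next
    assume j: "j < 4"
    then have "j = 0 \<or> j = 1 \<or> j = 2 \<or> j = 3" by auto
    then have s: "(\<Sum>k<4. ?M i k * ?N k j) = ?M i j" unfolding sum_lessThan_4 by (elim disjE) simp_all
    have z: "zmat Z3 $$ (i, j) = (if j \<in> set (Z3 ! i) then 0 else 1)" using ij by (simp add: zmat_def)
    have "2 \<in> set (Z3 ! 0)" by (simp add: Z3_def)
    then show ?thesis unfolding s z using h1 t1 hval_one[where 'a='a] by auto
  qed
qed (simp add: zmat_def)

lemma zmat_residue:
  assumes "null_vectors r" and r: "\<And>i j. i < 5 \<Longrightarrow> j < 5 \<Longrightarrow> r i j \<noteq> 0 \<longleftrightarrow> zmat Z $$ (i, j) = 0"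
    and ij: "i0 < 5" "j0 < 5"
  obtains w where "w j0 = 0" "\<exists>j<5. w j \<noteq> 0"
    "\<And>i. i < 5 \<Longrightarrow> i \<noteq> i0 \<Longrightarrow> (\<Sum>j<5. if j \<in> set (Z ! i) then r i j * w j else 0) = 0"
proof -
  obtain w where w: "w j0 = 0" "\<exists>j<5. w j \<noteq> 0" "\<forall>i<5. i \<noteq> i0 \<longrightarrow> (\<Sum>j<5. r i j * w j) = 0"
    using assms(1) ij unfolding null_vectors_def by blast
  have "(\<Sum>j<5. if j \<in> set (Z ! i) then r i j * w j else 0) = (\<Sum>j<5. r i j * w j)" if "i < 5" for i
  proof (rule sum.cong)
    fix j assume "j \<in> {..<5::nat}"
    then have j: "j < 5" by simp
    show "(if j \<in> set (Z ! i) then r i j * w j else 0) = r i j * w j"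
      using r[OF that j] that j by (auto simp: zmat_def)
  qed simp
  then show thesis using that w by simp
qed

text \<open>Rows 1 to 3 make the entries 0, 1, 2 of the null vector equal to its entry 4; row 0 then
  adds three equal terms, which over two elements vanish only if they are 0.\<close>

lemma kapranov_rank_Z2_ge:
  assumes c: "card (UNIV :: 'a::field set) = 2"
  shows "kapranov_rank TYPE('a) (zmat Z2) \<ge> 4"
proof (rule kapranov_rank_ge_4)
  fix r :: "nat \<Rightarrow> nat \<Rightarrow> 'a"
  assume n: "null_vectors r" and r: "\<And>i j. i < 5 \<Longrightarrow> j < 5 \<Longrightarrow> r i j \<noteq> 0 \<longleftrightarrow> zmat Z2 $$ (i, j) = 0"
  note F = field_two_elements[OF c]
  have one: "r i j = 1" if "i < 5" "j < 5" "j \<in> set (Z2 ! i)" for i j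
    using r[OF that(1,2)] that F(1)[of "r i j"] by (auto simp: zmat_def)
  obtain w where w: "w 3 = 0" "\<exists>j<5. w j \<noteq> 0"
    and e: "\<And>i. i < 5 \<Longrightarrow> i \<noteq> 4 \<Longrightarrow> (\<Sum>j<5. if j \<in> set (Z2 ! i) then r i j * w j else 0) = 0"
    using zmat_residue[OF n r, of 4 3] by auto
  have "r 0 0 = 1" "r 0 1 = 1" "r 0 2 = 1" "r 1 0 = 1" "r 1 4 = 1" "r 2 1 = 1" "r 2 4 = 1" "r 3 2 = 1" "r 3 4 = 1"
    by (rule one; simp add: Z2_def)+
  note R = this
  have "w 0 + w 1 + w 2 = 0" using e[of 0] R w(1) by (simp add: sum_lessThan_5 Z2_def)
  moreover have "w 0 + w 4 = 0" using e[of 1] R by (simp add: sum_lessThan_5 Z2_def)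
  moreover have "w 1 + w 4 = 0" using e[of 2] R by (simp add: sum_lessThan_5 Z2_def)
  moreover have "w 2 + w 4 = 0" using e[of 3] R w(1) by (simp add: sum_lessThan_5 Z2_def)
  moreover have "w 0 \<noteq> 0 \<or> w 1 \<noteq> 0 \<or> w 2 \<noteq> 0 \<or> w 4 \<noteq> 0" using w unfolding ex_less_5 by simp
  ultimately show False
    using F(1)[of "w 0"] F(1)[of "w 1"] F(1)[of "w 2"] F(1)[of "w 4"] F(2)
    by (elim disjE) (simp_all add: add.assoc)
qed (auto simp: zmat_def)

text \<open>The null vectors \<open>u\<close> and \<open>v\<close> are proportional, so
  \<open>u\<close> satisfies row 0 as well and has three equal terms there. After rescaling columns
  1 to 3 by \<open>u\<close>, the null vectors \<open>w\<close> and \<open>z\<close> give two linear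
  relations between nonzero elements, which are contradictory over three elements.\<close>

lemma kapranov_rank_Z3_ge:
  assumes c: "card (UNIV :: 'a::field set) = 3"
  shows "kapranov_rank TYPE('a) (zmat Z3) \<ge> 4"
proof (rule kapranov_rank_ge_4)
  fix r :: "nat \<Rightarrow> nat \<Rightarrow> 'a"
  assume n: "null_vectors r" and r: "\<And>i j. i < 5 \<Longrightarrow> j < 5 \<Longrightarrow> r i j \<noteq> 0 \<longleftrightarrow> zmat Z3 $$ (i, j) = 0"
  note F = field_three_elements[OF c]
  have sq: "x * x = 1" if "x \<noteq> 0" for x :: 'a using F(1)[of x] that by auto
  have neg: "b = - a" if "a \<noteq> b" "a \<noteq> 0" "b \<noteq> 0" for a b :: 'a using F(1)[of a] F(1)[of b] that by auto
  \<comment> \<open>Two different nonzero elements are opposite; they would cancel and leave the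
    nonzero third term.\<close>
  have three: "x = y \<and> y = z" if e: "x + y + z = 0" and n: "x \<noteq> 0" "y \<noteq> 0" "z \<noteq> 0" for x y z :: 'a
  proof
    show "x = y"
    proof (rule ccontr)
      assume "x \<noteq> y"
      then have "y = - x" using neg n by blast
      then show False using e n by simp
    qed
    show "y = z"
    proof (rule ccontr)
      assume "y \<noteq> z"
      then have "z = - y" using neg n by blast
      then show False using e n by simp
    qed
  qed
  have dbl: "x + x = - x" for x :: 'a
  proof -
    have "x + x = (1 + 1) * x" by (simp only: distrib_right mult_1)
    then show ?thesis unfolding F(2) by simp
  qed
  have cross: "x * y' = y * x'" if "a * x + b * y = 0" "a * x' + b * y' = 0" "a \<noteq> 0" for a b x y x' y' :: 'a
  proof -
    have e: "a * x = - (b * y)" "a * x' = - (b * y')" using that by (simp_all add: eq_neg_iff_add_eq_0)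
    have "a * (x * y') = (a * x) * y'" by (simp only: mult.assoc)
    also have "\<dots> = y * (a * x')" unfolding e by (simp add: mult.commute mult.left_commute)
    also have "\<dots> = a * (y * x')" by (simp only: mult.left_commute)
    finally show ?thesis using that(3) by simp
  qed
  have R: "r 0 0 \<noteq> 0" "r 0 1 \<noteq> 0" "r 0 2 \<noteq> 0" "r 0 3 \<noteq> 0" "r 1 0 \<noteq> 0" "r 1 4 \<noteq> 0" "r 2 1 \<noteq> 0" "r 2 2 \<noteq> 0" "r 2 4 \<noteq> 0"
    "r 3 1 \<noteq> 0" "r 3 3 \<noteq> 0" "r 3 4 \<noteq> 0" "r 4 2 \<noteq> 0" "r 4 3 \<noteq> 0" "r 4 4 \<noteq> 0"
    by (subst r; simp add: zmat_def Z3_def)+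
  note S = sum_lessThan_5 Z3_def
  obtain u where u: "u 4 = 0" "\<exists>j<5. u j \<noteq> 0"
    and eu: "\<And>i. i < 5 \<Longrightarrow> i \<noteq> 0 \<Longrightarrow> (\<Sum>j<5. if j \<in> set (Z3 ! i) then r i j * u j else 0) = 0"
    using zmat_residue[OF n r, of 0 4] by auto
  obtain v where v: "v 4 = 0" "\<exists>j<5. v j \<noteq> 0"
    and ev: "\<And>i. i < 5 \<Longrightarrow> i \<noteq> 2 \<Longrightarrow> (\<Sum>j<5. if j \<in> set (Z3 ! i) then r i j * v j else 0) = 0"
    using zmat_residue[OF n r, of 2 4] by auto
  obtain w where w: "w 1 = 0" "\<exists>j<5. w j \<noteq> 0"
    and ew: "\<And>i. i < 5 \<Longrightarrow> i \<noteq> 2 \<Longrightarrow> (\<Sum>j<5. if j \<in> set (Z3 ! i) then r i j * w j else 0) = 0"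
    using zmat_residue[OF n r, of 2 1] by auto
  obtain z where z: "z 2 = 0" "\<exists>j<5. z j \<noteq> 0"
    and ez: "\<And>i. i < 5 \<Longrightarrow> i \<noteq> 3 \<Longrightarrow> (\<Sum>j<5. if j \<in> set (Z3 ! i) then r i j * z j else 0) = 0"
    using zmat_residue[OF n r, of 3 2] by auto
  have u0: "u 0 = 0" using eu[of 1] R u(1) by (simp add: S)
  have u2: "r 2 1 * u 1 + r 2 2 * u 2 = 0" using eu[of 2] u(1) by (simp add: S)
  have u3: "r 3 1 * u 1 + r 3 3 * u 3 = 0" using eu[of 3] u(1) by (simp add: S)
  have u4: "r 4 2 * u 2 + r 4 3 * u 3 = 0" using eu[of 4] u(1) by (simp add: S)
  have "u 1 = 0 \<longleftrightarrow> u 2 = 0" using u2 R by auto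
  moreover have "u 1 = 0 \<longleftrightarrow> u 3 = 0" using u3 R by auto
  moreover have "u 1 \<noteq> 0 \<or> u 2 \<noteq> 0 \<or> u 3 \<noteq> 0" using u u0 unfolding ex_less_5 by simp
  ultimately have un: "u 1 \<noteq> 0" "u 2 \<noteq> 0" "u 3 \<noteq> 0" by blast+
  have v0: "v 0 = 0" using ev[of 1] R v(1) by (simp add: S)
  have v1: "r 0 1 * v 1 + r 0 2 * v 2 + r 0 3 * v 3 = 0" using ev[of 0] v0 by (simp add: S)
  have v3: "r 3 1 * v 1 + r 3 3 * v 3 = 0" using ev[of 3] v(1) by (simp add: S)
  have v4: "r 4 2 * v 2 + r 4 3 * v 3 = 0" using ev[of 4] v(1) by (simp add: S)
  have vn: "v 3 \<noteq> 0"
  proof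
    assume 0: "v 3 = 0"
    then have "v 1 = 0" "v 2 = 0" using v3 v4 R by simp_all
    then show False using v v0 0 unfolding ex_less_5 by simp
  qed
  have p1: "v 1 * u 3 = v 3 * u 1" by (rule cross[OF v3 u3]) (use R in simp)
  have p2: "v 2 * u 3 = v 3 * u 2" by (rule cross[OF v4 u4]) (use R in simp)
  have "v 3 * (r 0 1 * u 1 + r 0 2 * u 2 + r 0 3 * u 3) = r 0 1 * (v 3 * u 1) + r 0 2 * (v 3 * u 2) + r 0 3 * (v 3 * u 3)"
    by (simp add: algebra_simps)
  also have "\<dots> = (r 0 1 * v 1 + r 0 2 * v 2 + r 0 3 * v 3) * u 3" unfolding p1[symmetric] p2[symmetric] by (simp add: algebra_simps)
  also have "\<dots> = 0" unfolding v1 by simp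
  finally have "r 0 1 * u 1 + r 0 2 * u 2 + r 0 3 * u 3 = 0" using vn by simp
  from three[OF this] have X': "r 0 1 * u 1 = r 0 2 * u 2 \<and> r 0 2 * u 2 = r 0 3 * u 3" using R un by simp
  define X where "X = r 0 1 * u 1"
  have X0: "X \<noteq> 0" unfolding X_def mult_eq_0_iff using R(2) un(1) by blast
  have X: "r 0 1 * u 1 = X" "r 0 2 * u 2 = X" "r 0 3 * u 3 = X" "X \<noteq> 0"
    using X' X0 unfolding X_def by argo+
  define D where "D = r 4 2 * u 2"
  have D: "D \<noteq> 0" "r 4 3 * u 3 = - D" using R un u4 by (simp_all add: D_def eq_neg_iff_add_eq_0 add.commute)
  \<comment> \<open>Every nonzero element is its own inverse, so the rescaling by \<open>u k\<close>
    undoes itself.\<close>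
  have div: "x = u k * (u k * x)" if "k = 1 \<or> k = 2 \<or> k = 3" for k and x using sq un that by (auto simp: mult.assoc[symmetric])
  define W2 W3 Z1 Z3' where "W2 = u 2 * w 2" and "W3 = u 3 * w 3" and "Z1 = u 1 * z 1" and "Z3' = u 3 * z 3"
  have W: "w 2 = u 2 * W2" "w 3 = u 3 * W3" "z 1 = u 1 * Z1" "z 3 = u 3 * Z3'"
    unfolding W2_def W3_def Z1_def Z3'_def by (rule div; simp)+
  have w0: "r 0 0 * w 0 + X * W2 + X * W3 = 0" using ew[of 0] w(1) X(2,3) by (simp add: S W(1,2) mult.assoc[symmetric])
  have w1: "r 1 0 * w 0 + r 1 4 * w 4 = 0" using ew[of 1] by (simp add: S)
  have w3: "(r 3 3 * u 3) * W3 + r 3 4 * w 4 = 0" using ew[of 3] w(1) by (simp add: S W(2) mult.assoc)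
  have w4: "D * W2 - D * W3 + r 4 4 * w 4 = 0" using ew[of 4] D(2) by (simp add: S W(1,2) D_def mult.assoc[symmetric])
  have z0: "r 0 0 * z 0 + X * Z1 + X * Z3' = 0" using ez[of 0] z(1) X(1,3) by (simp add: S W(3)[unfolded One_nat_def] W(4) mult.assoc[symmetric])
  have z1: "r 1 0 * z 0 + r 1 4 * z 4 = 0" using ez[of 1] by (simp add: S)
  have z2: "(r 2 1 * u 1) * Z1 + r 2 4 * z 4 = 0" using ez[of 2] z(1) by (simp add: S W(3)[unfolded One_nat_def] mult.assoc)
  have z4: "- D * Z3' + r 4 4 * z 4 = 0" using ez[of 4] z(1) D(2) by (simp add: S W(4) mult.assoc[symmetric])
  have wn: "w 4 \<noteq> 0"
  proof
    assume 0: "w 4 = 0"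
    then have "w 0 = 0" "W3 = 0" using w1 w3 R un by simp_all
    moreover from this have "W2 = 0" using w4 0 D by simp
    ultimately show False using w 0 W unfolding ex_less_5 by simp
  qed
  have zn: "z 4 \<noteq> 0"
  proof
    assume 0: "z 4 = 0"
    then have "z 0 = 0" "Z1 = 0" "Z3' = 0" using z1 z2 z4 R un D by simp_all
    then show False using z 0 W unfolding ex_less_5 by simp
  qed
  have solve: "a * x + b = 0 \<Longrightarrow> x = - (a * b)" if "a \<noteq> 0" for a b x :: 'a
  proof -
    assume "a * x + b = 0"
    then have "a * x = - b" by (simp add: eq_neg_iff_add_eq_0)
    then have "a * (a * x) = a * - b" by simp
    then show "x = - (a * b)" using sq[OF that] by (simp add: mult.assoc[symmetric])
  qed
  \<comment> \<open>The coefficients that remain when the other entries are expressed by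
    \<open>w 4\<close> and \<open>z 4\<close>.\<close>
  define p q t y where "p = - (r 3 3 * u 3 * r 3 4)" and "q = D * r 4 4" and "t = r 2 1 * u 1 * r 2 4" and "y = X * r 0 0 * r 1 0 * r 1 4"
  have nz: "p \<noteq> 0" "q \<noteq> 0" "t \<noteq> 0" "y \<noteq> 0" using R un D X by (simp_all add: p_def q_def t_def y_def)
  have a: "w 0 = - (r 1 0 * r 1 4) * w 4" using solve[OF _ w1] R by (simp add: mult.assoc)
  have b: "W3 = p * w 4" using solve[OF _ w3] R un by (simp add: p_def mult.assoc)
  have "D * (W2 - W3) + r 4 4 * w 4 = 0" using w4 by (simp add: algebra_simps)
  from solve[OF D(1) this] have c: "W2 = W3 - q * w 4" by (simp add: q_def mult.assoc algebra_simps)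
  have "X * (W2 + W3) + r 0 0 * w 0 = 0" using w0 by (simp add: algebra_simps)
  from solve[OF X(4) this] have "W2 + W3 = y * w 4" unfolding a by (simp add: y_def mult.assoc)
  then have "w 4 * (p - q + p - y) = 0" unfolding c b by (simp add: algebra_simps)
  then have E1: "p - q + p - y = 0" using wn by simp
  have a': "z 0 = - (r 1 0 * r 1 4) * z 4" using solve[OF _ z1] R by (simp add: mult.assoc)
  have b': "Z1 = - t * z 4" using solve[OF _ z2] R un by (simp add: t_def mult.assoc)
  have c': "Z3' = q * z 4" using solve[OF _ z4] D by (simp add: q_def mult.assoc)
  have "X * (Z1 + Z3') + r 0 0 * z 0 = 0" using z0 by (simp add: algebra_simps)
  from solve[OF X(4) this] have "Z1 + Z3' = y * z 4" unfolding a' by (simp add: y_def mult.assoc)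
  then have "z 4 * (q - t - y) = 0" unfolding c' b' by (simp add: algebra_simps)
  then have E2: "q - t - y = 0" using zn by simp
  have "y = (p + p - q) - (p - q + p - y)" by (simp add: algebra_simps)
  then have y: "y = p + p - q" unfolding E1 by simp
  \<comment> \<open>For \<open>q = - p\<close> the first relation gives
    \<open>y = p + p + p = 0\<close>. For \<open>p = q\<close> it gives \<open>y = q\<close>, and
    the second relation leaves \<open>t = 0\<close>.\<close>
  have "p = q"
  proof (rule ccontr)
    assume "p \<noteq> q"
    then have "q = - p" using neg nz by blast
    then have "y = 0" using y unfolding dbl by simp
    with nz show False by simp
  qed
  then have "y = q" using y by simp
  then show False using E2 nz by simp
qed (auto simp: zmat_def)

theorem theorem12:
  shows "(\<exists>B :: real mat. B \<in> carrier_mat 5 5 \<and>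
            tropical_rank B = 3 \<and> kapranov_rank TYPE('a::field) B = 4)
         \<longleftrightarrow> finite (UNIV :: 'a set) \<and> card (UNIV :: 'a set) \<le> 3"
proof
  assume "\<exists>B :: real mat. B \<in> carrier_mat 5 5 \<and> tropical_rank B = 3 \<and> kapranov_rank TYPE('a::field) B = 4"
  then show "finite (UNIV :: 'a set) \<and> card (UNIV :: 'a set) \<le> 3" using small_field_if_gap by blast
next
  assume f: "finite (UNIV :: 'a set) \<and> card (UNIV :: 'a set) \<le> 3"
  have "card {0, 1 :: 'a} \<le> card (UNIV :: 'a set)" by (rule card_mono) (use f in auto)
  then have "card (UNIV :: 'a set) = 2 \<or> card (UNIV :: 'a set) = 3" using f by auto
  then show "\<exists>B :: real mat. B \<in> carrier_mat 5 5 \<and> tropical_rank B = 3 \<and> kapranov_rank TYPE('a::field) B = 4"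
  proof
    assume c: "card (UNIV :: 'a set) = 2"
    have "kapranov_rank TYPE('a) (zmat Z2) = 4" using kapranov_rank_Z2_ge[OF c] kapranov_rank_Z2_le[where 'a='a] by simp
    then show ?thesis using tropical_rank_Z2 by (intro exI[of _ "zmat Z2"]) (simp add: zmat_def)
  next
    assume c: "card (UNIV :: 'a set) = 3"
    have "kapranov_rank TYPE('a) (zmat Z3) = 4" using kapranov_rank_Z3_ge[OF c] kapranov_rank_Z3_le[OF c] by simp
    then show ?thesis using tropical_rank_Z3 by (intro exI[of _ "zmat Z3"]) (simp add: zmat_def)
  qed
qed

end
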